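(* Let $W\in L^2(I^2)$ be nonnegative and satisfy (W-1) and (W-2), and let $g\in L^2(I)$. Then for every $T>0$ there is a unique weak solution $\mathbf u$ on $[0,T]$ of the initial value problem $$\partial_tu(t,x)=f(u(t,x),t)+\int_IW(x,y)D\big(u(t,y)-u(t,x)\big)\,dy,\qquad u(0,x)=g(x),\qquad x\in I.$$ Moreover, $$\lim_{n\to\infty}\|\mathbf v_n-\mathbf u\|_{C(0,T;L^2(I))}=0,$$ where $\|\mathbf w\|_{C(0,T;L^2(I))}=\max_{t\in[0,T]}\|\mathbf w(t)\|_{L^2(I)}$ and $\mathbf v_n(t)=v_n(t,\cdot)$ is the (step function) solution of the averaged problem $$\partial_tv_n(t,x)=f(v_n(t,x),t)+\int_I\bar W_n(x,y)D\big(v_n(t,y)-v_n(t,x)\big)\,dy,\qquad v_n(0,x)=g_n(x).$$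
   Context: $I=[0,1]$, $[n]=\{1,\dots,n\}$, $I_{n,i}=((i-1)/n,\,i/n]$. For an integrable function, $\langle V\rangle_{I_{n,i}\times I_{n,j}}=n^2\int_{I_{n,i}\times I_{n,j}}V(x,y)\,dx\,dy$. $a\wedge b=\min\{a,b\}$. Nonlinearities: $D:\mathbb R\to\mathbb R$ is $2\pi$-periodic and Lipschitz continuous with $\max|D|=1$. $f:\mathbb R\times\mathbb R\to\mathbb R$, $(u,t)\mapsto f(u,t)$, is Lipschitz continuous in $u$ (with constant independent of $t$) and continuous in $t$. Conditions on $W$: with $W_n(x,y)=\sum_{i,j=1}^n\langle W\rangle_{I_{n,i}\times I_{n,j}}\mathbf 1_{I_{n,i}\times I_{n,j}}(x,y)$, (W-1) $\sup_{n\in\mathbb N}\sup_{y\in I}\int_0^1W_n(x,y)\,dx<\infty$; (W-2) $\sup_{n\in\mathbb N}\sup_{x\in I}\int_0^1W_n(x,y)\,dy<\infty$. Discretization: $(\alpha_n)$ is a sequence with $1\ge\alpha_n\searrow0$ and $n\alpha_n\to\infty$; $\tilde W_n=\alpha_n^{-1}\wedge W$, $\bar W_{n,ij}=\langle\tilde W_n\rangle_{I_{n,i}\times I_{n,j}}$, $\bar W_n(x,y)=\sum_{i,j=1}^n\bar W_{n,ij}\mathbf 1_{I_{n,i}}(x)\mathbf 1_{I_{n,j}}(y)$, and $g_n(x)=\sum_{i=1}^n\big(n\int_{I_{n,i}}g\big)\mathbf 1_{I_{n,i}}(x)$. The solution of the averaged problem has the form $v_n(t,x)=\sum_{i=1}^nv_{n,i}(t)\mathbf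 1_{I_{n,i}}(x)$. Weak solution: with $X=L^2(I)$ and inner product $(\cdot,\cdot)$, and $K(u)(x)=\int_IW(x,y)D(u(y)-u(x))\,dy$, a function $\mathbf u\in H^1(0,T;X)$ is a weak solution on $[0,T]$ if $(\mathbf u'(t)-K(\mathbf u(t))-f(\mathbf u(t),t),\mathbf v)=0$ for all $\mathbf v\in X$ for a.e. $t\in[0,T]$, and $\mathbf u(0)=g$ (continuous representative). *)

theory Defs
  imports "HOL-Analysis.Analysis"
begin

section \<open>The Hilbert space \<open>L\<^sup>2(0,1)\<close>\<close>

definition square_integrable :: "'a::euclidean_space set \<Rightarrow> ('a \<Rightarrow> real) \<Rightarrow> bool" where
  "square_integrable S h \<longleftrightarrow>
     h \<in> borel_measurable (lebesgue_on S) \<and> integrable (lebesgue_on S) (\<lambda>x. (h x)\<^sup>2)"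

abbreviation leb01 :: "real measure" where
  "leb01 \<equiv> lebesgue_on {0..1}"

lemma square_integrable_mult:
  assumes "square_integrable S h" "square_integrable S k"
  shows "integrable (lebesgue_on S) (\<lambda>x. h x * k x)"
proof (rule Bochner_Integration.integrable_bound)
  show "integrable (lebesgue_on S) (\<lambda>x. (h x)\<^sup>2 + (k x)\<^sup>2)"
    using assms by (auto simp: square_integrable_def)
  show "(\<lambda>x. h x * k x) \<in> borel_measurable (lebesgue_on S)"
    using assms by (auto simp: square_integrable_def)
  have "\<bar>a * b\<bar> \<le> a\<^sup>2 + b\<^sup>2" for a b :: real
  proof -
    have "2 * (\<bar>a\<bar> * \<bar>b\<bar>) \<le> a\<^sup>2 + b\<^sup>2"
      using sum_squares_bound[of "\<bar>a\<bar>" "\<bar>b\<bar>"] by simp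
    moreover have "0 \<le> \<bar>a\<bar> * \<bar>b\<bar>" by simp
    ultimately show ?thesis unfolding abs_mult by linarith
  qed
  then show "AE x in lebesgue_on S. norm (h x * k x) \<le> norm ((h x)\<^sup>2 + (k x)\<^sup>2)"
    by auto
qed

lemma square_integrable_add:
  assumes "square_integrable S h" "square_integrable S k"
  shows "square_integrable S (\<lambda>x. h x + k x)"
proof -
  have "integrable (lebesgue_on S) (\<lambda>x. (h x)\<^sup>2 + (k x)\<^sup>2 + 2 * (h x * k x))"
    using assms square_integrable_mult[OF assms] by (auto simp: square_integrable_def)
  then have "integrable (lebesgue_on S) (\<lambda>x. (h x + k x)\<^sup>2)"
    by (simp add: power2_sum mult.assoc)
  then show ?thesis using assms by (auto simp: square_integrable_def)
qed

lemma square_integrable_scale: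
  assumes "square_integrable S h" shows "square_integrable S (\<lambda>x. c * h x)"
  using assms by (auto simp: square_integrable_def power_mult_distrib)

lemma square_integrable_uminus:
  assumes "square_integrable S h" shows "square_integrable S (\<lambda>x. - h x)"
  using assms by (auto simp: square_integrable_def)

lemma square_integrable_diff:
  assumes "square_integrable S h" "square_integrable S k"
  shows "square_integrable S (\<lambda>x. h x - k x)"
  using square_integrable_add[OF assms(1) square_integrable_uminus[OF assms(2)]] by simp

lemma square_integrable_zero: "square_integrable S (\<lambda>x. 0)"
  by (auto simp: square_integrable_def)

definition L2_rel :: "(real \<Rightarrow> real) \<Rightarrow> (real \<Rightarrow> real) \<Rightarrow> bool" where
  "L2_rel h k \<longleftrightarrow> square_integrable {0..1} h \<and> square_integrable {0..1} k \<and>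
     (AE x in leb01. h x = k x)"

quotient_type L2 = "real \<Rightarrow> real" / partial: L2_rel
proof (rule part_equivpI)
  show "\<exists>h. L2_rel h h"
    using square_integrable_zero by (auto simp: L2_rel_def)
  show "symp L2_rel" by (auto simp: symp_def L2_rel_def)
  show "transp L2_rel" by (auto simp: transp_def L2_rel_def)
qed

lemma square_integrable_rep: "square_integrable {0..1} (rep_L2 u)"
  using Quotient3_rep_reflp[OF Quotient3_L2] by (auto simp: L2_rel_def)

lemma abs_rep_L2: "abs_L2 (rep_L2 u) = u"
  using Quotient3_abs_rep[OF Quotient3_L2] by auto

lemma abs_L2_eq_iff:
  assumes "square_integrable {0..1} h" "square_integrable {0..1} k"
  shows "abs_L2 h = abs_L2 k \<longleftrightarrow> (AE x in leb01. h x = k x)"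
  using Quotient3_rel[OF Quotient3_L2, of h k] assms by (auto simp: L2_rel_def)

lemma rep_abs_L2:
  assumes "square_integrable {0..1} h"
  shows "AE x in leb01. rep_L2 (abs_L2 h) x = h x"
  using abs_L2_eq_iff[OF square_integrable_rep assms] abs_rep_L2 by auto

instantiation L2 :: real_vector
begin

lift_definition zero_L2 :: L2 is "\<lambda>x. 0"
  by (auto simp: L2_rel_def square_integrable_zero)

lift_definition plus_L2 :: "L2 \<Rightarrow> L2 \<Rightarrow> L2" is "\<lambda>h k x. h x + k x"
  by (auto simp: L2_rel_def square_integrable_add)

lift_definition minus_L2 :: "L2 \<Rightarrow> L2 \<Rightarrow> L2" is "\<lambda>h k x. h x - k x"
  by (auto simp: L2_rel_def square_integrable_diff)

lift_definition uminus_L2 :: "L2 \<Rightarrow> L2" is "\<lambda>h x. - h x"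
  by (auto simp: L2_rel_def square_integrable_uminus)

lift_definition scaleR_L2 :: "real \<Rightarrow> L2 \<Rightarrow> L2" is "\<lambda>c h x. c * h x"
  by (auto simp: L2_rel_def square_integrable_scale)

instance
  by standard
    (transfer; auto simp: L2_rel_def algebra_simps
       intro!: square_integrable_zero square_integrable_add square_integrable_scale
         square_integrable_diff square_integrable_uminus)+

end

instantiation L2 :: real_inner
begin

lift_definition inner_L2 :: "L2 \<Rightarrow> L2 \<Rightarrow> real" is "\<lambda>h k. LINT x|leb01. h x * k x"
  by (rule integral_cong_AE) (auto simp: L2_rel_def square_integrable_def)

definition norm_L2 :: "L2 \<Rightarrow> real" where
  "norm_L2 u = sqrt (inner u u)"

definition sgn_L2 :: "L2 \<Rightarrow> L2" where
  "sgn_L2 u = u /\<^sub>R norm u"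

definition dist_L2 :: "L2 \<Rightarrow> L2 \<Rightarrow> real" where
  "dist_L2 u v = norm (u - v)"

definition uniformity_L2 :: "(L2 \<times> L2) filter" where
  "uniformity_L2 = (INF e\<in>{0 <..}. principal {(u, v). dist u v < e})"

definition open_L2 :: "L2 set \<Rightarrow> bool" where
  "open_L2 U = (\<forall>u\<in>U. eventually (\<lambda>(u', v). u' = u \<longrightarrow> v \<in> U) uniformity)"

instance
proof
  fix x y z :: L2 and r :: real
  show "inner x y = inner y x"
    by transfer (simp add: mult.commute)
  show "inner (x + y) z = inner x z + inner y z"
    by transfer (simp add: L2_rel_def distrib_right square_integrable_mult)
  show "inner (r *\<^sub>R x) y = r * inner x y"
    by transfer (simp add: mult.assoc)
  show "0 \<le> inner x x"
    by transfer simp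
  show "inner x x = 0 \<longleftrightarrow> x = 0"
  proof (transfer, goal_cases)
    case (1 h)
    then have h: "square_integrable {0..1} h" by (simp add: L2_rel_def)
    have "((LINT x|leb01. h x * h x) = 0) \<longleftrightarrow> (AE x in leb01. h x * h x = 0)"
      by (rule integral_nonneg_eq_0_iff_AE) (use square_integrable_mult[OF h h] in auto)
    then show ?case
      using h by (simp add: L2_rel_def square_integrable_zero)
  qed
qed (rule norm_L2_def sgn_L2_def dist_L2_def uniformity_L2_def open_L2_def)+

end


lemma L2_rel_refl: "L2_rel h h \<longleftrightarrow> square_integrable {0..1} h"
  by (simp add: L2_rel_def)

lemma norm_abs_L2:
  assumes "square_integrable {0..1} h"
  shows "(norm (abs_L2 h))\<^sup>2 = (LINT x|leb01. (h x)\<^sup>2)"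
  using assms unfolding power2_norm_eq_inner
  by (simp add: inner_L2.abs_eq L2_rel_refl power2_eq_square[of "h _"])

lemma nn_norm_abs_L2:
  assumes "square_integrable {0..1} h"
  shows "(\<integral>\<^sup>+x. ennreal ((h x)\<^sup>2) \<partial>leb01) = ennreal ((norm (abs_L2 h))\<^sup>2)"
  unfolding norm_abs_L2[OF assms]
  using assms by (intro nn_integral_eq_integral) (auto simp: square_integrable_def)

lemma abs_L2_add:
  assumes "square_integrable {0..1} h" "square_integrable {0..1} k"
  shows "abs_L2 (\<lambda>x. h x + k x) = abs_L2 h + abs_L2 k"
  using assms by (simp add: plus_L2.abs_eq L2_rel_refl)

lemma abs_L2_diff:
  assumes "square_integrable {0..1} h" "square_integrable {0..1} k"
  shows "abs_L2 (\<lambda>x. h x - k x) = abs_L2 h - abs_L2 k"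
  using assms by (simp add: minus_L2.abs_eq L2_rel_refl)

lemma abs_L2_scale:
  assumes "square_integrable {0..1} h"
  shows "abs_L2 (\<lambda>x. c * h x) = c *\<^sub>R abs_L2 h"
  using assms by (simp add: scaleR_L2.abs_eq L2_rel_refl)

lemma square_integrable_indicator:
  assumes "A \<in> sets lebesgue"
  shows "square_integrable {0..1::real} (indicator A)"
proof -
  have m: "indicator A \<in> borel_measurable leb01"
    using assms by (intro measurable_restrict_space1) auto
  moreover have "integrable leb01 (\<lambda>x. (indicator A x)\<^sup>2 :: real)"
  proof (rule finite_measure.integrable_const_bound[where B=1])
    show "finite_measure leb01"
      by (rule finite_measureI) (simp add: emeasure_restrict_space space_restrict_space)
    show "(\<lambda>x. (indicator A x)\<^sup>2 :: real) \<in> borel_measurable leb01"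
      using m by measurable
  qed (auto simp: indicator_def)
  ultimately show ?thesis by (simp add: square_integrable_def)
qed

lemma L1_le_L2:
  assumes h: "square_integrable {0..1} h"
  shows "(\<integral>\<^sup>+x. ennreal \<bar>h x\<bar> \<partial>leb01) \<le> ennreal (norm (abs_L2 h))"
proof -
  let ?i = "indicator UNIV :: real \<Rightarrow> real"
  have i: "square_integrable {0..1} ?i" by (rule square_integrable_indicator) auto
  have h': "square_integrable {0..1} (\<lambda>x. \<bar>h x\<bar>)"
    using h by (auto simp: square_integrable_def)
  have int: "integrable leb01 (\<lambda>x. \<bar>h x\<bar>)"
    using square_integrable_mult[OF h' i] by simp
  have n1: "(norm (abs_L2 (\<lambda>x. \<bar>h x\<bar>)))\<^sup>2 = (norm (abs_L2 h))\<^sup>2"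
    by (simp add: norm_abs_L2[OF h] norm_abs_L2[OF h'])
  have n2: "(norm (abs_L2 ?i))\<^sup>2 = 1\<^sup>2"
    unfolding norm_abs_L2[OF i] by (simp add: space_restrict_space measure_restrict_space)
  have "(LINT x|leb01. \<bar>h x\<bar>) = inner (abs_L2 (\<lambda>x. \<bar>h x\<bar>)) (abs_L2 ?i)"
    using h' i by (simp add: inner_L2.abs_eq L2_rel_refl)
  also have "\<dots> \<le> norm (abs_L2 (\<lambda>x. \<bar>h x\<bar>)) * norm (abs_L2 ?i)"
    by (rule norm_cauchy_schwarz)
  also have "\<dots> = norm (abs_L2 h)"
    using n1 n2 power2_eq_imp_eq[OF n1] power2_eq_imp_eq[OF n2] by (metis mult.right_neutral norm_ge_zero zero_le_one)
  finally have "(LINT x|leb01. \<bar>h x\<bar>) \<le> norm (abs_L2 h)" .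
  then show ?thesis
    by (subst nn_integral_eq_integral[OF int]) (auto intro: ennreal_leI)
qed

lemma square_integrable_limit:
  assumes h: "\<And>m. square_integrable {0..1} (h m)"
    and H: "H \<in> borel_measurable leb01"
    and lim: "AE x in leb01. (\<lambda>m. h m x) \<longlonglongrightarrow> H x"
    and le: "\<And>m. m \<ge> k \<Longrightarrow> norm (abs_L2 (h m) - abs_L2 (h k)) \<le> e"
    and e: "0 \<le> e"
  shows "square_integrable {0..1} H \<and> norm (abs_L2 H - abs_L2 (h k)) \<le> e"
proof -
  have hm: "h m \<in> borel_measurable leb01" for m
    using h[of m] by (simp add: square_integrable_def)
  have d: "square_integrable {0..1} (\<lambda>x. h m x - h k x)" for m
    by (rule square_integrable_diff[OF h h])
  have "(\<integral>\<^sup>+x. ennreal ((H x - h k x)\<^sup>2) \<partial>leb01)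
      = (\<integral>\<^sup>+x. liminf (\<lambda>m. ennreal ((h m x - h k x)\<^sup>2)) \<partial>leb01)"
  proof (rule nn_integral_cong_AE)
    show "AE x in leb01. ennreal ((H x - h k x)\<^sup>2) = liminf (\<lambda>m. ennreal ((h m x - h k x)\<^sup>2))"
      using lim
    proof eventually_elim
      case (elim x)
      have "(\<lambda>m. ennreal ((h m x - h k x)\<^sup>2)) \<longlonglongrightarrow> ennreal ((H x - h k x)\<^sup>2)"
        by (intro tendsto_ennrealI tendsto_intros elim)
      then show ?case
        by (intro lim_imp_Liminf[symmetric]) auto
    qed
  qed
  also have "\<dots> \<le> liminf (\<lambda>m. \<integral>\<^sup>+x. ennreal ((h m x - h k x)\<^sup>2) \<partial>leb01)"
    using hm by (intro nn_integral_liminf) measurable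
  also have "\<dots> \<le> liminf (\<lambda>m::nat. ennreal (e\<^sup>2))"
  proof (rule Liminf_mono)
    show "\<forall>\<^sub>F m in sequentially. (\<integral>\<^sup>+x. ennreal ((h m x - h k x)\<^sup>2) \<partial>leb01) \<le> ennreal (e\<^sup>2)"
      using eventually_ge_at_top[of k]
    proof eventually_elim
      case (elim m)
      then show ?case
        unfolding nn_norm_abs_L2[OF d] abs_L2_diff[OF h h]
        by (intro ennreal_leI power_mono le) auto
    qed
  qed
  also have "\<dots> = ennreal (e\<^sup>2)" by (simp add: Liminf_const)
  finally have bound: "(\<integral>\<^sup>+x. ennreal ((H x - h k x)\<^sup>2) \<partial>leb01) \<le> ennreal (e\<^sup>2)" .
  have "integrable leb01 (\<lambda>x. (H x - h k x)\<^sup>2)"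
  proof (rule integrableI_nonneg)
    show "(\<lambda>x. (H x - h k x)\<^sup>2) \<in> borel_measurable leb01"
      using H hm by measurable
    show "(\<integral>\<^sup>+x. ennreal ((H x - h k x)\<^sup>2) \<partial>leb01) < \<infinity>"
      using bound by (metis ennreal_less_top infinity_ennreal_def le_less_trans)
  qed auto
  then have Hd: "square_integrable {0..1} (\<lambda>x. H x - h k x)"
    using H hm by (auto simp: square_integrable_def)
  have HS: "square_integrable {0..1} H"
    using square_integrable_add[OF Hd h[of k]] by simp
  have "(norm (abs_L2 H - abs_L2 (h k)))\<^sup>2 \<le> e\<^sup>2"
    using bound unfolding nn_norm_abs_L2[OF Hd] abs_L2_diff[OF HS h]
    by (simp add: ennreal_le_iff)
  then show ?thesis using HS e power2_le_imp_le by blast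
qed

instance L2 :: banach
proof
  fix X :: "nat \<Rightarrow> L2"
  assume C: "Cauchy X"
  have "\<exists>N. \<forall>m\<ge>N. \<forall>n\<ge>N. dist (X m) (X n) < (1/2)^k" for k :: nat
    using C by (auto simp: Cauchy_def)
  then obtain N where N: "\<And>k m n. m \<ge> N k \<Longrightarrow> n \<ge> N k \<Longrightarrow> dist (X m) (X n) < (1/2)^k"
    by metis
  define r where "r k = k + (\<Sum>i\<le>k. N i)" for k
  have r: "strict_mono r"
    by (auto simp: strict_mono_Suc_iff r_def)
  have rN: "N k \<le> r m" if "k \<le> m" for k m
    using member_le_sum[of k "{..m}" N] that by (simp add: r_def)
  define h where "h k = rep_L2 (X (r k))" for k
  have h: "square_integrable {0..1} (h k)" for k
    by (simp add: h_def square_integrable_rep)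
  have hm [measurable]: "h k \<in> borel_measurable leb01" for k
    using h[of k] by (simp add: square_integrable_def)
  have ah: "abs_L2 (h k) = X (r k)" for k
    by (simp add: h_def abs_rep_L2)
  have close: "norm (abs_L2 (h m) - abs_L2 (h k)) \<le> (1/2)^k" if "m \<ge> k" for m k
    unfolding ah dist_norm[symmetric] using N[OF rN[OF that] rN[OF order_refl]] by simp
  have "(\<integral>\<^sup>+x. (\<Sum>k. ennreal \<bar>h (Suc k) x - h k x\<bar>) \<partial>leb01)
      = (\<Sum>k. \<integral>\<^sup>+x. ennreal \<bar>h (Suc k) x - h k x\<bar> \<partial>leb01)"
    by (rule nn_integral_suminf) measurable
  also have "\<dots> \<le> (\<Sum>k. ennreal ((1/2)^k))"
  proof (rule suminf_le)
    fix k
    have "(\<integral>\<^sup>+x. ennreal \<bar>h (Suc k) x - h k x\<bar> \<partial>leb01)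
        \<le> ennreal (norm (abs_L2 (h (Suc k)) - abs_L2 (h k)))"
      using L1_le_L2[OF square_integrable_diff[OF h h]] by (simp add: abs_L2_diff[OF h h])
    also have "\<dots> \<le> ennreal ((1/2)^k)"
      by (intro ennreal_leI close) simp
    finally show "(\<integral>\<^sup>+x. ennreal \<bar>h (Suc k) x - h k x\<bar> \<partial>leb01) \<le> ennreal ((1/2)^k)" .
  qed auto
  also have "\<dots> = ennreal (\<Sum>k. (1/2)^k)"
    by (rule suminf_ennreal2) (auto intro!: summable_geometric)
  also have "\<dots> < \<infinity>" by simp
  finally have "(\<integral>\<^sup>+x. (\<Sum>k. ennreal \<bar>h (Suc k) x - h k x\<bar>) \<partial>leb01) \<noteq> \<infinity>" by simp
  then have "AE x in leb01. (\<Sum>k. ennreal \<bar>h (Suc k) x - h k x\<bar>) \<noteq> \<infinity>"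
    by (intro nn_integral_PInf_AE) auto
  then have conv: "AE x in leb01. convergent (\<lambda>k. h k x)"
  proof eventually_elim
    case (elim x)
    then have "summable (\<lambda>k. \<bar>h (Suc k) x - h k x\<bar>)"
      by (intro summable_suminf_not_top) auto
    then have "summable (\<lambda>k. h (Suc k) x - h k x)"
      by (rule summable_rabs_cancel)
    then have "convergent (\<lambda>n. \<Sum>k<n. h (Suc k) x - h k x)"
      by (simp add: summable_iff_convergent)
    then have "convergent (\<lambda>n. h n x - h 0 x)"
      unfolding sum_lessThan_telescope[of "\<lambda>k. h k x"] .
    then have "convergent (\<lambda>n. (h n x - h 0 x) + h 0 x)"
      by (intro convergent_add convergent_const)
    then show ?case by simp
  qed
  define H where "H x = lim (\<lambda>k. h k x)" for x
  have H: "H \<in> borel_measurable leb01"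
    unfolding H_def by measurable
  have lim: "AE x in leb01. (\<lambda>k. h k x) \<longlonglongrightarrow> H x"
    using conv by eventually_elim (simp add: H_def convergent_LIMSEQ_iff)
  have lH: "norm (abs_L2 H - X (r k)) \<le> (1/2)^k" for k
    using square_integrable_limit[OF h H lim close, of k] by (auto simp: ah)
  have "(\<lambda>k. X (r k)) \<longlonglongrightarrow> abs_L2 H"
  proof (rule LIM_zero_cancel, rule Lim_null_comparison)
    show "\<forall>\<^sub>F k in sequentially. norm (X (r k) - abs_L2 H) \<le> (1/2)^k"
      using lH by (auto simp: norm_minus_commute)
    show "(\<lambda>k. (1/2)^k :: real) \<longlonglongrightarrow> 0" by (rule LIMSEQ_realpow_zero) auto
  qed
  then have "X \<longlonglongrightarrow> abs_L2 H"
    using Cauchy_converges_subseq[OF C r] by (simp add: o_def)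
  then show "convergent X" by (auto simp: convergent_def)
qed

lemma L2_dominated:
  assumes h: "\<And>m. square_integrable {0..1} (h m)"
    and H: "square_integrable {0..1} H" and k: "square_integrable {0..1} k"
    and lim: "\<And>x. (\<lambda>m. h m x) \<longlonglongrightarrow> H x"
    and le: "\<And>m x. \<bar>h m x\<bar> \<le> k x"
  shows "(\<lambda>m. abs_L2 (h m)) \<longlonglongrightarrow> abs_L2 H"
proof -
  have "(\<lambda>m. LINT x|leb01. (h m x - H x)\<^sup>2) \<longlonglongrightarrow> (LINT x|leb01. 0)"
  proof (rule integral_dominated_convergence[where w="\<lambda>x. (2 * k x)\<^sup>2"])
    show "integrable leb01 (\<lambda>x. (2 * k x)\<^sup>2)"
      using square_integrable_scale[OF k, of 2] by (simp add: square_integrable_def)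
    show "AE x in leb01. (\<lambda>m. (h m x - H x)\<^sup>2) \<longlonglongrightarrow> 0"
    proof (rule AE_I2)
      fix x
      have "(\<lambda>m. (h m x - H x)\<^sup>2) \<longlonglongrightarrow> (H x - H x)\<^sup>2"
        by (intro tendsto_intros lim)
      then show "(\<lambda>m. (h m x - H x)\<^sup>2) \<longlonglongrightarrow> 0" by simp
    qed
    show "AE x in leb01. norm ((h m x - H x)\<^sup>2) \<le> (2 * k x)\<^sup>2" for m
    proof (rule AE_I2)
      fix x
      have "\<bar>H x\<bar> \<le> k x"
        by (rule Lim_bounded[OF tendsto_rabs[OF lim], of 0]) (simp add: le)
      then have "\<bar>h m x - H x\<bar> \<le> 2 * k x" using le[of m x] by linarith
      then have "\<bar>h m x - H x\<bar>\<^sup>2 \<le> (2 * k x)\<^sup>2" by (rule power_mono) simp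
      then show "norm ((h m x - H x)\<^sup>2) \<le> (2 * k x)\<^sup>2" by simp
    qed
  qed (use square_integrable_diff[OF h H] in \<open>auto simp: square_integrable_def\<close>)
  then have "(\<lambda>m. (norm (abs_L2 (h m) - abs_L2 H))\<^sup>2) \<longlonglongrightarrow> 0"
    by (simp add: norm_abs_L2[OF square_integrable_diff[OF h H], unfolded abs_L2_diff[OF h H]])
  then have "(\<lambda>m. sqrt ((norm (abs_L2 (h m) - abs_L2 H))\<^sup>2)) \<longlonglongrightarrow> sqrt 0"
    by (rule tendsto_real_sqrt)
  then have "(\<lambda>m. norm (abs_L2 (h m) - abs_L2 H)) \<longlonglongrightarrow> 0" by simp
  then show ?thesis
    by (rule LIM_zero_cancel[OF tendsto_norm_zero_cancel])
qed

definition L2_dense :: "L2 set" where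
  "L2_dense = range (\<lambda>xs :: (rat \<times> rat) list.
     \<Sum>(c, q)\<leftarrow>xs. real_of_rat c *\<^sub>R abs_L2 (indicator {..real_of_rat q}))"

lemma subspace_closure_L2_dense: "subspace (closure L2_dense)"
proof -
  let ?F = "\<lambda>xs :: (rat \<times> rat) list.
     \<Sum>(c, q)\<leftarrow>xs. real_of_rat c *\<^sub>R abs_L2 (indicator {..real_of_rat q})"
  have add: "x + y \<in> L2_dense" if "x \<in> L2_dense" "y \<in> L2_dense" for x y
  proof -
    from that obtain xs ys where "x = ?F xs" "y = ?F ys" by (auto simp: L2_dense_def)
    then have "x + y = ?F (xs @ ys)" by simp
    then show ?thesis unfolding L2_dense_def by blast
  qed
  have scale: "real_of_rat d *\<^sub>R x \<in> L2_dense" if "x \<in> L2_dense" for d x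
  proof -
    from that obtain xs where x: "x = ?F xs" by (auto simp: L2_dense_def)
    have "real_of_rat d *\<^sub>R ?F xs = ?F (map (\<lambda>(c, q). (d * c, q)) xs)"
      by (induction xs) (auto simp: scaleR_add_right of_rat_mult)
    then show ?thesis unfolding L2_dense_def x by blast
  qed
  have scale': "real_of_rat d *\<^sub>R x \<in> closure L2_dense" if x: "x \<in> closure L2_dense" for d x
  proof -
    obtain s where "\<And>n. s n \<in> L2_dense" "s \<longlonglongrightarrow> x"
      using x by (auto simp: closure_sequential)
    then have "\<And>n. real_of_rat d *\<^sub>R s n \<in> L2_dense"
      "(\<lambda>n. real_of_rat d *\<^sub>R s n) \<longlonglongrightarrow> real_of_rat d *\<^sub>R x"
      by (auto intro!: scale tendsto_intros)
    then show ?thesis by (force simp: closure_sequential)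
  qed
  show ?thesis
  proof (rule subspaceI)
    have "?F [] \<in> L2_dense" unfolding L2_dense_def by (rule rangeI)
    then show "0 \<in> closure L2_dense" using closure_subset by auto
  next
    fix x y assume "x \<in> closure L2_dense" "y \<in> closure L2_dense"
    then obtain s t where "\<And>n. s n \<in> L2_dense" "s \<longlonglongrightarrow> x" "\<And>n. t n \<in> L2_dense" "t \<longlonglongrightarrow> y"
      by (auto simp: closure_sequential)
    then have "\<And>n. s n + t n \<in> L2_dense" "(\<lambda>n. s n + t n) \<longlonglongrightarrow> x + y"
      by (auto intro!: add tendsto_intros)
    then show "x + y \<in> closure L2_dense" by (force simp: closure_sequential)
  next
    fix c x assume x: "x \<in> closure L2_dense"
    have "\<exists>d. c < real_of_rat d \<and> real_of_rat d < c + 1 / Suc n" for n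
      by (rule of_rat_dense) simp
    then obtain d where d: "\<And>n. c < real_of_rat (d n)" "\<And>n. real_of_rat (d n) < c + 1 / Suc n"
      by metis
    have "(\<lambda>n. real_of_rat (d n)) \<longlonglongrightarrow> c"
    proof (rule tendsto_sandwich[where f="\<lambda>n. c" and h="\<lambda>n. c + 1 / Suc n"])
      have "(\<lambda>n. c + 1 / Suc n) \<longlonglongrightarrow> c + 0"
        by (intro tendsto_add tendsto_const LIMSEQ_Suc[OF lim_1_over_n])
      then show "(\<lambda>n. c + 1 / Suc n) \<longlonglongrightarrow> c" by simp
    qed (use d in \<open>auto intro!: always_eventually less_imp_le\<close>)
    then have "(\<lambda>n. real_of_rat (d n) *\<^sub>R x) \<longlonglongrightarrow> c *\<^sub>R x"
      by (intro tendsto_intros)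
    then show "c *\<^sub>R x \<in> closure L2_dense"
      by (rule closed_sequentially[OF closed_closure, rotated]) (rule scale'[OF x])
  qed
qed

lemma indicator_in_closure_L2_dense:
  assumes "A \<in> sets borel"
  shows "abs_L2 (indicator A) \<in> closure L2_dense"
proof -
  note S = subspace_closure_L2_dense
  have sq: "square_integrable {0..1::real} (indicator B)" if "B \<in> sets borel" for B :: "real set"
    using that by (intro square_integrable_indicator) auto
  have one: "square_integrable {0..1::real} (indicator UNIV)"
    by (rule sq) simp
  have gen: "abs_L2 (indicator {..real_of_rat q}) \<in> closure L2_dense" for q
  proof -
    have "abs_L2 (indicator {..real_of_rat q}) = (\<Sum>(c, q)\<leftarrow>[(1::rat, q)].
        real_of_rat c *\<^sub>R abs_L2 (indicator {..real_of_rat q}))" by simp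
    then have "abs_L2 (indicator {..real_of_rat q}) \<in> L2_dense"
      unfolding L2_dense_def by blast
    then show ?thesis using closure_subset by auto
  qed
  have atMost: "abs_L2 (indicator {..a}) \<in> closure L2_dense" for a
  proof -
    have "\<exists>d. a < real_of_rat d \<and> real_of_rat d < a + 1 / Suc n" for n
      by (rule of_rat_dense) simp
    then obtain d where d: "\<And>n. a < real_of_rat (d n)" "\<And>n. real_of_rat (d n) < a + 1 / Suc n"
      by metis
    have dl: "(\<lambda>n. real_of_rat (d n)) \<longlonglongrightarrow> a"
    proof (rule tendsto_sandwich[where f="\<lambda>n. a" and h="\<lambda>n. a + 1 / Suc n"])
      have "(\<lambda>n. a + 1 / Suc n) \<longlonglongrightarrow> a + 0"
        by (intro tendsto_add tendsto_const LIMSEQ_Suc[OF lim_1_over_n])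
      then show "(\<lambda>n. a + 1 / Suc n) \<longlonglongrightarrow> a" by simp
    qed (use d in \<open>auto intro!: always_eventually less_imp_le\<close>)
    have "(\<lambda>n. abs_L2 (indicator {..real_of_rat (d n)})) \<longlonglongrightarrow> abs_L2 (indicator {..a})"
    proof (rule L2_dominated[where k="indicator UNIV"])
      fix x :: real
      show "(\<lambda>n. indicator {..real_of_rat (d n)} x :: real) \<longlonglongrightarrow> indicator {..a} x"
      proof (cases "x \<le> a")
        case True
        then have "x \<le> real_of_rat (d n)" for n using d(1)[of n] by linarith
        then show ?thesis using True by (simp add: indicator_def)
      next
        case False
        then have "\<forall>\<^sub>F n in sequentially. real_of_rat (d n) < x"
          using order_tendstoD(2)[OF dl] by simp
        then have "\<forall>\<^sub>F n in sequentially. indicator {..real_of_rat (d n)} x = (0::real)"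
          by eventually_elim (simp add: indicator_def)
        then show ?thesis using False by (simp add: tendsto_eventually)
      qed
    qed (simp_all add: sq one del: indicator_UNIV)
    then show ?thesis by (rule closed_sequentially[OF closed_closure, rotated]) (rule gen)
  qed
  have "Int_stable (range (\<lambda>a::real. {..a}))"
    by (auto simp: Int_stable_def)
  moreover have "range (\<lambda>a::real. {..a}) \<subseteq> Pow UNIV" by simp
  moreover have "A \<in> sigma_sets UNIV (range (\<lambda>a::real. {..a}))"
    using assms by (simp add: borel_eq_atMost)
  ultimately show ?thesis
  proof (induction rule: sigma_sets_induct_disjoint)
    case (basic A)
    then show ?case using atMost by auto
  next
    case empty
    have "abs_L2 (indicator {}) = 0" by (simp add: zero_L2.abs_eq indicator_def[abs_def])
    then show ?case using subspace_0[OF S] by (simp add: zero_L2.abs_eq)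
  next
    case (compl A)
    then have A: "A \<in> sets borel" by (simp add: borel_eq_atMost)
    have "abs_L2 (indicator {..1::real}) = abs_L2 (indicator UNIV)"
      by (subst abs_L2_eq_iff[OF sq one]) (auto simp: space_restrict_space)
    then have "abs_L2 (indicator UNIV) \<in> closure L2_dense" using atMost[of 1] by metis
    moreover have "abs_L2 (indicator (UNIV - A)) = abs_L2 (indicator UNIV) - abs_L2 (indicator A)"
      unfolding abs_L2_diff[OF one sq[OF A], symmetric]
      by (rule arg_cong[where f=abs_L2]) (auto simp: indicator_def)
    ultimately show ?case using subspace_diff[OF S _ compl(2)] by metis
  next
    case (union A)
    then have A: "A i \<in> sets borel" for i by (auto simp: borel_eq_atMost)
    have fin: "abs_L2 (indicator (\<Union>i<n. A i)) \<in> closure L2_dense" for n :: nat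
    proof (induction n)
      case 0
      have "abs_L2 (indicator {}) = 0" by (simp add: zero_L2.abs_eq indicator_def[abs_def])
      then show ?case using subspace_0[OF S] by (simp add: zero_L2.abs_eq)
    next
      case (Suc n)
      have "A i \<inter> A n = {}" if "i < n" for i
        using union(1) that by (simp add: disjoint_family_on_def)
      then have "(\<Union>i<n. A i) \<inter> A n = {}" by blast
      then have "indicator (\<Union>i<Suc n. A i) x = indicator (\<Union>i<n. A i) x + (indicator (A n) x :: real)" for x
        by (auto simp: indicator_def less_Suc_eq)
      then have "(indicator (\<Union>i<Suc n. A i) :: real \<Rightarrow> real)
          = (\<lambda>x. indicator (\<Union>i<n. A i) x + indicator (A n) x)" by auto
      then have "abs_L2 (indicator (\<Union>i<Suc n. A i))
          = abs_L2 (indicator (\<Union>i<n. A i)) + abs_L2 (indicator (A n))"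
        using abs_L2_add[OF sq sq, of "\<Union>i<n. A i" "A n"] A by simp
      then show ?case using subspace_add[OF S Suc union(3)[of n]] by simp
    qed
    have "(\<lambda>n. abs_L2 (indicator (\<Union>i<n. A i))) \<longlonglongrightarrow> abs_L2 (indicator (\<Union>i. A i))"
    proof (rule L2_dominated[where k="indicator UNIV"])
      show "(\<lambda>n. indicator (\<Union>i<n. A i) x :: real) \<longlonglongrightarrow> indicator (\<Union>i. A i) x" for x
        by (rule LIMSEQ_indicator_UN)
      show "square_integrable {0..1} (indicat_real (\<Union>i<n. A i))" for n
        using A by (intro sq) auto
      show "square_integrable {0..1} (indicat_real (\<Union>i. A i))"
        using A by (intro sq) auto
    qed (simp_all add: one del: indicator_UNIV)
    then show ?case by (rule closed_sequentially[OF closed_closure, rotated]) (rule fin)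
  qed
qed

lemma closure_L2_dense: "closure L2_dense = UNIV"
proof -
  note S = subspace_closure_L2_dense
  have sq: "square_integrable {0..1::real} (indicator B)" if "B \<in> sets borel" for B :: "real set"
    using that by (intro square_integrable_indicator) auto
  have "u \<in> closure L2_dense" for u
  proof -
    define h where "h x = indicator {0..1} x * rep_L2 u x" for x
    have h: "h \<in> borel_measurable lebesgue"
      using square_integrable_rep[of u]
      by (simp add: square_integrable_def h_def[abs_def] borel_measurable_restrict_space_iff)
    obtain k where k [measurable]: "k \<in> borel_measurable lborel" and hk: "AE x in lborel. h x = k x"
      using completion_ex_borel_measurable_real[OF h] by auto
    have hk': "AE x in lebesgue. h x = k x" using hk by (rule AE_completion)
    have AE: "AE x in leb01. rep_L2 u x = k x"
      using hk' by (subst AE_restrict_space_iff) (auto simp: h_def elim!: eventually_mono)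
    have km: "k \<in> borel_measurable leb01"
      by (rule measurable_restrict_space1, rule measurable_completion) (rule k)
    have ksq: "square_integrable {0..1} k"
    proof -
      have "integrable leb01 (\<lambda>x. (k x)\<^sup>2)"
        using square_integrable_rep[of u] AE km
        by (subst integrable_cong_AE[of _ _ "\<lambda>x. (rep_L2 u x)\<^sup>2"]) (auto simp: square_integrable_def)
      then show ?thesis using km by (simp add: square_integrable_def)
    qed
    have uk: "u = abs_L2 k"
      using abs_L2_eq_iff[OF square_integrable_rep ksq] AE by (simp add: abs_rep_L2)
    obtain F where F: "\<And>i. simple_function lborel (F i)" "\<And>x. (\<lambda>i. F i x) \<longlonglongrightarrow> k x"
      "\<And>i x. norm (F i x) \<le> 2 * norm (k x)"
      using borel_measurable_implies_sequence_metric[OF k, of 0] by auto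
    have fin: "square_integrable {0..1} (\<lambda>x. \<Sum>y\<in>Y. y * indicator (B y) x) \<and>
        abs_L2 (\<lambda>x. \<Sum>y\<in>Y. y * indicator (B y) x) \<in> closure L2_dense"
      if "finite Y" "\<And>y. B y \<in> sets borel" for Y :: "real set" and B
      using that(1)
    proof (induction Y)
      case empty
      have "abs_L2 (\<lambda>x. 0) = 0" by (simp add: zero_L2.abs_eq)
      then show ?case using subspace_0[OF S] by (simp add: square_integrable_zero)
    next
      case (insert y Y)
      have 1: "square_integrable {0..1} (\<lambda>x. y * indicator (B y) x)"
        by (intro square_integrable_scale sq that)
      have 2: "abs_L2 (\<lambda>x. y * indicator (B y) x) \<in> closure L2_dense"
        unfolding abs_L2_scale[OF sq[OF that(2)]]
        by (intro subspace_scale[OF S] indicator_in_closure_L2_dense that)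
      have 3: "square_integrable {0..1} (\<lambda>x. \<Sum>y\<in>Y. y * indicator (B y) x)"
        and 4: "abs_L2 (\<lambda>x. \<Sum>y\<in>Y. y * indicator (B y) x) \<in> closure L2_dense"
        using insert.IH by blast+
      show ?case
        unfolding sum.insert[OF insert.hyps] abs_L2_add[OF 1 3]
        using square_integrable_add[OF 1 3] subspace_add[OF S 2 4] by blast
    qed
    have Fi: "square_integrable {0..1} (F i) \<and> abs_L2 (F i) \<in> closure L2_dense" for i
    proof -
      have fi: "finite (range (F i))" using F(1)[of i] by (auto simp: simple_function_def)
      have B: "F i -` {y} \<in> sets borel" for y
        using measurable_sets[OF borel_measurable_simple_function[OF F(1)[of i]], of "{y}"] by simp
      have "F i x = (\<Sum>y\<in>range (F i). y * indicator (F i -` {y}) x)" for x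
        using fi by (subst sum.remove[of _ "F i x"]) (auto simp: indicator_def intro!: sum.neutral)
      then have "F i = (\<lambda>x. \<Sum>y\<in>range (F i). y * indicator (F i -` {y}) x)" by blast
      then show ?thesis using fin[OF fi, of "\<lambda>y. F i -` {y}"] B by simp
    qed
    have "(\<lambda>i. abs_L2 (F i)) \<longlonglongrightarrow> abs_L2 k"
    proof (rule L2_dominated[where k="\<lambda>x. 2 * \<bar>k x\<bar>"])
      show "square_integrable {0..1} (\<lambda>x. 2 * \<bar>k x\<bar>)"
        using ksq by (intro square_integrable_scale) (auto simp: square_integrable_def)
    qed (use F Fi ksq in auto)
    then show ?thesis unfolding uk
      by (rule closed_sequentially[OF closed_closure, rotated]) (use Fi in blast)
  qed
  then show ?thesis by auto
qed

instance L2 :: second_countable_topology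
proof
  let ?B = "(\<lambda>(u, n). ball u (1 / Suc n)) ` (L2_dense \<times> (UNIV :: nat set))"
  have "countable ?B"
    by (auto simp: L2_dense_def)
  moreover have "topological_basis ?B"
  proof (rule topological_basisI)
    fix U :: "L2 set" and x assume U: "open U" "x \<in> U"
    then obtain e where e: "e > 0" "ball x e \<subseteq> U" by (meson openE)
    then obtain n where n: "1 / Suc n < e / 2"
      using nat_approx_posE[of "e/2"] by (metis half_gt_zero)
    have "x \<in> closure L2_dense" by (simp add: closure_L2_dense)
    then obtain u where u: "u \<in> L2_dense" "dist u x < 1 / Suc n"
      unfolding closure_approachable by (metis of_nat_0_less_iff zero_less_Suc zero_less_divide_1_iff)
    have "ball u (1 / Suc n) \<subseteq> ball x e"
    proof
      fix y assume "y \<in> ball u (1 / Suc n)"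
      then show "y \<in> ball x e"
        using u(2) n dist_triangle[of x y u] by (simp add: dist_commute)
    qed
    with e u show "\<exists>B'\<in>?B. x \<in> B' \<and> B' \<subseteq> U"
      by (intro bexI[of _ "ball u (1 / Suc n)"]) auto
  qed auto
  ultimately show "\<exists>B::L2 set set. countable B \<and> open = generate_topology B"
    using topological_basis_imp_subbasis by blast
qed

section \<open>The space \<open>H\<^sup>1(0,T; L\<^sup>2(0,1))\<close>\<close>

text \<open>As \<open>L2\<close> is separable, Borel measurability is strong measurability, and the integrals over
  \<open>L2\<close>-valued functions below are Bochner integrals.\<close>

definition L2_Bochner :: "real \<Rightarrow> (real \<Rightarrow> L2) \<Rightarrow> bool" where
  "L2_Bochner T w \<longleftrightarrow> w \<in> borel_measurable (lebesgue_on {0..T}) \<and>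
     integrable (lebesgue_on {0..T}) (\<lambda>t. (norm (w t))\<^sup>2)"

definition test_function :: "real \<Rightarrow> (real \<Rightarrow> real) \<Rightarrow> bool" where
  "test_function T \<phi> \<longleftrightarrow> (\<forall>k t. (deriv ^^ k) \<phi> differentiable (at t)) \<and>
     (\<exists>a b. 0 < a \<and> b < T \<and> (\<forall>t. t \<notin> {a..b} \<longrightarrow> \<phi> t = 0))"

definition weak_derivative :: "real \<Rightarrow> (real \<Rightarrow> L2) \<Rightarrow> (real \<Rightarrow> L2) \<Rightarrow> bool" where
  "weak_derivative T u u' \<longleftrightarrow> (\<forall>\<phi>. test_function T \<phi> \<longrightarrow>
     (LINT t|lebesgue_on {0..T}. deriv \<phi> t *\<^sub>R u t) = - (LINT t|lebesgue_on {0..T}. \<phi> t *\<^sub>R u' t))"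

definition C_norm :: "real \<Rightarrow> (real \<Rightarrow> L2) \<Rightarrow> real" where
  "C_norm T w = (SUP t\<in>{0..T}. norm (w t))"


section \<open>The initial value problem\<close>

text \<open>\<open>abs_L2 h\<close> is the class of \<open>h\<close> and is meaningful only if \<open>h\<close> is square integrable on
  \<open>{0..1}\<close>. This holds in both definitions below when \<open>W\<close> is square integrable, \<open>D\<close> is bounded and
  continuous, and \<open>f\<close> is Lipschitz in its first argument; the choice of the representative
  \<open>rep_L2 u\<close> is then immaterial.\<close>

definition coupling :: "(real \<times> real \<Rightarrow> real) \<Rightarrow> (real \<Rightarrow> real) \<Rightarrow> L2 \<Rightarrow> L2" where
  "coupling W D u = abs_L2 (\<lambda>x. LINT y|leb01. W (x, y) * D (rep_L2 u y - rep_L2 u x))"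

definition reaction :: "(real \<Rightarrow> real \<Rightarrow> real) \<Rightarrow> real \<Rightarrow> L2 \<Rightarrow> L2" where
  "reaction f t u = abs_L2 (\<lambda>x. f (rep_L2 u x) t)"

text \<open>Elements of \<open>H\<^sup>1(0,T; L\<^sup>2(0,1))\<close> are represented by their continuous representatives on
  \<open>{0..T}\<close>.\<close>

definition weak_solution ::
  "(real \<times> real \<Rightarrow> real) \<Rightarrow> (real \<Rightarrow> real) \<Rightarrow> (real \<Rightarrow> real \<Rightarrow> real) \<Rightarrow> (real \<Rightarrow> real) \<Rightarrow>
   real \<Rightarrow> (real \<Rightarrow> L2) \<Rightarrow> bool" where
  "weak_solution W D f g T u \<longleftrightarrow>
     continuous_on {0..T} u \<and> L2_Bochner T u \<and>
     (\<exists>u'. L2_Bochner T u' \<and> weak_derivative T u u' \<and>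
        (AE t in lebesgue_on {0..T}. \<forall>v.
           inner (u' t - coupling W D (u t) - reaction f t (u t)) v = 0)) \<and>
     u 0 = abs_L2 g"


section \<open>Discretization\<close>

definition cell :: "nat \<Rightarrow> nat \<Rightarrow> real set" where
  "cell n i = {(real i - 1) / real n <.. real i / real n}"

definition cell_average :: "nat \<Rightarrow> (real \<times> real \<Rightarrow> real) \<Rightarrow> nat \<Rightarrow> nat \<Rightarrow> real" where
  "cell_average n V i j = (real n)\<^sup>2 * (LINT p|lebesgue_on (cell n i \<times> cell n j). V p)"

definition step_kernel :: "nat \<Rightarrow> (real \<times> real \<Rightarrow> real) \<Rightarrow> real \<times> real \<Rightarrow> real" where
  "step_kernel n V p =
     (\<Sum>i\<in>{1..n}. \<Sum>j\<in>{1..n}. cell_average n V i j * indicator (cell n i \<times> cell n j) p)"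

definition step_datum :: "nat \<Rightarrow> (real \<Rightarrow> real) \<Rightarrow> real \<Rightarrow> real" where
  "step_datum n g x =
     (\<Sum>i\<in>{1..n}. (real n * (LINT z|lebesgue_on (cell n i). g z)) * indicator (cell n i) x)"

definition truncated_kernel :: "real \<Rightarrow> (real \<times> real \<Rightarrow> real) \<Rightarrow> real \<times> real \<Rightarrow> real" where
  "truncated_kernel a W p = min (inverse a) (W p)"

definition cond_W1 :: "(real \<times> real \<Rightarrow> real) \<Rightarrow> bool" where
  "cond_W1 W \<longleftrightarrow>
     (SUP n\<in>{1..}. SUP y\<in>{0..1}. ereal (LINT x|leb01. step_kernel n W (x, y))) < \<infinity>"

definition cond_W2 :: "(real \<times> real \<Rightarrow> real) \<Rightarrow> bool" where
  "cond_W2 W \<longleftrightarrow>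
     (SUP n\<in>{1..}. SUP x\<in>{0..1}. ereal (LINT y|leb01. step_kernel n W (x, y))) < \<infinity>"

text \<open>The cells partition \<open>{0<..1}\<close>, so a step function vanishes at \<open>x = 0\<close> and the equation is
  imposed on \<open>{0<..1}\<close> only. At the endpoints of \<open>{0..T}\<close> the derivative is one-sided.\<close>

definition averaged_solution ::
  "nat \<Rightarrow> real \<Rightarrow> (real \<times> real \<Rightarrow> real) \<Rightarrow> (real \<Rightarrow> real) \<Rightarrow> (real \<Rightarrow> real \<Rightarrow> real) \<Rightarrow> (real \<Rightarrow> real) \<Rightarrow>
   real \<Rightarrow> (real \<Rightarrow> real \<Rightarrow> real) \<Rightarrow> bool" where
  "averaged_solution n a W D f g T v \<longleftrightarrow>
     (\<exists>c. \<forall>t\<in>{0..T}. \<forall>x\<in>{0..1}. v t x = (\<Sum>i\<in>{1..n}. c i t * indicator (cell n i) x)) \<and>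
     (\<forall>t\<in>{0..T}. \<forall>x\<in>{0<..1}.
        ((\<lambda>s. v s x) has_real_derivative
           f (v t x) t +
           (LINT y|leb01. step_kernel n (truncated_kernel a W) (x, y) * D (v t y - v t x)))
        (at t within {0..T})) \<and>
     (\<forall>x\<in>{0<..1}. v 0 x = step_datum n g x)"

end

theory Submission
  imports Defs
begin

text \<open>
  In \<open>X = L\<^sup>2(0,1)\<close> both problems are ordinary differential equations \<open>u' = K\<^sub>W(u) + f(u, t)\<close>.
  Condition (W-2) bounds the row integrals of \<open>W\<close>, which together with \<open>W \<in> L\<^sup>2\<close> makes \<open>K\<^sub>W\<close>
  globally Lipschitz on \<open>X\<close>; this gives a unique \<open>C\<^sup>1\<close> solution by Picard iteration. A weak
  solution is \<open>C\<^sup>1\<close>, because its weak derivative agrees almost everywhere with a continuous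
  function and a continuous function with vanishing weak derivative is constant.
  Since \<open>\<bar>D\<bar> \<le> 1\<close>, replacing the kernel costs only
  \<open>\<parallel>K\<^sub>W(v) - K\<^sub>V(v)\<parallel> \<le> \<parallel>W - V\<parallel>\<close>, uniformly in \<open>v\<close>. Hence Gronwall's argument, run with the
  Lipschitz constant of the limit problem, bounds the error by \<open>\<parallel>g\<^sub>n - g\<parallel>\<close> and the \<open>L\<^sup>2\<close> distance
  between \<open>W\<close> and its truncated cell averages, and both tend to zero because cell averages are
  best approximations by step functions.
\<close>

text \<open>(W-2) speaks of the averages of \<open>W\<close>, not of \<open>W\<close>, which
  moreover is only Lebesgue measurable on the square. Rows are therefore handled through a Borel
  function \<open>W0\<close> equal to \<open>W\<close> almost everywhere, and the row bound reaches
  \<open>W0\<close> because the averages converge to it in mean square. Square integrability alone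
  would not make the operator Lipschitz: \<open>|D(h y - h x) - D(k y - k x)|\<close> is at most
  \<open>L (|d y| + |d x|)\<close> with \<open>d = h - k\<close>, and while the first term is
  controlled by the Hilbert-Schmidt norm of the kernel, the second puts the row integral as a factor
  in front of \<open>d x\<close>. The Lipschitz constants available for the averaged kernels come
  from their suprema and may grow with \<open>n\<close>; they serve for existence and uniqueness at
  fixed \<open>n\<close>, and the comparison with the limit is arranged so that they do not enter.
  Since truncation precedes averaging, the averaged function itself varies with \<open>n\<close>,
  and the approximation result must allow for that.\<close>

section \<open>Lipschitz differential equations in Banach spaces\<close>


text \<open>Evaluating the integrated inequality at a maximum of \<open>exp (- 2 * L * t) * norm (w t)\<close> absorbs
  half of the left-hand side; the same weight makes the Picard map a contraction on all of \<open>{0..T}\<close>.\<close>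

lemma ode_stability:
  fixes w w' :: "real \<Rightarrow> 'a::real_normed_vector"
  assumes L: "0 < L" and \<delta>: "0 \<le> \<delta>"
    and deriv: "\<And>t. t \<in> {0..T} \<Longrightarrow> (w has_vector_derivative w' t) (at t within {0..T})"
    and bound: "\<And>t. t \<in> {0..T} \<Longrightarrow> norm (w' t) \<le> \<delta> + L * norm (w t)"
    and t: "t \<in> {0..T}"
  shows "norm (w t) \<le> 2 * (norm (w 0) + \<delta> * T) * exp (2 * L * T)"
proof -
  let ?A = "norm (w 0) + \<delta> * T"
  have A: "0 \<le> ?A" using \<delta> t by auto
  have cont: "continuous_on {0..T} w"
    by (rule continuous_on_vector_derivative[OF deriv])
  have "continuous_on {0..T} (\<lambda>s. exp (- 2 * L * s) * norm (w s))"
    by (intro continuous_intros cont)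
  moreover have "{0..T} \<noteq> {}" using t by auto
  ultimately obtain s where s: "s \<in> {0..T}"
    and max: "\<And>r. r \<in> {0..T} \<Longrightarrow> exp (- 2 * L * r) * norm (w r) \<le> exp (- 2 * L * s) * norm (w s)"
    using continuous_attains_sup[OF compact_Icc] by blast
  define m where "m = exp (- 2 * L * s) * norm (w s)"
  have m0: "0 \<le> m" by (simp add: m_def)
  have le: "norm (w r) \<le> m * exp (2 * L * r)" if "r \<in> {0..T}" for r
  proof -
    have "norm (w r) = exp (- 2 * L * r) * norm (w r) * exp (2 * L * r)"
      by (simp add: exp_minus)
    also have "\<dots> \<le> m * exp (2 * L * r)"
      unfolding m_def by (rule mult_right_mono[OF max[OF that]]) simp
    finally show ?thesis .
  qed
  have ws: "norm (w s) = m * exp (2 * L * s)"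
    by (simp add: m_def exp_minus)
  have "norm (w s) \<le> ?A + m / 2 * exp (2 * L * s)"
  proof (cases "s = 0")
    case True
    then show ?thesis using \<delta> t m0 by auto
  next
    case False
    then have s0: "0 < s" using s by auto
    \<comment> \<open>The majorant is an antiderivative of
      \<open>\<delta> + L * (m * exp (2 * L * r))\<close>; the exponent \<open>2 * L\<close> is what
      leaves the factor \<open>m / 2\<close>.\<close>
    have "norm (w s - w 0) \<le> (\<delta> * s + m / 2 * exp (2 * L * s)) - (\<delta> * 0 + m / 2 * exp (2 * L * 0))"
    proof (rule differentiable_bound_general[OF s0, where f'=w' and \<phi>'="\<lambda>r. \<delta> + L * (m * exp (2 * L * r))"])
      show "continuous_on {0..s} w"
        by (rule continuous_on_subset[OF cont]) (use s in auto)
      show "continuous_on {0..s} (\<lambda>r. \<delta> * r + m / 2 * exp (2 * L * r))"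
        by (intro continuous_intros)
      fix r assume r: "0 < r" "r < s"
      then show "(w has_vector_derivative w' r) (at r)"
        using deriv[of r] s at_within_Icc_at[of 0 r T] by auto
      show "((\<lambda>r. \<delta> * r + m / 2 * exp (2 * L * r)) has_vector_derivative \<delta> + L * (m * exp (2 * L * r))) (at r)"
        unfolding has_real_derivative_iff_has_vector_derivative[symmetric]
        by (auto intro!: derivative_eq_intros)
      have rT: "r \<in> {0..T}" using r s by auto
      show "norm (w' r) \<le> \<delta> + L * (m * exp (2 * L * r))"
        using bound[OF rT] mult_left_mono[OF le[OF rT], of L] L by linarith
    qed
    then have "norm (w s - w 0) \<le> \<delta> * s + m / 2 * exp (2 * L * s)" using m0 by simp
    moreover have "\<delta> * s \<le> \<delta> * T" using s \<delta> by (intro mult_left_mono) auto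
    moreover have "norm (w s) \<le> norm (w s - w 0) + norm (w 0)"
      using norm_triangle_ineq[of "w s - w 0" "w 0"] by simp
    ultimately show ?thesis by linarith
  qed
  then have "m * exp (2 * L * s) \<le> 2 * ?A" unfolding ws by (simp add: field_simps)
  moreover have "m * 1 \<le> m * exp (2 * L * s)"
    using m0 L s by (intro mult_left_mono) auto
  ultimately have m: "m \<le> 2 * ?A" by linarith
  have "norm (w t) \<le> m * exp (2 * L * t)" by (rule le[OF t])
  also have "\<dots> \<le> 2 * ?A * exp (2 * L * T)"
    using m m0 A t L by (intro mult_mono) auto
  finally show ?thesis .
qed

text \<open>The constant \<open>L\<close> is the same for all times, so freezing the state at
  \<open>u t\<close> costs at most \<open>L * norm (u s - u t)\<close>; separate continuity in time
  then suffices along a moving state.\<close>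

lemma continuous_on_lipschitz_param:
  fixes F :: "real \<Rightarrow> 'a::real_normed_vector \<Rightarrow> 'b::real_normed_vector"
  assumes lip: "\<And>t x y. t \<in> S \<Longrightarrow> norm (F t x - F t y) \<le> L * norm (x - y)"
    and cont: "\<And>x. continuous_on S (\<lambda>t. F t x)"
    and u: "continuous_on S u"
  shows "continuous_on S (\<lambda>t. F t (u t))"
  unfolding continuous_on_def
proof
  fix t assume t: "t \<in> S"
  have "((\<lambda>s. F s (u s) - F s (u t)) \<longlongrightarrow> 0) (at t within S)"
  proof (rule Lim_null_comparison)
    show "\<forall>\<^sub>F s in at t within S. norm (F s (u s) - F s (u t)) \<le> L * norm (u s - u t)"
      by (auto simp: eventually_at_filter lip intro!: always_eventually)
    have "((\<lambda>s. L * norm (u s - u t)) \<longlongrightarrow> L * norm (u t - u t)) (at t within S)"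
      by (intro tendsto_intros) (use u t in \<open>auto simp: continuous_on_def\<close>)
    then show "((\<lambda>s. L * norm (u s - u t)) \<longlongrightarrow> 0) (at t within S)" by simp
  qed
  moreover have "((\<lambda>s. F s (u t)) \<longlongrightarrow> F t (u t)) (at t within S)"
    using cont[of "u t"] t by (auto simp: continuous_on_def)
  ultimately have "((\<lambda>s. (F s (u s) - F s (u t)) + F s (u t)) \<longlongrightarrow> 0 + F t (u t)) (at t within S)"
    by (rule tendsto_add)
  then show "((\<lambda>s. F s (u s)) \<longlongrightarrow> F t (u t)) (at t within S)" by simp
qed

text \<open>Elements of \<open>bcontfun\<close> live on the whole real line; clamping time to
  \<open>{0..T}\<close> extends a curve by its end values and lets the fixed point theorem be
  applied there.\<close>

lemma continuous_on_clamp_real: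
  fixes h :: "real \<Rightarrow> 'a::topological_space"
  assumes "continuous_on {0..T} h" "0 \<le> T"
  shows "continuous_on UNIV (\<lambda>t. h (max 0 (min T t)))"
proof -
  have "continuous_on UNIV (h \<circ> (\<lambda>t. max 0 (min T t)))"
    by (rule continuous_on_compose)
      (use assms in \<open>auto intro!: continuous_intros continuous_on_subset[OF assms(1)]\<close>)
  then show ?thesis by (simp add: o_def)
qed

text \<open>The exponential weight is put into the unknown instead of the norm: the fixed point is
  \<open>exp (- 2 * L * t) *\<^sub>R u t\<close>, so the supremum norm of \<open>bcontfun\<close> is
  used as it is and no short time intervals have to be glued.\<close>

lemma picard_lindelof_global:
  fixes F :: "real \<Rightarrow> 'a::banach \<Rightarrow> 'a"
  assumes T: "0 < T" and L: "0 < L"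
    and lip: "\<And>t x y. t \<in> {0..T} \<Longrightarrow> norm (F t x - F t y) \<le> L * norm (x - y)"
    and cont: "\<And>x. continuous_on {0..T} (\<lambda>t. F t x)"
  obtains u where "u 0 = g"
    "\<And>t. t \<in> {0..T} \<Longrightarrow> (u has_vector_derivative F t (u t)) (at t within {0..T})"
proof -
  define \<tau> where "\<tau> t = max 0 (min T t)" for t :: real
  have \<tau>: "\<tau> t \<in> {0..T}" for t using T by (auto simp: \<tau>_def)
  define G where "G w s = F s (exp (2 * L * s) *\<^sub>R apply_bcontfun w s)" for w s
  define P where "P w t = exp (- 2 * L * t) *\<^sub>R (g + integral {0..t} (G w))" for w t
  have G: "continuous_on {0..T} (G w)" for w
    unfolding G_def
    by (rule continuous_on_lipschitz_param[of _ F L])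
      (auto intro!: lip cont continuous_intros continuous_on_apply_bcontfun)
  have Gi: "G w integrable_on {0..t}" if "t \<in> {0..T}" for w t
    using that by (intro integrable_continuous_real continuous_on_subset[OF G[of w]]) auto
  have Pc: "continuous_on {0..T} (P w)" for w
    unfolding P_def
    by (intro continuous_intros indefinite_integral_continuous_1 integrable_continuous_real G)
  have Pb: "(\<lambda>t. P w (\<tau> t)) \<in> bcontfun" for w
  proof -
    obtain B where B: "\<And>t. t \<in> {0..T} \<Longrightarrow> norm (P w t) \<le> B"
      using compact_imp_bounded[OF compact_continuous_image[OF Pc[of w] compact_Icc]]
      unfolding bounded_iff by blast
    show ?thesis
      by (rule bcontfun_normI[of _ B])
        (use B \<tau> continuous_on_clamp_real[OF Pc, of w] T in \<open>auto simp: \<tau>_def\<close>)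
  qed
  define \<Phi> where "\<Phi> w = Bcontfun (\<lambda>t. P w (\<tau> t))" for w
  have \<Phi>: "apply_bcontfun (\<Phi> w) t = P w (\<tau> t)" for w t
    by (simp add: \<Phi>_def Bcontfun_inverse[OF Pb])
  have "dist (\<Phi> w) (\<Phi> z) \<le> 1/2 * dist w z" for w z
  proof (rule dist_bound)
    fix r
    define t where "t = \<tau> r"
    have t: "t \<in> {0..T}" unfolding t_def by (rule \<tau>)
    have "norm (integral {0..t} (G w) - integral {0..t} (G z)) = norm (integral {0..t} (\<lambda>s. G w s - G z s))"
      by (simp add: Henstock_Kurzweil_Integration.integral_diff[OF Gi[OF t] Gi[OF t]])
    also have "\<dots> \<le> integral {0..t} (\<lambda>s. L * exp (2 * L * s) * dist w z)"
    proof (rule integral_norm_bound_integral)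
      show "(\<lambda>s. G w s - G z s) integrable_on {0..t}"
        by (intro Henstock_Kurzweil_Integration.integrable_diff Gi t)
      show "(\<lambda>s. L * exp (2 * L * s) * dist w z) integrable_on {0..t}"
        by (intro integrable_continuous_real continuous_intros)
      fix s assume s: "s \<in> {0..t}"
      then have "norm (G w s - G z s) \<le> L * norm (exp (2 * L * s) *\<^sub>R apply_bcontfun w s - exp (2 * L * s) *\<^sub>R apply_bcontfun z s)"
        unfolding G_def using t by (intro lip) auto
      also have "\<dots> = L * exp (2 * L * s) * dist (apply_bcontfun w s) (apply_bcontfun z s)"
        by (simp add: scaleR_diff_right[symmetric] dist_norm)
      also have "\<dots> \<le> L * exp (2 * L * s) * dist w z"
        using L by (intro mult_left_mono dist_bounded) auto
      finally show "norm (G w s - G z s) \<le> L * exp (2 * L * s) * dist w z" .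
    qed
    \<comment> \<open>The primitive of \<open>L * exp (2 * L * s)\<close> is
      \<open>exp (2 * L * s) / 2\<close>: this is the contraction factor 1/2, whatever the length of
      the interval.\<close>
    also have "\<dots> = (exp (2 * L * t) / 2 * dist w z) - (exp (2 * L * 0) / 2 * dist w z)"
      by (rule integral_unique, rule fundamental_theorem_of_calculus)
        (use t in \<open>auto intro!: derivative_eq_intros simp flip: has_real_derivative_iff_has_vector_derivative\<close>)
    also have "\<dots> \<le> exp (2 * L * t) / 2 * dist w z" by simp
    finally have I: "norm (integral {0..t} (G w) - integral {0..t} (G z)) \<le> exp (2 * L * t) / 2 * dist w z" .
    have "dist (apply_bcontfun (\<Phi> w) r) (apply_bcontfun (\<Phi> z) r)
        = exp (- 2 * L * t) * norm (integral {0..t} (G w) - integral {0..t} (G z))"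
      by (simp add: \<Phi> P_def dist_norm t_def[symmetric] scaleR_diff_right[symmetric])
    also have "\<dots> \<le> exp (- 2 * L * t) * (exp (2 * L * t) / 2 * dist w z)"
      by (intro mult_left_mono I) auto
    also have "\<dots> = 1/2 * dist w z" by (simp add: exp_minus)
    finally show "dist (apply_bcontfun (\<Phi> w) r) (apply_bcontfun (\<Phi> z) r) \<le> 1/2 * dist w z" .
  qed
  then obtain w where w: "\<Phi> w = w"
    using banach_fix_type[of "1/2" \<Phi>] by auto
  define u where "u t = g + integral {0..t} (G w)" for t
  have uw: "exp (2 * L * t) *\<^sub>R apply_bcontfun w t = u t" if "t \<in> {0..T}" for t
  proof -
    have "\<tau> t = t" using that by (auto simp: \<tau>_def)
    then have "apply_bcontfun w t = exp (- 2 * L * t) *\<^sub>R u t"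
      using \<Phi>[of w t] by (simp add: w P_def u_def)
    then show ?thesis by (simp add: exp_minus)
  qed
  show thesis
  proof (rule that)
    show "u 0 = g" by (simp add: u_def)
    fix t assume t: "t \<in> {0..T}"
    have "(u has_vector_derivative 0 + G w t) (at t within {0..T})"
      unfolding u_def[abs_def]
      by (intro has_vector_derivative_add has_vector_derivative_const integral_has_vector_derivative G t)
    then show "(u has_vector_derivative F t (u t)) (at t within {0..T})"
      by (simp add: G_def uw[OF t])
  qed
qed

section \<open>Smooth test functions\<close>


text \<open>Literally the regularity clause of \<open>test_function\<close>, detached from the
  support condition so that closure properties can be proved without regard to supports.\<close>

definition smooth :: "(real \<Rightarrow> real) \<Rightarrow> bool" where
  "smooth h \<longleftrightarrow> (\<forall>k t. (deriv ^^ k) h differentiable (at t))"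

text \<open>Iterated derivatives never have to be computed: any family of functions that contains a
  derivative of each of its members consists of smooth functions. Each closure property below
  reduces to the choice of such a family.\<close>

lemma smooth_coinduct:
  assumes "h \<in> S"
    and step: "\<And>h. h \<in> S \<Longrightarrow> \<exists>h'\<in>S. \<forall>t. (h has_real_derivative h' t) (at t)"
  shows "smooth h"
proof -
  have "(deriv ^^ k) h \<in> S" for k
  proof (induction k)
    case (Suc k)
    then obtain h' where h': "h' \<in> S" "\<And>t. ((deriv ^^ k) h has_real_derivative h' t) (at t)"
      using step by blast
    then have "deriv ((deriv ^^ k) h) = h'" by (intro ext DERIV_imp_deriv)
    then show ?case using h' by simp
  qed (use assms in simp)
  then show ?thesis
    unfolding smooth_def real_differentiable_def using step by blast
qed

lemma smooth_deriv: "smooth h \<Longrightarrow> smooth (deriv h)"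
  unfolding smooth_def by (metis funpow_simps_right(2) comp_apply)

lemma smooth_DERIV: "smooth h \<Longrightarrow> (h has_real_derivative deriv h t) (at t)"
  unfolding smooth_def using DERIV_deriv_iff_real_differentiable by (metis funpow_0)

lemma smooth_diff:
  assumes "smooth a" "smooth b" shows "smooth (\<lambda>x. a x - b x)"
proof (rule smooth_coinduct)
  let ?S = "{(\<lambda>x. a x - b x) |a b. smooth a \<and> smooth b}"
  show "(\<lambda>x. a x - b x) \<in> ?S" using assms by blast
  fix h assume "h \<in> ?S"
  then obtain a b where ab: "smooth a" "smooth b" "h = (\<lambda>x. a x - b x)" by blast
  then have "\<forall>t. (h has_real_derivative deriv a t - deriv b t) (at t)"
    by (auto intro!: derivative_eq_intros smooth_DERIV)
  with ab show "\<exists>h'\<in>?S. \<forall>t. (h has_real_derivative h' t) (at t)"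
    by (intro bexI[of _ "\<lambda>x. deriv a x - deriv b x"]) (auto intro: smooth_deriv)
qed

lemma smooth_affine: "smooth (\<lambda>x. a * x + b)"
proof (rule smooth_coinduct)
  let ?S = "range (\<lambda>(a, b) x. a * x + b :: real)"
  show "(\<lambda>x. a * x + b) \<in> ?S" by (auto intro!: image_eqI[of _ _ "(a, b)"])
  fix h assume "h \<in> ?S"
  then obtain a b where h: "h = (\<lambda>x. a * x + b)" by auto
  have "\<forall>t. (h has_real_derivative 0 * t + a) (at t)"
    unfolding h by (auto intro!: derivative_eq_intros)
  then show "\<exists>h'\<in>?S. \<forall>t. (h has_real_derivative h' t) (at t)"
    by (intro bexI[of _ "\<lambda>x. 0 * x + a"]) (auto intro!: image_eqI[of _ _ "(0, a)"])
qed

text \<open>Products are not closed under differentiation but finite sums of products are; lists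
  represent the sums, and the Leibniz rule replaces every pair by two.\<close>

lemma smooth_mult:
  assumes "smooth a" "smooth b" shows "smooth (\<lambda>x. a x * b x)"
proof (rule smooth_coinduct)
  let ?F = "\<lambda>xs :: ((real \<Rightarrow> real) \<times> (real \<Rightarrow> real)) list. \<lambda>x. \<Sum>(a, b)\<leftarrow>xs. a x * b x"
  let ?S = "{?F xs |xs. \<forall>(a, b)\<in>set xs. smooth a \<and> smooth b}"
  have "(\<lambda>x. a x * b x) = ?F [(a, b)]" by simp
  then show "(\<lambda>x. a x * b x) \<in> ?S" using assms by (intro CollectI exI[of _ "[(a, b)]"]) auto
  fix h assume "h \<in> ?S"
  then obtain xs where xs: "\<forall>(a, b)\<in>set xs. smooth a \<and> smooth b" and h: "h = ?F xs" by blast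
  let ?ys = "concat (map (\<lambda>(a, b). [(deriv a, b), (a, deriv b)]) xs)"
  have "(?F xs has_real_derivative ?F ?ys t) (at t)" for t
    using xs
    by (induction xs) (auto intro!: derivative_eq_intros smooth_DERIV)
  moreover have "?F ?ys \<in> ?S"
    using xs by (intro CollectI exI[of _ ?ys]) (auto intro: smooth_deriv)
  ultimately show "\<exists>h'\<in>?S. \<forall>t. (h has_real_derivative h' t) (at t)"
    unfolding h by (intro bexI[of _ "?F ?ys"] allI)
qed

text \<open>The family is that of finite sums of \<open>a (g x) * b x\<close>. The inner derivative
  is absorbed into the second factor, so no formula for higher derivatives of a composition
  appears.\<close>

lemma smooth_compose:
  assumes a: "smooth a" and g: "smooth g" shows "smooth (\<lambda>x. a (g x))"
proof (rule smooth_coinduct)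
  let ?F = "\<lambda>xs :: ((real \<Rightarrow> real) \<times> (real \<Rightarrow> real)) list. \<lambda>x. \<Sum>(a, b)\<leftarrow>xs. a (g x) * b x"
  let ?S = "{?F xs |xs. \<forall>(a, b)\<in>set xs. smooth a \<and> smooth b}"
  have "(\<lambda>x. a (g x)) = ?F [(a, \<lambda>x. 1)]" by simp
  then show "(\<lambda>x. a (g x)) \<in> ?S"
    using a smooth_affine[of 0 1] by (intro CollectI exI[of _ "[(a, \<lambda>x. 1)]"]) auto
  fix h assume "h \<in> ?S"
  then obtain xs where xs: "\<forall>(a, b)\<in>set xs. smooth a \<and> smooth b" and h: "h = ?F xs" by blast
  let ?ys = "concat (map (\<lambda>(a, b). [(deriv a, \<lambda>x. deriv g x * b x), (a, deriv b)]) xs)"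
  have "(?F xs has_real_derivative ?F ?ys t) (at t)" for t
    using xs
    by (induction xs)
      (auto intro!: derivative_eq_intros smooth_DERIV DERIV_chain2[OF smooth_DERIV smooth_DERIV[OF g]])
  moreover have "?F ?ys \<in> ?S"
    using xs by (intro CollectI exI[of _ ?ys]) (auto intro!: smooth_deriv smooth_mult g)
  ultimately show "\<exists>h'\<in>?S. \<forall>t. (h has_real_derivative h' t) (at t)"
    unfolding h by (intro bexI[of _ "?F ?ys"] allI)
qed

section \<open>Flat functions and a smooth cutoff\<close>

definition flat :: "real poly \<Rightarrow> real \<Rightarrow> real" where
  "flat p x = (if x \<le> 0 then 0 else poly p (1 / x) * exp (- (1 / x)))"

lemma tendsto_poly_exp_0: "((\<lambda>y. poly p y * exp (- y)) \<longlongrightarrow> (0::real)) at_top"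
proof -
  have "((\<lambda>y. \<Sum>i\<le>degree p. coeff p i * (y ^ i / exp y)) \<longlongrightarrow> (\<Sum>i\<le>degree p. coeff p i * 0)) at_top"
    by (intro tendsto_intros tendsto_power_div_exp_0)
  then show ?thesis
    by (simp add: poly_altdef sum_distrib_right exp_minus divide_inverse mult.assoc)
qed

text \<open>With \<open>y = 1 / x\<close> the derivative of \<open>p(y) exp(-y)\<close> is
  \<open>y^2 (p(y) - p'(y)) exp(-y)\<close>, again of the form \<open>flat\<close>; this is why
  \<open>flat\<close> is indexed by polynomials. At \<open>0\<close> the right difference quotient
  is \<open>y p(y) exp(-y)\<close>, which tends to 0.\<close>

lemma DERIV_flat: "(flat p has_real_derivative flat ([:0, 0, 1:] * (p - pderiv p)) x) (at x)"
proof -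
  consider "x < 0" | "x = 0" | "x > 0" by linarith
  then show ?thesis
  proof cases
    case 1
    then have "(\<forall>\<^sub>F y in nhds x. flat p y = 0)"
      using eventually_nhds_in_open[of "{..<0}" x] by (auto elim!: eventually_mono simp: flat_def)
    then show ?thesis
      using 1 DERIV_cong_ev[of x x "flat p" "\<lambda>_. 0" 0 0] by (auto simp: flat_def)
  next
    case 2
    have "((\<lambda>h. flat p h / h) \<longlongrightarrow> 0) (at 0)"
    proof (rule filterlim_split_at)
      show "((\<lambda>h. flat p h / h) \<longlongrightarrow> 0) (at_left 0)"
        by (rule tendsto_eventually) (auto simp: eventually_at_filter flat_def)
      have "((\<lambda>h. poly ([:0, 1:] * p) (inverse h) * exp (- inverse h)) \<longlongrightarrow> 0) (at_right (0::real))"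
        by (rule filterlim_compose[OF tendsto_poly_exp_0 filterlim_inverse_at_top_right])
      then show "((\<lambda>h. flat p h / h) \<longlongrightarrow> 0) (at_right 0)"
        by (rule Lim_transform_eventually)
          (auto simp: eventually_at_filter flat_def field_simps)
    qed
    then show ?thesis using 2 by (simp add: DERIV_def flat_def)
  next
    case 3
    have "(\<forall>\<^sub>F y in nhds x. flat p y = poly p (1 / y) * exp (- (1 / y)))"
      using eventually_nhds_in_open[of "{0<..}" x] 3 by (auto elim!: eventually_mono simp: flat_def)
    moreover have "((\<lambda>y. poly p (1 / y) * exp (- (1 / y))) has_real_derivative
        flat ([:0, 0, 1:] * (p - pderiv p)) x) (at x)"
      using 3 by (auto intro!: derivative_eq_intros DERIV_chain2[OF poly_DERIV]
          simp: flat_def field_simps power2_eq_square)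
    ultimately show ?thesis
      using DERIV_cong_ev[of x x "flat p"] by auto
  qed
qed

lemma smooth_flat: "smooth (flat p)"
  by (rule smooth_coinduct[of _ "range flat"]) (use DERIV_flat in blast)+

text \<open>\<open>flat 1\<close> is nested in itself: the outer copy is evaluated at
  \<open>1 - exp 1 * flat 1 x\<close>, which is \<open>1\<close> for \<open>x \<le> 0\<close> and
  nonpositive for \<open>1 \<le> x\<close>. This yields a cutoff without quotients, and the chain
  rule shows the sign of its derivative.\<close>

lemma smooth_step:
  obtains H where "smooth H" "\<And>x. x \<le> 0 \<Longrightarrow> H x = 1" "\<And>x. 1 \<le> x \<Longrightarrow> H x = 0"
    "\<And>x. deriv H x \<le> 0"
proof
  let ?g = "\<lambda>x. (- exp 1) * flat 1 x + 1" and ?q = "[:0, 0, 1:] * (1 - pderiv 1) :: real poly"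
  define H where "H x = exp 1 * flat 1 (?g x) + 0" for x
  show "smooth H"
    unfolding H_def[abs_def]
    by (intro smooth_compose[OF smooth_affine] smooth_compose[OF smooth_flat] smooth_flat)
  show "H x = 1" if "x \<le> 0" for x
    using that by (simp add: H_def flat_def exp_minus)
  show "H x = 0" if "1 \<le> x" for x
  proof -
    have "exp 1 * flat 1 x = exp (1 - 1 / x)" using that by (simp add: flat_def exp_diff exp_minus divide_inverse)
    also have "\<dots> \<ge> 1" using that by simp
    finally have "?g x \<le> 0" by simp
    then show ?thesis by (simp add: H_def flat_def)
  qed
  have q: "flat ?q x \<ge> 0" for x by (simp add: flat_def pderiv_1)
  have "(H has_real_derivative exp 1 * (flat ?q (?g x) * ((- exp 1) * flat ?q x))) (at x)" for x
    unfolding H_def[abs_def]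
    by (auto intro!: derivative_eq_intros DERIV_chain2[OF DERIV_flat] DERIV_flat simp del: mult_pCons_left)
  then have "deriv H x = exp 1 * (flat ?q (?g x) * ((- exp 1) * flat ?q x))" for x
    by (rule DERIV_imp_deriv)
  then show "deriv H x \<le> 0" for x
    using q by (simp add: mult_nonneg_nonneg del: mult_pCons_left)
qed

text \<open>The weight \<open>- deriv H ((r - s) / \<epsilon>) / \<epsilon>\<close> is nonnegative,
  has total mass 1 and lives on \<open>{s..s + \<epsilon>}\<close>, so the integral is a one-sided
  average of \<open>w\<close> just after \<open>s\<close>.\<close>

lemma mollifier_estimate:
  fixes w :: "real \<Rightarrow> 'a::banach"
  assumes H: "smooth H" "\<And>x. x \<le> 0 \<Longrightarrow> H x = 1" "\<And>x. 1 \<le> x \<Longrightarrow> H x = 0" "\<And>x. deriv H x \<le> 0"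
    and s: "0 < s" "s + \<epsilon> \<le> T" "0 < \<epsilon>"
    and w: "continuous_on {0..T} w"
    and e: "\<And>r. r \<in> {s..s + \<epsilon>} \<Longrightarrow> norm (w r - w s) \<le> e"
  shows "norm (integral {0..T} (\<lambda>r. (- deriv H ((r - s) / \<epsilon>) / \<epsilon>) *\<^sub>R w r) - w s) \<le> e"
proof -
  let ?k = "\<lambda>r. - deriv H ((r - s) / \<epsilon>) / \<epsilon>"
  have kc: "continuous_on {0..T} ?k"
  proof -
    have "continuous_on UNIV (deriv H)"
      using smooth_DERIV[OF smooth_deriv[OF H(1)]] DERIV_isCont continuous_at_imp_continuous_on by blast
    then have "continuous_on {0..T} (\<lambda>r. deriv H ((r - s) / \<epsilon>))"
      by (rule continuous_on_compose2) (use s in \<open>auto intro!: continuous_intros\<close>)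
    then show ?thesis using s by (auto intro!: continuous_intros)
  qed
  have k0: "?k r = 0" if "r \<notin> {s..s + \<epsilon>}" for r
  proof -
    define x where "x = (r - s) / \<epsilon>"
    have "x < 0 \<or> 1 < x" using that s by (auto simp: x_def field_simps)
    then have "deriv H x = 0"
    proof
      assume x: "x < 0"
      have "\<forall>\<^sub>F y in nhds x. H y = 1"
        using eventually_nhds_in_open[of "{..<0}" x] x by (auto elim!: eventually_mono simp: H)
      then have "deriv H x = deriv (\<lambda>_. 1) x" by (intro deriv_cong_ev) auto
      then show ?thesis by simp
    next
      assume x: "1 < x"
      have "\<forall>\<^sub>F y in nhds x. H y = 0"
        using eventually_nhds_in_open[of "{1<..}" x] x by (auto elim!: eventually_mono simp: H)
      then have "deriv H x = deriv (\<lambda>_. 0) x" by (intro deriv_cong_ev) auto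
      then show ?thesis by simp
    qed
    then show ?thesis by (simp add: x_def)
  qed
  have k_nonneg: "0 \<le> ?k r" for r using H(4) s by (simp add: field_simps)
  \<comment> \<open>The mass telescopes to
    \<open>H ((0 - s) / \<epsilon>) - H ((T - s) / \<epsilon>)\<close>; the second value is 0
    because \<open>s + \<epsilon> \<le> T\<close>.\<close>
  have "(?k has_integral (- H ((T - s) / \<epsilon>) - - H ((0 - s) / \<epsilon>))) {0..T}"
    by (rule fundamental_theorem_of_calculus)
      (use s in \<open>auto intro!: derivative_eq_intros DERIV_chain2[OF smooth_DERIV[OF H(1)]]
        simp flip: has_real_derivative_iff_has_vector_derivative\<close>)
  moreover have "H ((T - s) / \<epsilon>) = 0" "H ((0 - s) / \<epsilon>) = 1"
    using s by (auto intro!: H simp: field_simps)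
  ultimately have k1: "(?k has_integral 1) {0..T}" by simp
  have 1: "((\<lambda>r. ?k r *\<^sub>R w s) has_integral w s) {0..T}"
    using has_integral_linear[OF k1 bounded_linear_scaleR_left[of "w s"]] by (simp add: o_def)
  have 2: "(\<lambda>r. ?k r *\<^sub>R w r) integrable_on {0..T}"
    by (intro integrable_continuous_real continuous_on_scaleR kc w)
  have eq: "integral {0..T} (\<lambda>r. ?k r *\<^sub>R w r) - w s
      = integral {0..T} (\<lambda>r. ?k r *\<^sub>R w r - ?k r *\<^sub>R w s)"
    unfolding Henstock_Kurzweil_Integration.integral_diff[OF 2 has_integral_integrable[OF 1]]
      integral_unique[OF 1] ..
  have "norm (integral {0..T} (\<lambda>r. ?k r *\<^sub>R w r - ?k r *\<^sub>R w s)) \<le> integral {0..T} (\<lambda>r. ?k r * e)"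
  proof (rule integral_norm_bound_integral)
    show "(\<lambda>r. ?k r *\<^sub>R w r - ?k r *\<^sub>R w s) integrable_on {0..T}"
      using 1 2 by (intro Henstock_Kurzweil_Integration.integrable_diff) auto
    show "(\<lambda>r. ?k r * e) integrable_on {0..T}"
      by (intro integrable_continuous_real continuous_on_mult kc continuous_on_const)
    fix r assume "r \<in> {0..T}"
    show "norm (?k r *\<^sub>R w r - ?k r *\<^sub>R w s) \<le> ?k r * e"
    proof (cases "r \<in> {s..s + \<epsilon>}")
      case True
      have "norm (?k r *\<^sub>R w r - ?k r *\<^sub>R w s) = \<bar>?k r\<bar> * norm (w r - w s)"
        unfolding scaleR_diff_right[symmetric] norm_scaleR ..
      also have "\<dots> \<le> ?k r * e"
        unfolding abs_of_nonneg[OF k_nonneg] by (rule mult_left_mono[OF e[OF True] k_nonneg])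
      finally show ?thesis .
    next
      case False
      then show ?thesis unfolding k0[OF False] by simp
    qed
  qed
  also have "\<dots> = e"
    using integral_unique[OF has_integral_mult_left[OF k1, of e]] by (simp only: mult_1)
  finally show ?thesis unfolding eq .
qed

text \<open>The du Bois-Reymond lemma. A difference of two cutoffs, switching at \<open>s\<close>
  and at \<open>t\<close>, is a test function whose derivative is a difference of two averaging
  weights. The averages of \<open>w\<close> just after \<open>s\<close> and just after
  \<open>t\<close> therefore agree, and they are close to \<open>w s\<close> and
  \<open>w t\<close>.\<close>

lemma zero_weak_derivative_imp_constant:
  fixes w :: "real \<Rightarrow> 'a::banach"
  assumes w: "continuous_on {0..T} w"
    and weak: "\<And>\<phi>. test_function T \<phi> \<Longrightarrow> integral {0..T} (\<lambda>r. deriv \<phi> r *\<^sub>R w r) = 0"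
    and T: "0 < T" and t: "t \<in> {0..T}"
  shows "w t = w 0"
proof -
  obtain H where H: "smooth H" "\<And>x. x \<le> 0 \<Longrightarrow> H x = 1" "\<And>x. 1 \<le> x \<Longrightarrow> H x = 0" "\<And>x. deriv H x \<le> 0"
    using smooth_step by metis
  have eq: "w s = w t" if st: "0 < s" "s < t" "t < T" for s t
  proof -
    have "norm (w s - w t) \<le> e" if "e > 0" for e
    proof -
      have "\<exists>d>0. \<forall>r\<in>{0..T}. dist r p < d \<longrightarrow> dist (w r) (w p) < e / 2" if "p \<in> {0..T}" for p
        using w that \<open>e > 0\<close> unfolding continuous_on_iff by (meson half_gt_zero)
      note near = this
      obtain d1 where d1: "d1 > 0" "\<And>r. r \<in> {0..T} \<Longrightarrow> dist r s < d1 \<Longrightarrow> dist (w r) (w s) < e / 2"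
        using near[of s] st by auto
      obtain d2 where d2: "d2 > 0" "\<And>r. r \<in> {0..T} \<Longrightarrow> dist r t < d2 \<Longrightarrow> dist (w r) (w t) < e / 2"
        using near[of t] st by auto
      \<comment> \<open>The bound by \<open>T - t\<close> keeps the support of the test function
        inside the open interval; \<open>d1\<close> and \<open>d2\<close> keep both averages in
        neighbourhoods where \<open>w\<close> varies by less than \<open>e / 2\<close>.\<close>
      define \<epsilon> where "\<epsilon> = min (T - t) (min d1 d2) / 2"
      have \<epsilon>: "0 < \<epsilon>" "t + \<epsilon> < T" "s + \<epsilon> < T" "\<epsilon> < d1" "\<epsilon> < d2"
        using d1(1) d2(1) st by (auto simp: \<epsilon>_def min_def field_simps)
      define k where "k p r = - deriv H ((r - p) / \<epsilon>) / \<epsilon>" for p r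
      define \<phi> where "\<phi> r = H ((1 / \<epsilon>) * r + (- t / \<epsilon>)) - H ((1 / \<epsilon>) * r + (- s / \<epsilon>))" for r
      have arg: "(1 / \<epsilon>) * r + (- p / \<epsilon>) = (r - p) / \<epsilon>" for r p by (simp add: diff_divide_distrib)
      have "smooth \<phi>"
        unfolding \<phi>_def[abs_def] by (intro smooth_diff smooth_compose[OF H(1)] smooth_affine)
      moreover have "\<phi> r = 0" if "r \<notin> {s..t + \<epsilon>}" for r
      proof -
        have "r < s \<or> t + \<epsilon> < r" using that by auto
        then show ?thesis
        proof
          assume "r < s"
          then have "(r - t) / \<epsilon> \<le> 0" "(r - s) / \<epsilon> \<le> 0"
            using \<epsilon> st by (auto simp: divide_nonpos_pos)
          then show ?thesis unfolding \<phi>_def arg by (simp only: H(2) diff_self)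
        next
          assume "t + \<epsilon> < r"
          then have "1 \<le> (r - t) / \<epsilon>" "1 \<le> (r - s) / \<epsilon>"
            using \<epsilon> st by auto
          then show ?thesis unfolding \<phi>_def arg by (simp only: H(3) diff_self)
        qed
      qed
      ultimately have "test_function T \<phi>"
        unfolding test_function_def smooth_def using st \<epsilon> by blast
      then have "integral {0..T} (\<lambda>r. deriv \<phi> r *\<^sub>R w r) = 0" by (rule weak)
      moreover have "deriv \<phi> r = k s r - k t r" for r
      proof (rule DERIV_imp_deriv)
        show "(\<phi> has_real_derivative k s r - k t r) (at r)"
          unfolding \<phi>_def[abs_def] arg k_def using \<epsilon>
          by (auto intro!: derivative_eq_intros DERIV_chain2[OF smooth_DERIV[OF H(1)]])
      qed
      moreover have "continuous_on {0..T} (\<lambda>r. k p r *\<^sub>R w r)" for p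
      proof -
        have "continuous_on UNIV (deriv H)"
          using smooth_DERIV[OF smooth_deriv[OF H(1)]] DERIV_isCont continuous_at_imp_continuous_on by blast
        then have "continuous_on {0..T} (\<lambda>r. deriv H ((r - p) / \<epsilon>))"
          by (rule continuous_on_compose2) (use \<epsilon> in \<open>auto intro!: continuous_intros\<close>)
        then show ?thesis using \<epsilon> w unfolding k_def by (auto intro!: continuous_intros)
      qed
      ultimately have "integral {0..T} (\<lambda>r. k s r *\<^sub>R w r) = integral {0..T} (\<lambda>r. k t r *\<^sub>R w r)"
        (is "?a = _")
        by (simp add: scaleR_diff_left Henstock_Kurzweil_Integration.integral_diff integrable_continuous_real)
      moreover have "norm (integral {0..T} (\<lambda>r. k t r *\<^sub>R w r) - w t) \<le> e / 2"
        unfolding k_def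
        by (rule mollifier_estimate[OF H]) (use st \<epsilon> w d2(2) in \<open>auto simp: dist_norm intro!: less_imp_le\<close>)
      moreover have "norm (?a - w s) \<le> e / 2"
        unfolding k_def
        by (rule mollifier_estimate[OF H]) (use st \<epsilon> w d1(2) in \<open>auto simp: dist_norm intro!: less_imp_le\<close>)
      ultimately show ?thesis
        using norm_triangle_ineq4[of "?a - w t" "?a - w s"] by simp
    qed
    then show ?thesis using field_le_epsilon[of "norm (w s - w t)" 0] by simp
  qed
  have inner: "w r = w (T / 2)" if "r \<in> {0<..<T}" for r
  proof (cases r "T / 2" rule: linorder_cases)
    case less
    then show ?thesis using that T by (intro eq) auto
  next
    case greater
    then show ?thesis using that T by (intro eq[symmetric]) auto
  qed (simp only:)
  \<comment> \<open>Test functions compare interior points only; the end points are reached by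
    continuity.\<close>
  have cl: "closure {0<..<T} = {0..T}" using T by simp
  have const: "w r = w (T / 2)" if "r \<in> {0..T}" for r
    using continuous_constant_on_closure[of "{0<..<T}" w "w (T / 2)" r] w inner that
    unfolding cl by blast
  have "0 \<in> {0..T}" using T by simp
  then show ?thesis using const[OF t] const[of 0] by simp
qed

section \<open>Convergence of cell averages in \<open>L\<^sup>2\<close>\<close>


lemma square_integrable_sq_diff:
  assumes "square_integrable S h" "square_integrable S k"
  shows "integrable (lebesgue_on S) (\<lambda>x. (h x - k x)\<^sup>2)"
  using square_integrable_diff[OF assms] by (simp add: square_integrable_def)

lemma square_diff_le: "(a - c :: real)\<^sup>2 \<le> 2 * (a - b)\<^sup>2 + 2 * (b - c)\<^sup>2"
proof -
  have "0 \<le> ((a - b) - (b - c))\<^sup>2" by simp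
  then show ?thesis by (simp add: power2_eq_square algebra_simps)
qed

text \<open>Kept for squared norms over an arbitrary set \<open>S\<close>: the type
  \<open>L2\<close> covers only the unit interval, while the estimate is needed for the square and
  for single cells as well.\<close>

lemma L2_norm_sq_triangle:
  assumes "square_integrable S a" "square_integrable S b" "square_integrable S c"
  shows "(LINT x|lebesgue_on S. (a x - c x)\<^sup>2)
    \<le> 2 * (LINT x|lebesgue_on S. (a x - b x)\<^sup>2) + 2 * (LINT x|lebesgue_on S. (b x - c x)\<^sup>2)"
proof -
  have "(LINT x|lebesgue_on S. (a x - c x)\<^sup>2) \<le> (LINT x|lebesgue_on S. 2 * (a x - b x)\<^sup>2 + 2 * (b x - c x)\<^sup>2)"
    using assms by (intro integral_mono) (auto intro!: square_integrable_sq_diff square_diff_le)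
  also have "\<dots> = 2 * (LINT x|lebesgue_on S. (a x - b x)\<^sup>2) + 2 * (LINT x|lebesgue_on S. (b x - c x)\<^sup>2)"
    using assms by (subst Bochner_Integration.integral_add) (auto intro!: square_integrable_sq_diff)
  finally show ?thesis .
qed

text \<open>Two stages of dominated convergence: cutting \<open>h\<close> off at height
  \<open>m\<close>, with majorant \<open>h^2\<close>, and then approximating the cut-off function,
  with a constant majorant because \<open>S\<close> has finite measure.\<close>

lemma L2_continuous_approx:
  fixes S :: "'a::euclidean_space set"
  assumes S: "compact S" and h: "square_integrable S h" and e: "0 < e"
  obtains q where "continuous_on UNIV q" "square_integrable S q" "(LINT x|lebesgue_on S. (q x - h x)\<^sup>2) < e"
proof -
  let ?M = "lebesgue_on S"
  have fin: "finite_measure ?M"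
    using S by (intro finite_measure_lebesgue_on lmeasurable_compact)
  have Sm: "S \<in> sets lebesgue" using S by (auto intro: lmeasurable_compact fmeasurableD)
  have hm [measurable]: "h \<in> borel_measurable ?M" using h by (simp add: square_integrable_def)
  define tr where "tr m x = max (- real m) (min (real m) x)" for m x
  have tr_le: "\<bar>tr m x\<bar> \<le> real m" for m x by (auto simp: tr_def)
  have tr_c: "continuous_on UNIV (tr m)" for m unfolding tr_def by (intro continuous_intros)
  then have [measurable]: "tr m \<in> borel_measurable borel" for m
    by (rule borel_measurable_continuous_onI)
  have sq: "square_integrable S (\<lambda>x. tr m (a x))" if [measurable]: "a \<in> borel_measurable ?M" for m a
  proof -
    have "integrable ?M (\<lambda>x. (tr m (a x))\<^sup>2)"
      by (rule finite_measure.integrable_const_bound[OF fin, of _ "(real m)\<^sup>2"])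
        (use tr_le[of m] in \<open>auto intro!: AE_I2 simp: abs_le_square_iff[symmetric]\<close>)
    then show ?thesis by (simp add: square_integrable_def)
  qed
  have "(\<lambda>m. LINT x|?M. (tr m (h x) - h x)\<^sup>2) \<longlonglongrightarrow> (LINT x|?M. 0)"
  proof (rule integral_dominated_convergence[where w="\<lambda>x. (h x)\<^sup>2"])
    show "integrable ?M (\<lambda>x. (h x)\<^sup>2)" using h by (simp add: square_integrable_def)
    show "AE x in ?M. (\<lambda>m. (tr m (h x) - h x)\<^sup>2) \<longlonglongrightarrow> 0"
    proof (rule AE_I2, rule tendsto_eventually)
      fix x
      obtain N where "\<bar>h x\<bar> \<le> real N" using real_arch_simple by blast
      then have "\<forall>m\<ge>N. (tr m (h x) - h x)\<^sup>2 = 0" by (auto simp: tr_def)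
      then show "\<forall>\<^sub>F m in sequentially. (tr m (h x) - h x)\<^sup>2 = 0"
        by (auto simp: eventually_sequentially)
    qed
    show "AE x in ?M. norm ((tr m (h x) - h x)\<^sup>2) \<le> (h x)\<^sup>2" for m
      by (auto intro!: AE_I2 simp: tr_def simp flip: abs_le_square_iff)
  qed auto
  then have "\<forall>\<^sub>F m in sequentially. (LINT x|?M. (tr m (h x) - h x)\<^sup>2) < e / 4"
    using e by (intro order_tendstoD) auto
  then obtain m where m: "(LINT x|?M. (tr m (h x) - h x)\<^sup>2) < e / 4"
    by (auto simp: eventually_sequentially)
  \<comment> \<open>\<open>measurable_on\<close> unfolds to almost everywhere convergence of
    continuous functions; applying \<open>tr m\<close> to them keeps continuity and makes them
    bounded.\<close>
  obtain N g where N: "negligible N" and g: "\<And>n. continuous_on UNIV (g n)"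
    and lim: "\<And>x. x \<notin> N \<Longrightarrow> (\<lambda>n. g n x) \<longlonglongrightarrow> (if x \<in> S then h x else 0)"
    using measurable_on_iff_borel_measurable[OF Sm, of h] unfolding measurable_on_def by auto
  have trg: "continuous_on UNIV (\<lambda>x. tr m (g n x))" for n
    by (rule continuous_on_compose2[OF tr_c g]) auto
  have gm [measurable]: "g n \<in> borel_measurable ?M" for n
    by (rule continuous_imp_measurable_on_sets_lebesgue[OF _ Sm]) (rule continuous_on_subset[OF g], simp)
  have "(\<lambda>n. LINT x|?M. (tr m (g n x) - tr m (h x))\<^sup>2) \<longlonglongrightarrow> (LINT x|?M. 0)"
  proof (rule integral_dominated_convergence[where w="\<lambda>x. (2 * real m)\<^sup>2"])
    show "integrable ?M (\<lambda>x. (2 * real m)\<^sup>2)"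
      by (rule finite_measure.integrable_const[OF fin])
    have "AE x in lebesgue. x \<notin> N" using N by (simp add: negligible_iff_null_sets AE_not_in)
    then have "AE x in ?M. x \<notin> N \<and> x \<in> S"
      using Sm by (subst AE_restrict_space_iff) auto
    then show "AE x in ?M. (\<lambda>n. (tr m (g n x) - tr m (h x))\<^sup>2) \<longlonglongrightarrow> 0"
    proof eventually_elim
      case (elim x)
      then have "(\<lambda>n. g n x) \<longlonglongrightarrow> h x" using lim[of x] by simp
      then have "(\<lambda>n. tr m (g n x)) \<longlonglongrightarrow> tr m (h x)"
        unfolding tr_def by (intro tendsto_intros)
      then have "(\<lambda>n. (tr m (g n x) - tr m (h x))\<^sup>2) \<longlonglongrightarrow> (tr m (h x) - tr m (h x))\<^sup>2"
        by (intro tendsto_intros)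
      then show ?case by simp
    qed
    show "AE x in ?M. norm ((tr m (g n x) - tr m (h x))\<^sup>2) \<le> (2 * real m)\<^sup>2" for n
    proof (rule AE_I2)
      fix x
      have "\<bar>tr m (g n x) - tr m (h x)\<bar> \<le> \<bar>2 * real m\<bar>"
        using tr_le[of m "g n x"] tr_le[of m "h x"] by linarith
      then show "norm ((tr m (g n x) - tr m (h x))\<^sup>2) \<le> (2 * real m)\<^sup>2"
        unfolding abs_le_square_iff by simp
    qed
  qed auto
  then have "\<forall>\<^sub>F n in sequentially. (LINT x|?M. (tr m (g n x) - tr m (h x))\<^sup>2) < e / 4"
    using e by (intro order_tendstoD) auto
  then obtain n where n: "(LINT x|?M. (tr m (g n x) - tr m (h x))\<^sup>2) < e / 4"
    by (auto simp: eventually_sequentially)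
  show thesis
  proof (rule that[OF trg[of n] sq[OF gm]])
    show "(LINT x|?M. (tr m (g n x) - h x)\<^sup>2) < e"
      using L2_norm_sq_triangle[OF sq[OF gm, of m n] sq[OF hm, of m] h] m n by linarith
  qed
qed

text \<open>When the square is expanded around the mean \<open>a\<close>, the cross term integrates
  to zero and \<open>(c - a)^2\<close> times the measure of \<open>C\<close> remains.\<close>

lemma average_minimizes_L2_distance:
  fixes C :: "'a::euclidean_space set"
  assumes C: "C \<in> lmeasurable" "0 < measure lebesgue C" and k: "square_integrable C k"
  shows "(LINT x|lebesgue_on C. ((LINT z|lebesgue_on C. k z) / measure lebesgue C - k x)\<^sup>2)
    \<le> (LINT x|lebesgue_on C. (c - k x)\<^sup>2)"
proof -
  let ?M = "lebesgue_on C"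
  define a where "a = (LINT z|?M. k z) / measure lebesgue C"
  have fin: "finite_measure ?M" using C by (intro finite_measure_lebesgue_on)
  have Cm: "C \<in> sets lebesgue" using C(1) by (rule fmeasurableD)
  have const: "square_integrable C (\<lambda>x. b)" for b
    by (auto simp: square_integrable_def intro!: finite_measure.integrable_const[OF fin])
  have ki: "integrable ?M k"
    using square_integrable_mult[OF k const[of 1]] by simp
  have i: "integrable ?M (\<lambda>x. (a - k x)\<^sup>2)"
    by (rule square_integrable_sq_diff[OF const k])
  have ci: "integrable ?M (\<lambda>x. b)" for b :: real by (rule finite_measure.integrable_const[OF fin])
  have mC: "measure ?M (space ?M) = measure lebesgue C"
    using Cm by (simp add: space_restrict_space measure_restrict_space)
  have "(LINT x|?M. (c - k x)\<^sup>2) = (LINT x|?M. (a - k x)\<^sup>2 + ((c - a)\<^sup>2 + 2 * (c - a) * (a - k x)))"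
    by (rule Bochner_Integration.integral_cong) (auto simp: power2_eq_square algebra_simps)
  also have "\<dots> = (LINT x|?M. (a - k x)\<^sup>2) + ((c - a)\<^sup>2 * measure lebesgue C
      + 2 * (c - a) * (a * measure lebesgue C - (LINT x|?M. k x)))"
    using i ci ki mC by simp
  also have "a * measure lebesgue C - (LINT x|?M. k x) = 0"
    using C(2) by (simp add: a_def)
  finally show ?thesis using C(2) unfolding a_def by simp
qed

lemma integral_lebesgue_on_subset:
  fixes f :: "'a::euclidean_space \<Rightarrow> real"
  assumes "C \<in> sets lebesgue" "S \<in> sets lebesgue" "C \<subseteq> S"
  shows "(LINT x|lebesgue_on S. indicator C x * f x) = (LINT x|lebesgue_on C. f x)"
proof -
  have "(LINT x|lebesgue_on S. indicator C x * f x) = (LINT x|lebesgue. indicator S x *\<^sub>R (indicator C x * f x))"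
    using assms by (subst integral_restrict_space) auto
  also have "\<dots> = (LINT x|lebesgue. indicator C x *\<^sub>R f x)"
    using assms by (intro Bochner_Integration.integral_cong) (auto simp: indicator_def)
  also have "\<dots> = (LINT x|lebesgue_on C. f x)"
    using assms by (subst integral_restrict_space) auto
  finally show ?thesis .
qed

lemma square_integrable_subset:
  fixes S :: "'a::euclidean_space set"
  assumes "square_integrable S h" "C \<in> sets lebesgue" "S \<in> sets lebesgue" "C \<subseteq> S"
  shows "square_integrable C h"
proof -
  have i: "integrable (lebesgue_on S) (\<lambda>x. (h x)\<^sup>2)" and m: "h \<in> borel_measurable (lebesgue_on S)"
    using assms(1) by (auto simp: square_integrable_def)
  have "h \<in> borel_measurable (lebesgue_on C)"
    using m by (rule measurable_restrict_mono) fact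
  moreover have "integrable (lebesgue_on C) (\<lambda>x. (h x)\<^sup>2)"
    using set_integrable_subset[of lebesgue S "\<lambda>x. (h x)\<^sup>2" C] i assms(2-4)
    by (simp add: integrable_restrict_space set_integrable_def)
  ultimately show ?thesis by (simp add: square_integrable_def)
qed

text \<open>Abstract partitions make the interval and the square instances of one result, and
  \<open>k n\<close> may change with \<open>n\<close>, as truncation requires. The comparison is
  with a continuous \<open>q\<close> close to \<open>h\<close>: on a cell the mean of
  \<open>k n\<close> approximates \<open>k n\<close> at least as well as the constant
  \<open>q y\<close>, and \<open>q\<close> hardly varies on a small cell.\<close>

theorem cell_averages_tendsto_L2:
  fixes S :: "'a::euclidean_space set" and C :: "nat \<Rightarrow> 'i \<Rightarrow> 'a set"
  assumes S: "compact S"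
    and fin: "\<And>n. finite (J n)"
    and C: "\<And>n i. i \<in> J n \<Longrightarrow> C n i \<in> sets lebesgue" "\<And>n i. i \<in> J n \<Longrightarrow> C n i \<subseteq> S"
      "\<And>n i. i \<in> J n \<Longrightarrow> 0 < measure lebesgue (C n i)"
    and disj: "\<And>n. disjoint_family_on (C n) (J n)"
    and cover: "\<And>n. 1 \<le> n \<Longrightarrow> negligible (S - (\<Union>i\<in>J n. C n i))"
    and diam: "\<And>e. 0 < e \<Longrightarrow> \<forall>\<^sub>F n in sequentially. \<forall>i\<in>J n. \<forall>x\<in>C n i. \<forall>y\<in>C n i. dist x y < e"
    and h: "square_integrable S h" and k: "\<And>n. square_integrable S (k n)"
    and lim: "(\<lambda>n. LINT x|lebesgue_on S. (k n x - h x)\<^sup>2) \<longlonglongrightarrow> 0"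
  shows "(\<lambda>n. LINT x|lebesgue_on S. ((\<Sum>i\<in>J n. (LINT z|lebesgue_on (C n i). k n z) / measure lebesgue (C n i)
      * indicator (C n i) x) - h x)\<^sup>2) \<longlonglongrightarrow> 0"
proof -
  let ?M = "lebesgue_on S"
  define a where "a n i = (LINT z|lebesgue_on (C n i). k n z) / measure lebesgue (C n i)" for n i
  define P where "P n x = (\<Sum>i\<in>J n. a n i * indicator (C n i) x)" for n x
  have finM: "finite_measure ?M"
    using S by (intro finite_measure_lebesgue_on lmeasurable_compact)
  have Sm: "S \<in> sets lebesgue" using S by (auto intro: lmeasurable_compact fmeasurableD)
  have Cl: "C n i \<in> lmeasurable" if "i \<in> J n" for n i
    using fmeasurableI2[OF lmeasurable_compact[OF S] C(2,1)[OF that]] .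
  have const: "integrable ?M (\<lambda>x. b)" for b :: real by (rule finite_measure.integrable_const[OF finM])
  have csq: "square_integrable (C n i) (\<lambda>x. b)" if "i \<in> J n" for n i and b :: real
    using finite_measure.integrable_const[OF finite_measure_lebesgue_on[OF Cl[OF that]]]
    by (simp add: square_integrable_def)
  have sub: "square_integrable (C n i) u" if "i \<in> J n" "square_integrable S u" for n i u
    using square_integrable_subset[OF that(2) C(1)[OF that(1)] Sm C(2)[OF that(1)]] .
  have P_eq: "P n x = a n i" if "i \<in> J n" "x \<in> C n i" for n i x
  proof -
    have "x \<notin> C n j" if "j \<in> J n - {i}" for j
      using disj[of n] that \<open>i \<in> J n\<close> \<open>x \<in> C n i\<close> by (auto simp: disjoint_family_on_def)
    then show ?thesis
      unfolding P_def using that fin[of n] by (subst sum.remove[of _ i]) auto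
  qed
  have AE: "AE x in ?M. \<exists>i\<in>J n. x \<in> C n i" if "1 \<le> n" for n
  proof -
    have "AE x in lebesgue. x \<notin> S - (\<Union>i\<in>J n. C n i)"
      using cover[OF that] by (intro AE_not_in) (simp add: negligible_iff_null_sets)
    then have "AE x in lebesgue. x \<in> S \<longrightarrow> (\<exists>i\<in>J n. x \<in> C n i)" by eventually_elim auto
    then show ?thesis using Sm by (subst AE_restrict_space_iff) (simp_all only: space_completion space_lborel space_borel Int_UNIV_right)
  qed
  have sum1: "(\<Sum>i\<in>J n. indicator (C n i) x * b i) = b j" if "j \<in> J n" "x \<in> C n j" for n j x and b :: "'i \<Rightarrow> real"
  proof -
    have "x \<notin> C n i" if "i \<in> J n - {j}" for i
      using disj[of n] that \<open>j \<in> J n\<close> \<open>x \<in> C n j\<close> by (auto simp: disjoint_family_on_def)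
    then show ?thesis
      using that fin[of n] by (subst sum.remove[of _ j]) auto
  qed
  have ind_i: "integrable ?M (\<lambda>x. indicator (C n i) x * u x)"
    if "i \<in> J n" "integrable (lebesgue_on (C n i)) u" for n i and u :: "'a \<Rightarrow> real"
  proof -
    have "integrable lebesgue (\<lambda>x. indicator (C n i) x *\<^sub>R u x)"
      using that C(1) by (subst integrable_restrict_space[symmetric]) auto
    moreover have "(\<lambda>x. indicator (C n i) x *\<^sub>R u x) = (\<lambda>x. indicator S x *\<^sub>R (indicator (C n i) x * u x))"
      using C(2)[OF that(1)] by (auto simp: indicator_def fun_eq_iff)
    ultimately show ?thesis
      using Sm by (subst integrable_restrict_space) auto
  qed
  \<comment> \<open>Three uses of \<open>square_diff_le\<close> give the coefficients:
    \<open>a n i - h x\<close> is split at \<open>k n x\<close>, then \<open>q y - k n x\<close> at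
    \<open>h x\<close>, then \<open>q y - h x\<close> at \<open>q x\<close>. The last coefficient is
    \<open>6 = 2 + 4\<close>.\<close>
  have key: "(LINT x|?M. (P n x - h x)\<^sup>2)
      \<le> 8 * e\<^sup>2 * measure lebesgue S + 8 * (LINT x|?M. (q x - h x)\<^sup>2) + 6 * (LINT x|?M. (k n x - h x)\<^sup>2)"
    if n: "1 \<le> n" and q: "square_integrable S q" and e: "\<And>i x y. i \<in> J n \<Longrightarrow> x \<in> C n i \<Longrightarrow> y \<in> C n i \<Longrightarrow> dist (q x) (q y) \<le> e"
    for n q e
  proof -
    define R where "R x = 8 * e\<^sup>2 + 8 * (q x - h x)\<^sup>2 + 6 * (k n x - h x)\<^sup>2" for x
    have R: "integrable ?M R"
      unfolding R_def[abs_def] by (intro Bochner_Integration.integrable_add integrable_mult_right const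
          square_integrable_sq_diff q h k)
    have cell: "(LINT x|?M. indicator (C n i) x * (a n i - h x)\<^sup>2) \<le> (LINT x|?M. indicator (C n i) x * R x)"
      if i: "i \<in> J n" for i
    proof -
      let ?N = "lebesgue_on (C n i)"
      note s = csq[OF i] sub[OF i h] sub[OF i k] sub[OF i q]
      have "C n i \<noteq> {}" using C(3)[OF i] by auto
      then obtain y where y: "y \<in> C n i" by blast
      have "(LINT x|?N. (a n i - h x)\<^sup>2) \<le> 2 * (LINT x|?N. (a n i - k n x)\<^sup>2) + 2 * (LINT x|?N. (k n x - h x)\<^sup>2)"
        by (rule L2_norm_sq_triangle) (rule s)+
      also have "(LINT x|?N. (a n i - k n x)\<^sup>2) \<le> (LINT x|?N. (q y - k n x)\<^sup>2)"
        unfolding a_def by (rule average_minimizes_L2_distance[OF Cl[OF i] C(3)[OF i] s(3)])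
      also have "2 * (LINT x|?N. (q y - k n x)\<^sup>2) + 2 * (LINT x|?N. (k n x - h x)\<^sup>2)
          = (LINT x|?N. 2 * (q y - k n x)\<^sup>2 + 2 * (k n x - h x)\<^sup>2)"
        using s by (subst Bochner_Integration.integral_add) (auto intro!: square_integrable_sq_diff)
      also have "\<dots> \<le> (LINT x|?N. R x)"
      proof (rule integral_mono)
        show "integrable ?N (\<lambda>x. 2 * (q y - k n x)\<^sup>2 + 2 * (k n x - h x)\<^sup>2)"
          by (intro Bochner_Integration.integrable_add integrable_mult_right square_integrable_sq_diff s)
        show "integrable ?N R"
          unfolding R_def[abs_def] using csq[OF i, of 1]
          by (intro Bochner_Integration.integrable_add integrable_mult_right square_integrable_sq_diff s
              finite_measure.integrable_const[OF finite_measure_lebesgue_on[OF Cl[OF i]]])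
        fix x assume "x \<in> space ?N"
        then have "\<bar>q y - q x\<bar> \<le> \<bar>e\<bar>" using e[OF i y, of x] by (auto simp: dist_real_def)
        then have "(q y - q x)\<^sup>2 \<le> e\<^sup>2" unfolding abs_le_square_iff .
        then show "2 * (q y - k n x)\<^sup>2 + 2 * (k n x - h x)\<^sup>2 \<le> R x"
          using square_diff_le[of "q y" "k n x" "h x"] square_diff_le[of "q y" "h x" "q x"]
          by (simp add: R_def power2_commute[of "h x" "k n x"])
      qed
      finally show ?thesis
        unfolding integral_lebesgue_on_subset[OF C(1)[OF i] Sm C(2)[OF i]] by simp
    qed
    have i1: "integrable ?M (\<lambda>x. indicator (C n i) x * (a n i - h x)\<^sup>2)" if "i \<in> J n" for i
      by (rule ind_i[OF that]) (intro square_integrable_sq_diff csq sub that h)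
    have i2: "integrable ?M (\<lambda>x. indicator (C n i) x * R x)" if "i \<in> J n" for i
      using integrable_mult_indicator[OF _ R, of "C n i"] C(1,2)[OF that] Sm
      by (auto simp: sets_restrict_space_iff)
    have hm: "h \<in> borel_measurable ?M" using h by (simp add: square_integrable_def)
    have Pm: "P n \<in> borel_measurable ?M"
      unfolding P_def[abs_def] using C(1)
      by (intro borel_measurable_sum borel_measurable_times borel_measurable_const
          measurable_restrict_space1 borel_measurable_indicator) auto
    have "(LINT x|?M. (P n x - h x)\<^sup>2) = (LINT x|?M. (\<Sum>i\<in>J n. indicator (C n i) x * (a n i - h x)\<^sup>2))"
    proof (rule integral_cong_AE)
      show "AE x in ?M. (P n x - h x)\<^sup>2 = (\<Sum>i\<in>J n. indicator (C n i) x * (a n i - h x)\<^sup>2)"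
        using AE[OF n] by eventually_elim (auto simp: P_eq sum1)
      show "(\<lambda>x. \<Sum>i\<in>J n. indicator (C n i) x * (a n i - h x)\<^sup>2) \<in> borel_measurable ?M"
        using i1 by (intro borel_measurable_sum) auto
    qed (use hm Pm in measurable)
    also have "\<dots> = (\<Sum>i\<in>J n. (LINT x|?M. indicator (C n i) x * (a n i - h x)\<^sup>2))"
      using i1 by (intro Bochner_Integration.integral_sum)
    also have "\<dots> \<le> (\<Sum>i\<in>J n. (LINT x|?M. indicator (C n i) x * R x))"
      by (intro sum_mono cell)
    also have "\<dots> = (LINT x|?M. (\<Sum>i\<in>J n. indicator (C n i) x * R x))"
      using i2 by (intro Bochner_Integration.integral_sum[symmetric])
    also have "\<dots> = (LINT x|?M. R x)"
    proof (rule integral_cong_AE)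
      show "AE x in ?M. (\<Sum>i\<in>J n. indicator (C n i) x * R x) = R x"
        using AE[OF n] by eventually_elim (auto simp: sum1)
      show "(\<lambda>x. \<Sum>i\<in>J n. indicator (C n i) x * R x) \<in> borel_measurable ?M"
        using i2 by (intro borel_measurable_sum) auto
    qed (use R in auto)
    also have "\<dots> = 8 * e\<^sup>2 * measure lebesgue S + 8 * (LINT x|?M. (q x - h x)\<^sup>2) + 6 * (LINT x|?M. (k n x - h x)\<^sup>2)"
    proof -
      have "measure ?M (space ?M) = measure lebesgue S"
        using Sm by (simp add: space_restrict_space measure_restrict_space)
      moreover have "integrable ?M (\<lambda>x. 8 * (q x - h x)\<^sup>2)" "integrable ?M (\<lambda>x. 6 * (k n x - h x)\<^sup>2)"
        by (intro integrable_mult_right square_integrable_sq_diff q h k)+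
      ultimately show ?thesis
        unfolding R_def[abs_def] using const
        by (simp add: Bochner_Integration.integral_add Bochner_Integration.integrable_add del: integrable_mult_right_iff)
    qed
    finally show ?thesis .
  qed
  have "(\<lambda>n. LINT x|?M. (P n x - h x)\<^sup>2) \<longlonglongrightarrow> 0"
  proof (rule LIMSEQ_I)
    fix r :: real assume r: "0 < r"
    obtain q where q: "continuous_on UNIV q" "square_integrable S q" "(LINT x|?M. (q x - h x)\<^sup>2) < r / 32"
      using L2_continuous_approx[OF S h, of "r / 32"] r by auto
    \<comment> \<open>Makes the oscillation term at most \<open>r / 4\<close>; the added
      \<open>1\<close> covers \<open>measure lebesgue S = 0\<close>. With the thresholds
      \<open>r / 32\<close> and \<open>r / 24\<close> the three terms stay below
      \<open>3 * r / 4\<close>.\<close>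
    define e where "e = sqrt (r / (32 * (measure lebesgue S + 1)))"
    have mS: "0 \<le> measure lebesgue S" by simp
    have e0: "0 < e" using r mS by (auto simp: e_def intro!: divide_pos_pos add_nonneg_pos)
    have "e\<^sup>2 = r / (32 * (measure lebesgue S + 1))"
      unfolding e_def using r mS by (intro real_sqrt_pow2 divide_nonneg_nonneg) auto
    then have "r = 32 * (e\<^sup>2 * measure lebesgue S) + 32 * e\<^sup>2"
      using mS by (simp add: field_simps)
    then have e2: "8 * e\<^sup>2 * measure lebesgue S \<le> r / 4"
      using zero_le_power2[of e] by simp
    have "uniformly_continuous_on S q"
      using compact_uniformly_continuous[OF continuous_on_subset[OF q(1)] S] by simp
    then obtain d where d: "d > 0" "\<And>x y. x \<in> S \<Longrightarrow> y \<in> S \<Longrightarrow> dist x y < d \<Longrightarrow> dist (q x) (q y) < e"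
      unfolding uniformly_continuous_on_def using e0 by meson
    have "\<forall>\<^sub>F n in sequentially. norm ((LINT x|?M. (P n x - h x)\<^sup>2) - 0) < r"
      using diam[OF d(1)] eventually_ge_at_top[of 1] order_tendstoD(2)[OF lim, of "r / 24", simplified, OF r]
    proof eventually_elim
      case (elim n)
      have "dist (q x) (q y) \<le> e" if "i \<in> J n" "x \<in> C n i" "y \<in> C n i" for i x y
        using d(2)[of x y] elim(1) C(2)[OF that(1)] that by (auto intro!: less_imp_le)
      then have "(LINT x|?M. (P n x - h x)\<^sup>2)
          \<le> 8 * e\<^sup>2 * measure lebesgue S + 8 * (LINT x|?M. (q x - h x)\<^sup>2) + 6 * (LINT x|?M. (k n x - h x)\<^sup>2)"
        by (rule key[OF elim(2) q(2)])
      then have "(LINT x|?M. (P n x - h x)\<^sup>2) < r"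
        using e2 q(3) elim(3) r by linarith
      then show ?case by simp
    qed
    then show "\<exists>no. \<forall>n\<ge>no. norm ((LINT x|?M. (P n x - h x)\<^sup>2) - 0) < r"
      by (simp add: eventually_sequentially)
  qed
  then show ?thesis unfolding P_def a_def .
qed

section \<open>Weak and classical solutions\<close>


lemma continuous_L2_measurable:
  fixes h :: "real \<Rightarrow> L2"
  assumes "continuous_on {0..T} h"
  shows "h \<in> borel_measurable (lebesgue_on {0..T})"
  using assms by (rule continuous_imp_measurable_on_sets_lebesgue) auto

lemma integrable_continuous_L2:
  fixes h :: "real \<Rightarrow> L2"
  assumes "continuous_on {0..T} h"
  shows "integrable (lebesgue_on {0..T}) h"
proof -
  obtain B where B: "\<And>t. t \<in> {0..T} \<Longrightarrow> norm (h t) \<le> B"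
    using compact_imp_bounded[OF compact_continuous_image[OF assms compact_Icc]] unfolding bounded_iff by blast
  show ?thesis
    by (rule finite_measure.integrable_const_bound[of _ _ B])
      (use B continuous_L2_measurable[OF assms] in \<open>auto intro!: finite_measure_lebesgue_on AE_I2\<close>)
qed

lemma L2_Bochner_continuous:
  assumes "continuous_on {0..T} h"
  shows "L2_Bochner T h"
proof -
  have "continuous_on {0..T} (\<lambda>t. (norm (h t))\<^sup>2)" by (intro continuous_intros assms)
  then have "integrable (lebesgue_on {0..T}) (\<lambda>t. (norm (h t))\<^sup>2)"
    by (intro continuous_imp_integrable_real)
  then show ?thesis using continuous_L2_measurable[OF assms] by (simp add: L2_Bochner_def)
qed

text \<open>The weak formulation uses Bochner integrals, the calculus lemmas the gauge integral.
  Pairing with every \<open>v\<close> reduces their agreement to real-valued integrands.\<close>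

lemma lebesgue_integral_continuous_L2:
  fixes h :: "real \<Rightarrow> L2"
  assumes h: "continuous_on {0..T} h"
  shows "(LINT t|lebesgue_on {0..T}. h t) = integral {0..T} h"
proof -
  have "inner (LINT t|lebesgue_on {0..T}. h t) v = inner (integral {0..T} h) v" for v
  proof -
    have i: "integrable (lebesgue_on {0..T}) h" by (rule integrable_continuous_L2[OF h])
    have "inner (LINT t|lebesgue_on {0..T}. h t) v = (LINT t|lebesgue_on {0..T}. inner (h t) v)"
      using i by (intro integral_inner_left[symmetric]) auto
    also have "\<dots> = integral {0..T} (\<lambda>t. inner (h t) v)"
      using i by (intro lebesgue_integral_eq_integral) auto
    also have "\<dots> = inner (integral {0..T} h) v"
      using integral_linear[OF integrable_continuous_real[OF h] bounded_linear_inner_left[of v]]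
      by (simp add: o_def)
    finally show ?thesis .
  qed
  then have "inner ((LINT t|lebesgue_on {0..T}. h t) - integral {0..T} h) v = 0" for v
    by (simp add: inner_diff_left)
  then show ?thesis using inner_eq_zero_iff by force
qed

lemma test_function_smooth: "test_function T \<phi> \<Longrightarrow> smooth \<phi>"
  by (simp add: test_function_def smooth_def)

lemma smooth_continuous_on: "smooth h \<Longrightarrow> continuous_on A h"
  using smooth_DERIV DERIV_isCont continuous_at_imp_continuous_on by blast

lemma integral_by_parts_test_function:
  fixes u G :: "real \<Rightarrow> 'a::banach"
  assumes \<phi>: "test_function T \<phi>" and T: "0 < T"
    and u: "\<And>t. t \<in> {0..T} \<Longrightarrow> (u has_vector_derivative G t) (at t within {0..T})"
    and G: "continuous_on {0..T} G"
  shows "integral {0..T} (\<lambda>t. deriv \<phi> t *\<^sub>R u t) = - integral {0..T} (\<lambda>t. \<phi> t *\<^sub>R G t)"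
proof -
  note s = test_function_smooth[OF \<phi>]
  have uc: "continuous_on {0..T} u" by (rule continuous_on_vector_derivative[OF u])
  have "\<phi> 0 = 0" "\<phi> T = 0" using \<phi> by (auto simp: test_function_def)
  moreover have "((\<lambda>t. \<phi> t *\<^sub>R G t + deriv \<phi> t *\<^sub>R u t) has_integral (\<phi> T *\<^sub>R u T - \<phi> 0 *\<^sub>R u 0)) {0..T}"
    by (rule fundamental_theorem_of_calculus)
      (use T in \<open>auto intro!: has_vector_derivative_scaleR u has_field_derivative_at_within smooth_DERIV[OF s]\<close>)
  ultimately have "integral {0..T} (\<lambda>t. \<phi> t *\<^sub>R G t + deriv \<phi> t *\<^sub>R u t) = 0"
    by (simp add: integral_unique)
  moreover have "(\<lambda>t. \<phi> t *\<^sub>R G t) integrable_on {0..T}" "(\<lambda>t. deriv \<phi> t *\<^sub>R u t) integrable_on {0..T}"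
    by (intro integrable_continuous_real continuous_on_scaleR smooth_continuous_on s smooth_deriv G uc)+
  ultimately show ?thesis
    by (simp add: Henstock_Kurzweil_Integration.integral_add eq_neg_iff_add_eq_0 add.commute)
qed

lemma weak_derivative_of_C1:
  assumes T: "0 < T"
    and u: "\<And>t. t \<in> {0..T} \<Longrightarrow> (u has_vector_derivative G t) (at t within {0..T})"
    and G: "continuous_on {0..T} G"
  shows "weak_derivative T u G"
  unfolding weak_derivative_def
proof (intro allI impI)
  fix \<phi> assume \<phi>: "test_function T \<phi>"
  note s = test_function_smooth[OF \<phi>]
  have uc: "continuous_on {0..T} u" by (rule continuous_on_vector_derivative[OF u])
  show "(LINT t|lebesgue_on {0..T}. deriv \<phi> t *\<^sub>R u t) = - (LINT t|lebesgue_on {0..T}. \<phi> t *\<^sub>R G t)"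
    using integral_by_parts_test_function[OF \<phi> T u G]
    by (simp add: lebesgue_integral_continuous_L2 continuous_on_scaleR smooth_continuous_on s smooth_deriv G uc)
qed

text \<open>The primitive \<open>U\<close> of \<open>G\<close> satisfies the same weak identity as
  \<open>u\<close>, since \<open>u'\<close> and \<open>G\<close> differ on a null set only;
  \<open>u - U\<close> is therefore constant.\<close>

lemma continuous_weak_derivative_imp_C1:
  assumes T: "0 < T" and u: "continuous_on {0..T} u"
    and u': "L2_Bochner T u'" and weak: "weak_derivative T u u'"
    and AE: "AE t in lebesgue_on {0..T}. u' t = G t" and G: "continuous_on {0..T} G"
    and t: "t \<in> {0..T}"
  shows "(u has_vector_derivative G t) (at t within {0..T})"
proof -
  define U where "U t = integral {0..t} G" for t
  have U: "(U has_vector_derivative G t) (at t within {0..T})" if "t \<in> {0..T}" for t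
    unfolding U_def by (rule integral_has_vector_derivative[OF G that])
  have Uc: "continuous_on {0..T} U" by (rule continuous_on_vector_derivative[OF U])
  have const: "u t - U t = u 0 - U 0" if "t \<in> {0..T}" for t
  proof (rule zero_weak_derivative_imp_constant[OF _ _ T that])
    show "continuous_on {0..T} (\<lambda>t. u t - U t)" by (intro continuous_on_diff u Uc)
    fix \<phi> assume \<phi>: "test_function T \<phi>"
    note s = test_function_smooth[OF \<phi>]
    have "integral {0..T} (\<lambda>t. deriv \<phi> t *\<^sub>R u t) = (LINT t|lebesgue_on {0..T}. deriv \<phi> t *\<^sub>R u t)"
      by (intro lebesgue_integral_continuous_L2[symmetric] continuous_on_scaleR smooth_continuous_on s smooth_deriv u)
    also have "\<dots> = - (LINT t|lebesgue_on {0..T}. \<phi> t *\<^sub>R u' t)"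
      using weak \<phi> by (simp add: weak_derivative_def)
    also have "(LINT t|lebesgue_on {0..T}. \<phi> t *\<^sub>R u' t) = (LINT t|lebesgue_on {0..T}. \<phi> t *\<^sub>R G t)"
    proof (rule integral_cong_AE)
      have "\<phi> \<in> borel_measurable (lebesgue_on {0..T})"
        by (rule continuous_imp_measurable_on_sets_lebesgue[OF smooth_continuous_on[OF s]]) auto
      then show "(\<lambda>t. \<phi> t *\<^sub>R u' t) \<in> borel_measurable (lebesgue_on {0..T})"
        "(\<lambda>t. \<phi> t *\<^sub>R G t) \<in> borel_measurable (lebesgue_on {0..T})"
        using u' continuous_L2_measurable[OF G]
        by (auto intro!: borel_measurable_scaleR simp: L2_Bochner_def)
    qed (use AE in eventually_elim, auto)
    also have "\<dots> = integral {0..T} (\<lambda>t. \<phi> t *\<^sub>R G t)"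
      by (intro lebesgue_integral_continuous_L2 continuous_on_scaleR smooth_continuous_on s G)
    finally have 1: "integral {0..T} (\<lambda>t. deriv \<phi> t *\<^sub>R u t) = integral {0..T} (\<lambda>t. deriv \<phi> t *\<^sub>R U t)"
      using integral_by_parts_test_function[OF \<phi> T U G] by simp
    have "integral {0..T} (\<lambda>t. deriv \<phi> t *\<^sub>R u t - deriv \<phi> t *\<^sub>R U t)
        = integral {0..T} (\<lambda>t. deriv \<phi> t *\<^sub>R u t) - integral {0..T} (\<lambda>t. deriv \<phi> t *\<^sub>R U t)"
      by (intro Henstock_Kurzweil_Integration.integral_diff integrable_continuous_real
          continuous_on_scaleR smooth_continuous_on smooth_deriv s u Uc)
    then show "integral {0..T} (\<lambda>t. deriv \<phi> t *\<^sub>R (u t - U t)) = 0"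
      using 1 by (simp add: scaleR_diff_right)
  qed
  have "((\<lambda>s. (u 0 - U 0) + U s) has_vector_derivative 0 + G t) (at t within {0..T})"
    by (intro has_vector_derivative_add has_vector_derivative_const U t)
  then have d: "((\<lambda>s. (u 0 - U 0) + U s) has_vector_derivative G t) (at t within {0..T})" by simp
  show ?thesis
  proof (rule has_vector_derivative_transform[OF t _ d])
    fix s assume "s \<in> {0..T}"
    then show "u s = (u 0 - U 0) + U s" using const[of s] by (simp add: algebra_simps)
  qed
qed

text \<open>Turns questions about weak solutions into questions about curves differentiable at each
  time. Of the operators, only continuity along continuous curves enters, which is the assumption
  \<open>F\<close>.\<close>

lemma weak_solution_iff_classical:
  assumes T: "0 < T"
    and F: "\<And>u. continuous_on {0..T} u \<Longrightarrow> continuous_on {0..T} (\<lambda>t. coupling W D (u t) + reaction f t (u t))"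
  shows "weak_solution W D f g T u \<longleftrightarrow> u 0 = abs_L2 g \<and>
    (\<forall>t\<in>{0..T}. (u has_vector_derivative coupling W D (u t) + reaction f t (u t)) (at t within {0..T}))"
    (is "?L \<longleftrightarrow> ?R")
proof
  assume ?L
  then obtain u' where u: "continuous_on {0..T} u" "u 0 = abs_L2 g" and u': "L2_Bochner T u'" "weak_derivative T u u'"
    "AE t in lebesgue_on {0..T}. \<forall>v. inner (u' t - coupling W D (u t) - reaction f t (u t)) v = 0"
    by (auto simp: weak_solution_def)
  have "AE t in lebesgue_on {0..T}. u' t = coupling W D (u t) + reaction f t (u t)"
    using u'(3)
  proof eventually_elim
    case (elim t)
    \<comment> \<open>The residual itself is an admissible \<open>v\<close>.\<close>
    then have "u' t - coupling W D (u t) - reaction f t (u t) = 0" using inner_eq_zero_iff by blast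
    then show ?case by (simp add: algebra_simps)
  qed
  then show ?R
    using continuous_weak_derivative_imp_C1[OF T u(1) u'(1,2) _ F[OF u(1)]] u(2) by blast
next
  assume R: ?R
  then have uc: "continuous_on {0..T} u" by (intro continuous_on_vector_derivative) auto
  have w: "weak_derivative T u (\<lambda>t. coupling W D (u t) + reaction f t (u t))"
    by (rule weak_derivative_of_C1[OF T _ F[OF uc]]) (use R in auto)
  show ?L
    unfolding weak_solution_def
    using uc L2_Bochner_continuous[OF uc] L2_Bochner_continuous[OF F[OF uc]] w R
    by (intro conjI exI[of _ "\<lambda>t. coupling W D (u t) + reaction f t (u t)"]) auto
qed

section \<open>The coupling operator of an \<open>L\<^sup>2\<close> kernel\<close>


text \<open>Row-wise arguments need a product measure. Its sigma-algebra is not the Lebesgue one of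
  the square, to which the assumptions on \<open>W\<close> refer; integrals are transferred between
  the two for Borel functions.\<close>

abbreviation leb01_sq :: "(real \<times> real) measure" where
  "leb01_sq \<equiv> leb01 \<Otimes>\<^sub>M leb01"

interpretation leb01: finite_measure leb01
  by (rule finite_measure_lebesgue_on) simp

interpretation leb01_sq: pair_sigma_finite leb01 leb01 ..

interpretation leb01_sq: finite_measure leb01_sq
  by (rule finite_measure_pair_measure) (rule leb01.finite_measure_axioms)+

lemma emeasure_leb01 [simp]: "emeasure leb01 {0..1} = 1"
  by (simp add: emeasure_restrict_space)

section \<open>Passing between the product measure and Lebesgue measure on the square\<close>

lemma borel_measurable_leb01_sq:
  assumes "F \<in> borel_measurable (borel :: (real \<times> real) measure)"
  shows "F \<in> borel_measurable leb01_sq"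
proof -
  have "(\<lambda>x. x) \<in> measurable leb01 borel"
    by (rule measurable_restrict_space1, rule measurable_completion) simp
  then have "(\<lambda>p. (fst p, snd p)) \<in> measurable leb01_sq (borel \<Otimes>\<^sub>M borel)"
    by (intro measurable_Pair measurable_compose[OF measurable_fst] measurable_compose[OF measurable_snd])
  then have "(\<lambda>p. p) \<in> measurable leb01_sq borel" by (simp add: borel_prod)
  from measurable_compose[OF this assms] show ?thesis .
qed

text \<open>Both sides equal the iterated integral with respect to \<open>lborel\<close>, because
  completing a measure does not change integrals of Borel functions.\<close>

lemma nn_integral_leb01_sq:
  assumes F [measurable]: "F \<in> borel_measurable (borel :: (real \<times> real) measure)"
  shows "integral\<^sup>N leb01_sq F = integral\<^sup>N (lebesgue_on ({0..1} \<times> {0..1})) F"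
proof -
  have [measurable]: "{0..1} \<times> {0..1::real} \<in> sets (borel :: (real \<times> real) measure)"
    by (intro borel_closed closed_Times closed_atLeastAtMost)
  have "integral\<^sup>N leb01_sq F = (\<integral>\<^sup>+x. \<integral>\<^sup>+y. F (x, y) \<partial>leb01 \<partial>leb01)"
    by (rule leb01.nn_integral_fst[symmetric]) (rule borel_measurable_leb01_sq[OF F])
  also have "\<dots> = (\<integral>\<^sup>+x. (\<integral>\<^sup>+y. F (x, y) * indicator {0..1} y \<partial>lborel) * indicator {0..1} x \<partial>lborel)"
    by (simp add: nn_integral_restrict_space nn_integral_completion)
  also have "\<dots> = (\<integral>\<^sup>+x. \<integral>\<^sup>+y. F (x, y) * indicator ({0..1} \<times> {0..1}) (x, y) \<partial>lborel \<partial>lborel)"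
  proof (intro nn_integral_cong)
    fix x :: real
    have "(\<integral>\<^sup>+y. F (x, y) * indicator {0..1} y \<partial>lborel) * indicator {0..1} x
        = (\<integral>\<^sup>+y. F (x, y) * indicator {0..1} y * indicator {0..1} x \<partial>lborel)"
      by (rule nn_integral_multc[symmetric]) measurable
    then show "(\<integral>\<^sup>+y. F (x, y) * indicator {0..1} y \<partial>lborel) * indicator {0..1} x
        = (\<integral>\<^sup>+y. F (x, y) * indicator ({0..1} \<times> {0..1}) (x, y) \<partial>lborel)"
      by (simp add: indicator_times mult.assoc mult.commute[of "indicator {0..1} x"])
  qed
  also have "\<dots> = (\<integral>\<^sup>+p. F p * indicator ({0..1} \<times> {0..1}) p \<partial>(lborel \<Otimes>\<^sub>M lborel))"
    by (rule lborel.nn_integral_fst) (unfold lborel_prod, measurable)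
  also have "\<dots> = integral\<^sup>N (lebesgue_on ({0..1} \<times> {0..1})) F"
    unfolding lborel_prod by (simp add: nn_integral_restrict_space nn_integral_completion)
  finally show ?thesis .
qed

text \<open>Completeness of Lebesgue measure; it makes the given kernel measurable on rows where it
  agrees almost everywhere with its Borel version.\<close>

lemma borel_measurable_lebesgue_on_cong_AE:
  fixes f g :: "'a::euclidean_space \<Rightarrow> real"
  assumes S: "S \<in> sets lebesgue" and f: "f \<in> borel_measurable (lebesgue_on S)"
    and AE: "AE x in lebesgue_on S. f x = g x"
  shows "g \<in> borel_measurable (lebesgue_on S)"
proof -
  have "AE x in lebesgue. x \<in> S \<longrightarrow> f x = g x"
    using AE S by (subst (asm) AE_restrict_space_iff) auto
  then have "{x. \<not> (x \<in> S \<longrightarrow> f x = g x)} \<in> null_sets lebesgue"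
    by (simp add: completion.AE_iff_null_sets)
  then have "negligible {x. \<not> (x \<in> S \<longrightarrow> f x = g x)}" by (simp add: negligible_iff_null_sets)
  moreover have "f measurable_on S" using f S by (simp add: measurable_on_iff_borel_measurable)
  ultimately have "g measurable_on S" by (intro measurable_on_spike[of f S _ g]) auto
  then show ?thesis using S by (simp add: measurable_on_iff_borel_measurable)
qed

text \<open>The estimates are carried out with nonnegative integrals, for which integrability need
  not be known in advance; this converts the outcome into membership in \<open>L2\<close> and a norm
  bound.\<close>

lemma square_integrable_nn_bound:
  assumes h: "h \<in> borel_measurable leb01" and le: "(\<integral>\<^sup>+x. ennreal ((h x)\<^sup>2) \<partial>leb01) \<le> ennreal c" and c: "0 \<le> c"
  shows "square_integrable {0..1} h" "(norm (abs_L2 h))\<^sup>2 \<le> c"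
proof -
  have "integrable leb01 (\<lambda>x. (h x)\<^sup>2)"
    by (rule integrableI_nonneg) (use h le in \<open>auto intro: le_less_trans\<close>)
  then show "square_integrable {0..1} h" using h by (simp add: square_integrable_def)
  from nn_norm_abs_L2[OF this] show "(norm (abs_L2 h))\<^sup>2 \<le> c" using le c by (simp add: ennreal_le_iff)
qed

text \<open>A non-integrable function has Bochner integral 0 by convention, so the bound survives on
  rows where the kernel is not integrable.\<close>

lemma abs_lebesgue_integral_le_nn_integral:
  fixes h :: "'a \<Rightarrow> real"
  shows "ennreal \<bar>LINT x|M. h x\<bar> \<le> (\<integral>\<^sup>+x. ennreal \<bar>h x\<bar> \<partial>M)"
  using integral_norm_bound_ennreal[of M h]
  by (cases "integrable M h") (auto simp: not_integrable_integral_eq)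

text \<open>The Hilbert-Schmidt estimate: Cauchy-Schwarz on each row, then Tonelli.\<close>

lemma nn_integral_row_Cauchy_Schwarz:
  assumes V [measurable]: "V \<in> borel_measurable leb01_sq" and d [measurable]: "d \<in> borel_measurable leb01"
  shows "(\<integral>\<^sup>+x. (\<integral>\<^sup>+y. ennreal \<bar>V (x, y) * d y\<bar> \<partial>leb01)\<^sup>2 \<partial>leb01)
    \<le> (\<integral>\<^sup>+p. ennreal ((V p)\<^sup>2) \<partial>leb01_sq) * (\<integral>\<^sup>+y. ennreal ((d y)\<^sup>2) \<partial>leb01)"
proof -
  have "(\<integral>\<^sup>+x. (\<integral>\<^sup>+y. ennreal \<bar>V (x, y) * d y\<bar> \<partial>leb01)\<^sup>2 \<partial>leb01)
      \<le> (\<integral>\<^sup>+x. (\<integral>\<^sup>+y. ennreal ((V (x, y))\<^sup>2) \<partial>leb01) * (\<integral>\<^sup>+y. ennreal ((d y)\<^sup>2) \<partial>leb01) \<partial>leb01)"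
  proof (rule nn_integral_mono)
    fix x assume [measurable]: "x \<in> space leb01"
    show "(\<integral>\<^sup>+y. ennreal \<bar>V (x, y) * d y\<bar> \<partial>leb01)\<^sup>2
        \<le> (\<integral>\<^sup>+y. ennreal ((V (x, y))\<^sup>2) \<partial>leb01) * (\<integral>\<^sup>+y. ennreal ((d y)\<^sup>2) \<partial>leb01)"
      using Cauchy_Schwarz_nn_integral[of "\<lambda>y. ennreal \<bar>V (x, y)\<bar>" leb01 "\<lambda>y. ennreal \<bar>d y\<bar>"]
      by (simp add: ennreal_power abs_mult ennreal_mult)
  qed
  also have "\<dots> = (\<integral>\<^sup>+x. (\<integral>\<^sup>+y. ennreal ((V (x, y))\<^sup>2) \<partial>leb01) \<partial>leb01) * (\<integral>\<^sup>+y. ennreal ((d y)\<^sup>2) \<partial>leb01)"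
    by (rule nn_integral_multc) measurable
  also have "(\<integral>\<^sup>+x. (\<integral>\<^sup>+y. ennreal ((V (x, y))\<^sup>2) \<partial>leb01) \<partial>leb01) = (\<integral>\<^sup>+p. ennreal ((V p)\<^sup>2) \<partial>leb01_sq)"
    by (rule leb01.nn_integral_fst) measurable
  finally show ?thesis .
qed

lemma nn_integral_row_square:
  assumes "V \<in> borel_measurable leb01_sq"
  shows "(\<integral>\<^sup>+x. (\<integral>\<^sup>+y. ennreal \<bar>V (x, y)\<bar> \<partial>leb01)\<^sup>2 \<partial>leb01) \<le> (\<integral>\<^sup>+p. ennreal ((V p)\<^sup>2) \<partial>leb01_sq)"
  using nn_integral_row_Cauchy_Schwarz[OF assms, of "\<lambda>_. 1"] by simp

text \<open>Acts on functions, not on classes: the estimates are pointwise in \<open>x\<close> and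
  need a fixed representative. Independence of the representative comes out afterwards, in
  \<open>coupling_abs_L2\<close>.\<close>

definition coupling_fun :: "(real \<times> real \<Rightarrow> real) \<Rightarrow> (real \<Rightarrow> real) \<Rightarrow> (real \<Rightarrow> real) \<Rightarrow> real \<Rightarrow> real" where
  "coupling_fun V D h x = (LINT y|leb01. V (x, y) * D (h y - h x))"

definition L2_kernel :: "(real \<times> real \<Rightarrow> real) \<Rightarrow> bool" where
  "L2_kernel V \<longleftrightarrow> V \<in> borel_measurable leb01_sq \<and> integrable leb01_sq (\<lambda>p. (V p)\<^sup>2)"

lemma L2_kernel_measurable: "L2_kernel V \<Longrightarrow> V \<in> borel_measurable leb01_sq"
  by (simp add: L2_kernel_def)

lemma L2_kernel_nn_integral:
  assumes "L2_kernel V"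
  shows "(\<integral>\<^sup>+p. ennreal ((V p)\<^sup>2) \<partial>leb01_sq) = ennreal (LINT p|leb01_sq. (V p)\<^sup>2)"
  using assms by (intro nn_integral_eq_integral) (auto simp: L2_kernel_def)

lemma L2_kernel_AE_row_integrable:
  assumes "L2_kernel V" shows "AE x in leb01. integrable leb01 (\<lambda>y. V (x, y))"
  by (rule leb01_sq.AE_integrable_fst', rule leb01_sq.square_integrable_imp_integrable)
    (use assms in \<open>auto simp: L2_kernel_def\<close>)

lemma L2_kernel_diff:
  assumes "L2_kernel V" "L2_kernel V'" shows "L2_kernel (\<lambda>p. V p - V' p)"
proof -
  have m [measurable]: "V \<in> borel_measurable leb01_sq" "V' \<in> borel_measurable leb01_sq"
    using assms by (auto simp: L2_kernel_def)
  have "integrable leb01_sq (\<lambda>p. (V p - V' p)\<^sup>2)"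
  proof (rule Bochner_Integration.integrable_bound)
    show "integrable leb01_sq (\<lambda>p. 2 * (V p)\<^sup>2 + 2 * (V' p)\<^sup>2)"
      using assms by (auto simp: L2_kernel_def)
    show "AE p in leb01_sq. norm ((V p - V' p)\<^sup>2) \<le> norm (2 * (V p)\<^sup>2 + 2 * (V' p)\<^sup>2)"
      using square_diff_le[of "V _" "V' _" 0] by auto
  qed measurable
  then show ?thesis by (simp add: L2_kernel_def)
qed

section \<open>Bounds for the coupling operator\<close>

context
  fixes D :: "real \<Rightarrow> real" and L :: real
  assumes D_lip: "L-lipschitz_on UNIV D" and D_le: "\<And>x. \<bar>D x\<bar> \<le> 1"
begin

lemma D_measurable: "D \<in> borel_measurable borel"
  by (rule borel_measurable_continuous_onI[OF lipschitz_on_continuous_on[OF D_lip]])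

lemma coupling_fun_measurable:
  assumes [measurable]: "V \<in> borel_measurable leb01_sq" "h \<in> borel_measurable leb01"
  shows "coupling_fun V D h \<in> borel_measurable leb01"
proof -
  note [measurable] = D_measurable
  show ?thesis unfolding coupling_fun_def[abs_def] by measurable
qed

lemma coupling_fun_row_integrable:
  assumes V: "V \<in> borel_measurable leb01_sq" and h [measurable]: "h \<in> borel_measurable leb01"
    and i: "integrable leb01 (\<lambda>y. V (x, y))"
  shows "integrable leb01 (\<lambda>y. V (x, y) * D (h y - c))"
proof (rule Bochner_Integration.integrable_bound[OF i])
  note [measurable] = D_measurable
  have [measurable]: "(\<lambda>y. V (x, y)) \<in> borel_measurable leb01" using i by auto
  show "(\<lambda>y. V (x, y) * D (h y - c)) \<in> borel_measurable leb01" by measurable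
  show "AE y in leb01. norm (V (x, y) * D (h y - c)) \<le> norm (V (x, y))"
    using D_le by (auto simp: abs_mult intro!: AE_I2 mult_left_le)
qed

text \<open>\<open>|D| \<le> 1\<close> bounds the value at \<open>x\<close> by the row integral of
  \<open>|V|\<close>, whatever \<open>h\<close> is, and row integrals are square integrable by
  \<open>nn_integral_row_square\<close>.\<close>

lemma coupling_fun_square_integrable:
  assumes V: "L2_kernel V" and h: "h \<in> borel_measurable leb01"
  shows "square_integrable {0..1} (coupling_fun V D h)"
    and "(norm (abs_L2 (coupling_fun V D h)))\<^sup>2 \<le> (LINT p|leb01_sq. (V p)\<^sup>2)"
proof -
  note m [measurable] = L2_kernel_measurable[OF V] h
  have "ennreal \<bar>coupling_fun V D h x\<bar> \<le> (\<integral>\<^sup>+y. ennreal \<bar>V (x, y)\<bar> \<partial>leb01)" for x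
  proof -
    have "ennreal \<bar>coupling_fun V D h x\<bar> \<le> (\<integral>\<^sup>+y. ennreal \<bar>V (x, y) * D (h y - h x)\<bar> \<partial>leb01)"
      unfolding coupling_fun_def by (rule abs_lebesgue_integral_le_nn_integral)
    also have "\<dots> \<le> (\<integral>\<^sup>+y. ennreal \<bar>V (x, y)\<bar> \<partial>leb01)"
      using D_le by (intro nn_integral_mono ennreal_leI) (auto simp: abs_mult intro!: mult_left_le)
    finally show ?thesis .
  qed
  then have "(ennreal \<bar>coupling_fun V D h x\<bar>)\<^sup>2 \<le> (\<integral>\<^sup>+y. ennreal \<bar>V (x, y)\<bar> \<partial>leb01)\<^sup>2" for x
    by (rule power_mono) simp
  then have "(\<integral>\<^sup>+x. ennreal ((coupling_fun V D h x)\<^sup>2) \<partial>leb01) \<le> (\<integral>\<^sup>+x. (\<integral>\<^sup>+y. ennreal \<bar>V (x, y)\<bar> \<partial>leb01)\<^sup>2 \<partial>leb01)"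
    by (intro nn_integral_mono) (simp add: ennreal_power)
  also have "\<dots> \<le> ennreal (LINT p|leb01_sq. (V p)\<^sup>2)"
    using nn_integral_row_square[OF m(1)] by (simp add: L2_kernel_nn_integral[OF V])
  finally have "(\<integral>\<^sup>+x. ennreal ((coupling_fun V D h x)\<^sup>2) \<partial>leb01) \<le> ennreal (LINT p|leb01_sq. (V p)\<^sup>2)" .
  from square_integrable_nn_bound[OF coupling_fun_measurable[OF m] this]
  show "square_integrable {0..1} (coupling_fun V D h)"
    "(norm (abs_L2 (coupling_fun V D h)))\<^sup>2 \<le> (LINT p|leb01_sq. (V p)\<^sup>2)" by auto
qed

text \<open>The operator is linear in the kernel, so the difference is the coupling for
  \<open>V - V'\<close>. The integral is split on rows where both kernels are integrable, hence for
  almost every \<open>x\<close> only.\<close>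

lemma coupling_fun_kernel_diff:
  assumes V: "L2_kernel V" "L2_kernel V'" and h: "h \<in> borel_measurable leb01"
  shows "(norm (abs_L2 (coupling_fun V D h) - abs_L2 (coupling_fun V' D h)))\<^sup>2 \<le> (LINT p|leb01_sq. (V p - V' p)\<^sup>2)"
proof -
  note s = coupling_fun_square_integrable(1)[OF V(1) h] coupling_fun_square_integrable(1)[OF V(2) h]
  have "AE x in leb01. coupling_fun V D h x - coupling_fun V' D h x = coupling_fun (\<lambda>p. V p - V' p) D h x"
    using L2_kernel_AE_row_integrable[OF V(1)] L2_kernel_AE_row_integrable[OF V(2)]
  proof eventually_elim
    case (elim x)
    note i = coupling_fun_row_integrable[OF L2_kernel_measurable[OF V(1)] h elim(1), of "h x"]
      coupling_fun_row_integrable[OF L2_kernel_measurable[OF V(2)] h elim(2), of "h x"]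
    show ?case
      unfolding coupling_fun_def Bochner_Integration.integral_diff[OF i, symmetric]
      by (simp add: left_diff_distrib)
  qed
  then have "abs_L2 (\<lambda>x. coupling_fun V D h x - coupling_fun V' D h x) = abs_L2 (coupling_fun (\<lambda>p. V p - V' p) D h)"
    using abs_L2_eq_iff[OF square_integrable_diff[OF s] coupling_fun_square_integrable(1)[OF L2_kernel_diff[OF V] h]]
    by simp
  then show ?thesis
    using coupling_fun_square_integrable(2)[OF L2_kernel_diff[OF V] h] by (simp add: abs_L2_diff[OF s])
qed

text \<open>The part of the integrand with \<open>d y\<close> falls under the Hilbert-Schmidt
  estimate, while \<open>d x\<close> comes out of the integral and leaves a row integral, bounded by
  \<open>M\<close>. The factor \<open>2\<close> is that of
  \<open>(a + b)^2 \<le> 2 a^2 + 2 b^2\<close>.\<close>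

lemma coupling_fun_lipschitz:
  assumes V: "L2_kernel V" and h: "square_integrable {0..1} h" and k: "square_integrable {0..1} k"
    and M: "AE x in leb01. (\<integral>\<^sup>+y. ennreal \<bar>V (x, y)\<bar> \<partial>leb01) \<le> ennreal M" "0 \<le> M"
  shows "norm (abs_L2 (coupling_fun V D h) - abs_L2 (coupling_fun V D k))
    \<le> sqrt (2 * L\<^sup>2 * ((LINT p|leb01_sq. (V p)\<^sup>2) + M\<^sup>2)) * norm (abs_L2 h - abs_L2 k)"
proof -
  have [measurable]: "h \<in> borel_measurable leb01" "k \<in> borel_measurable leb01"
    using h k by (auto simp: square_integrable_def)
  note Vm [measurable] = L2_kernel_measurable[OF V]
  have L0: "0 \<le> L" using lipschitz_on_nonneg[OF D_lip] .
  define N where "N = (LINT p|leb01_sq. (V p)\<^sup>2)"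
  have N0: "0 \<le> N" by (simp add: N_def)
  define d where "d x = h x - k x" for x
  have dsq: "square_integrable {0..1} d" unfolding d_def[abs_def] by (rule square_integrable_diff[OF h k])
  then have [measurable]: "d \<in> borel_measurable leb01" by (simp add: square_integrable_def)
  define I where "I x = (\<integral>\<^sup>+y. ennreal \<bar>V (x, y) * d y\<bar> \<partial>leb01)" for x
  have [measurable]: "I \<in> borel_measurable leb01" unfolding I_def[abs_def] by measurable
  let ?c = "\<lambda>x. coupling_fun V D h x - coupling_fun V D k x"
  note s = coupling_fun_square_integrable(1)[OF V, of h] coupling_fun_square_integrable(1)[OF V, of k]
  have "AE x in leb01. ennreal ((?c x)\<^sup>2) \<le> ennreal (2 * L\<^sup>2) * ((I x)\<^sup>2 + ennreal (M\<^sup>2 * (d x)\<^sup>2))"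
    using L2_kernel_AE_row_integrable[OF V] M(1) AE_space
  proof eventually_elim
    case (elim x)
    have [measurable]: "(\<lambda>y. V (x, y)) \<in> borel_measurable leb01" using elim(1) by auto
    note i = coupling_fun_row_integrable[OF Vm _ elim(1), of h "h x"]
      coupling_fun_row_integrable[OF Vm _ elim(1), of k "k x"]
    have "?c x = (LINT y|leb01. V (x, y) * (D (h y - h x) - D (k y - k x)))"
      unfolding coupling_fun_def using i by (simp add: right_diff_distrib)
    then have "ennreal \<bar>?c x\<bar> \<le> (\<integral>\<^sup>+y. ennreal \<bar>V (x, y) * (D (h y - h x) - D (k y - k x))\<bar> \<partial>leb01)"
      using abs_lebesgue_integral_le_nn_integral[of leb01 "\<lambda>y. V (x, y) * (D (h y - h x) - D (k y - k x))"]
      by simp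
    also have "\<dots> \<le> (\<integral>\<^sup>+y. ennreal L * (ennreal \<bar>V (x, y) * d y\<bar> + ennreal \<bar>V (x, y)\<bar> * ennreal \<bar>d x\<bar>) \<partial>leb01)"
    proof (rule nn_integral_mono)
      fix y
      have "\<bar>D (h y - h x) - D (k y - k x)\<bar> \<le> L * \<bar>(h y - h x) - (k y - k x)\<bar>"
        using lipschitz_onD[OF D_lip, of "h y - h x" "k y - k x"] by (simp add: dist_real_def)
      also have "\<dots> \<le> L * (\<bar>d y\<bar> + \<bar>d x\<bar>)"
        using L0 by (intro mult_left_mono) (auto simp: d_def)
      finally have "\<bar>V (x, y) * (D (h y - h x) - D (k y - k x))\<bar> \<le> \<bar>V (x, y)\<bar> * (L * (\<bar>d y\<bar> + \<bar>d x\<bar>))"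
        unfolding abs_mult by (rule mult_left_mono) simp
      also have "\<dots> = L * (\<bar>V (x, y) * d y\<bar> + \<bar>V (x, y)\<bar> * \<bar>d x\<bar>)"
        by (simp add: abs_mult algebra_simps)
      finally show "ennreal \<bar>V (x, y) * (D (h y - h x) - D (k y - k x))\<bar>
          \<le> ennreal L * (ennreal \<bar>V (x, y) * d y\<bar> + ennreal \<bar>V (x, y)\<bar> * ennreal \<bar>d x\<bar>)"
        using L0 by (simp add: ennreal_mult[symmetric] ennreal_plus[symmetric] ennreal_leI del: ennreal_plus)
    qed
    also have "\<dots> = ennreal L * (I x + (\<integral>\<^sup>+y. ennreal \<bar>V (x, y)\<bar> \<partial>leb01) * ennreal \<bar>d x\<bar>)"
      by (simp add: nn_integral_cmult nn_integral_add nn_integral_multc I_def)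
    also have "\<dots> \<le> ennreal L * (I x + ennreal M * ennreal \<bar>d x\<bar>)"
      by (intro mult_left_mono add_left_mono mult_right_mono elim) auto
    finally have le: "ennreal \<bar>?c x\<bar> \<le> ennreal L * (I x + ennreal (M * \<bar>d x\<bar>))"
      using M(2) by (simp add: ennreal_mult)
    show ?case
    \<comment> \<open>\<open>I x\<close> may be infinite: then the claim is trivial unless
      \<open>L = 0\<close>, and in that case the left-hand side vanishes.\<close>
    proof (cases "I x")
      case top
      show ?thesis
      proof (cases "L = 0")
        case True
        then show ?thesis using le by simp
      next
        case False
        then show ?thesis using L0 by (simp add: top ennreal_mult_top)
      qed
    next
      case (real r)
      then have "\<bar>?c x\<bar> \<le> L * (r + M * \<bar>d x\<bar>)"
        using le L0 M(2) by (simp add: ennreal_mult[symmetric] ennreal_plus[symmetric] ennreal_le_iff del: ennreal_plus)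
      then have "\<bar>?c x\<bar>\<^sup>2 \<le> (L * (r + M * \<bar>d x\<bar>))\<^sup>2" by (rule power_mono) simp
      also have "\<dots> = L\<^sup>2 * (r + M * \<bar>d x\<bar>)\<^sup>2" by (simp add: power_mult_distrib)
      also have "\<dots> \<le> L\<^sup>2 * (2 * r\<^sup>2 + 2 * (M * \<bar>d x\<bar>)\<^sup>2)"
        using square_diff_le[of r "- (M * \<bar>d x\<bar>)" 0] by (intro mult_left_mono) auto
      finally have "(?c x)\<^sup>2 \<le> 2 * L\<^sup>2 * (r\<^sup>2 + M\<^sup>2 * (d x)\<^sup>2)"
        by (simp add: power_mult_distrib algebra_simps)
      then show ?thesis
        using real by (simp add: ennreal_mult[symmetric] ennreal_plus[symmetric] ennreal_power ennreal_leI del: ennreal_plus)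
    qed
  qed
  then have "(\<integral>\<^sup>+x. ennreal ((?c x)\<^sup>2) \<partial>leb01)
      \<le> (\<integral>\<^sup>+x. ennreal (2 * L\<^sup>2) * ((I x)\<^sup>2 + ennreal (M\<^sup>2 * (d x)\<^sup>2)) \<partial>leb01)"
    by (rule nn_integral_mono_AE)
  also have "\<dots> = ennreal (2 * L\<^sup>2) * ((\<integral>\<^sup>+x. (I x)\<^sup>2 \<partial>leb01) + ennreal (M\<^sup>2) * (\<integral>\<^sup>+x. ennreal ((d x)\<^sup>2) \<partial>leb01))"
    by (simp add: nn_integral_cmult nn_integral_add ennreal_mult)
  also have "\<dots> \<le> ennreal (2 * L\<^sup>2) * (ennreal N * (\<integral>\<^sup>+x. ennreal ((d x)\<^sup>2) \<partial>leb01) + ennreal (M\<^sup>2) * (\<integral>\<^sup>+x. ennreal ((d x)\<^sup>2) \<partial>leb01))"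
    unfolding I_def N_def L2_kernel_nn_integral[OF V, symmetric]
    by (intro mult_left_mono add_right_mono nn_integral_row_Cauchy_Schwarz) auto
  also have "\<dots> = ennreal (2 * L\<^sup>2 * (N + M\<^sup>2) * (norm (abs_L2 d))\<^sup>2)"
    unfolding nn_norm_abs_L2[OF dsq] using N0
    by (simp add: ennreal_mult[symmetric] ennreal_plus[symmetric] algebra_simps del: ennreal_plus)
  finally have "(norm (abs_L2 ?c))\<^sup>2 \<le> 2 * L\<^sup>2 * (N + M\<^sup>2) * (norm (abs_L2 d))\<^sup>2"
    using N0 by (intro square_integrable_nn_bound) (auto intro!: borel_measurable_diff coupling_fun_measurable)
  also have "\<dots> = (sqrt (2 * L\<^sup>2 * (N + M\<^sup>2)) * norm (abs_L2 d))\<^sup>2"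
    using N0 by (simp add: power_mult_distrib)
  finally have "norm (abs_L2 ?c) \<le> sqrt (2 * L\<^sup>2 * (N + M\<^sup>2)) * norm (abs_L2 d)"
    by (rule power2_le_imp_le) (use N0 in simp)
  then show ?thesis
    using s by (simp add: abs_L2_diff N_def d_def[abs_def] abs_L2_diff[OF h k])
qed

lemma coupling_eq: "coupling V D u = abs_L2 (coupling_fun V D (rep_L2 u))"
  by (simp add: coupling_def coupling_fun_def[abs_def])

lemma coupling_lipschitz:
  assumes V: "L2_kernel V"
    and M: "AE x in leb01. (\<integral>\<^sup>+y. ennreal \<bar>V (x, y)\<bar> \<partial>leb01) \<le> ennreal M" "0 \<le> M"
  shows "norm (coupling V D u - coupling V D w)
    \<le> sqrt (2 * L\<^sup>2 * ((LINT p|leb01_sq. (V p)\<^sup>2) + M\<^sup>2)) * norm (u - w)"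
  using coupling_fun_lipschitz[OF V square_integrable_rep square_integrable_rep M, of u w]
  unfolding abs_rep_L2 coupling_eq .

text \<open>\<open>rep_L2 (abs_L2 h)\<close> and \<open>h\<close> lie in the same class, so the
  Lipschitz estimate between them has right-hand side 0.\<close>

lemma coupling_abs_L2:
  assumes V: "L2_kernel V" and h: "square_integrable {0..1} h"
    and M: "AE x in leb01. (\<integral>\<^sup>+y. ennreal \<bar>V (x, y)\<bar> \<partial>leb01) \<le> ennreal M" "0 \<le> M"
  shows "coupling V D (abs_L2 h) = abs_L2 (coupling_fun V D h)"
proof -
  have "norm (abs_L2 (coupling_fun V D (rep_L2 (abs_L2 h))) - abs_L2 (coupling_fun V D h)) \<le> 0"
    using coupling_fun_lipschitz[OF V square_integrable_rep h M, of "abs_L2 h"]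
    unfolding abs_rep_L2 diff_self norm_zero mult_zero_right .
  then show ?thesis unfolding coupling_eq by simp
qed

lemma coupling_kernel_diff:
  assumes V: "L2_kernel V" "L2_kernel V'"
  shows "norm (coupling V D u - coupling V' D u) \<le> sqrt (LINT p|leb01_sq. (V p - V' p)\<^sup>2)"
proof -
  have "rep_L2 u \<in> borel_measurable leb01"
    using square_integrable_rep[of u] by (simp add: square_integrable_def)
  from coupling_fun_kernel_diff[OF V this] show ?thesis
    unfolding coupling_eq by (rule real_le_rsqrt)
qed

end

section \<open>Step kernels and step data\<close>


lemma cell_borel [measurable]: "cell n i \<in> sets borel"
  by (simp add: cell_def)

lemma cell_lebesgue: "cell n i \<in> sets lebesgue"
  by (simp add: cell_def)

lemma cell_subset:
  assumes "i \<in> {1..n}" shows "cell n i \<subseteq> {0<..1}"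
proof -
  have "0 \<le> (real i - 1) / real n" "real i / real n \<le> 1"
    using assms by (auto simp: divide_le_eq_1)
  then show ?thesis by (auto simp: cell_def)
qed

lemma measure_cell: "1 \<le> n \<Longrightarrow> measure lborel (cell n i) = 1 / real n"
  by (simp add: cell_def diff_divide_distrib divide_right_mono)

lemma cell_disjoint:
  assumes "x \<in> cell n i" "x \<in> cell n j" shows "i = j"
proof (cases "n = 0")
  case False
  then have "real i - 1 < real n * x" "real n * x \<le> real i" "real j - 1 < real n * x" "real n * x \<le> real j"
    using assms by (auto simp: cell_def field_simps)
  then show ?thesis by linarith
qed (use assms in \<open>simp add: cell_def\<close>)

lemma cell_cover:
  assumes "x \<in> {0<..1}" "1 \<le> n"
  obtains i where "i \<in> {1..n}" "x \<in> cell n i"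
proof
  define i where "i = nat \<lceil>real n * x\<rceil>"
  have pos: "0 < real n * x" using assms by simp
  have "real n * x \<le> real n" using assms by (simp add: mult_left_le)
  then show "i \<in> {1..n}" using pos by (auto simp: i_def le_nat_iff nat_le_iff ceiling_le_iff)
  have "real i = of_int \<lceil>real n * x\<rceil>" using pos by (simp add: i_def)
  then have "real i - 1 < real n * x" "real n * x \<le> real i" by linarith+
  then show "x \<in> cell n i" using assms by (auto simp: cell_def field_simps)
qed

lemma cell_dist:
  assumes "x \<in> cell n i" "y \<in> cell n i" shows "dist x y \<le> 1 / real n"
proof -
  have "real i / real n - (real i - 1) / real n = 1 / real n" by (simp add: diff_divide_distrib)
  then show ?thesis using assms by (auto simp: cell_def dist_real_def abs_le_iff)
qed

lemma eventually_inverse_nat_less: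
  assumes "0 < e" shows "\<forall>\<^sub>F n in sequentially. c / real n < e"
  using order_tendstoD(2)[OF tendsto_mult_right_zero[OF lim_1_over_n, of c] assms] by simp

text \<open>Cells are closed on the right, so \<open>i / n\<close> can serve as the sample point at
  which an equation on cell \<open>i\<close> is reduced to one for its coefficient.\<close>

lemma cell_endpoint: "i \<in> {1..n} \<Longrightarrow> real i / real n \<in> cell n i"
  by (simp add: cell_def divide_strict_right_mono)

lemma indicator_cell:
  assumes "x \<in> cell n i" shows "indicator (cell n k) x = (of_bool (k = i) :: real)"
  using assms cell_disjoint by (auto simp: indicator_def)

section \<open>Kernels constant on cells\<close>

lemma measure_cell_prod:
  assumes "1 \<le> n"
  shows "measure lebesgue (cell n i \<times> cell n j) = 1 / (real n)\<^sup>2"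
proof -
  have e: "emeasure lborel (cell n i) = ennreal (1 / real n)" for i
    using assms by (simp add: cell_def diff_divide_distrib divide_right_mono)
  have "emeasure lborel (cell n i \<times> cell n j) = emeasure (lborel \<Otimes>\<^sub>M lborel) (cell n i \<times> cell n j)"
    by (simp add: lborel_prod)
  also have "\<dots> = ennreal (1 / (real n)\<^sup>2)"
    by (subst lborel.emeasure_pair_measure_Times) (auto simp: e ennreal_mult[symmetric] power2_eq_square)
  finally show ?thesis
    by (subst measure_completion) (auto simp: measure_def borel_Times)
qed

lemma cell_prod_lebesgue: "cell n i \<times> cell n j \<in> sets lebesgue"
  by (auto simp: borel_Times intro!: sets_completionI_sets)

lemma step_kernel_measurable [measurable]: "step_kernel n V \<in> borel_measurable borel"
  unfolding step_kernel_def[abs_def]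
  by (intro borel_measurable_sum borel_measurable_times borel_measurable_const borel_measurable_indicator)
    (simp add: borel_Times)

lemma step_kernel_bounded: obtains B where "\<And>p. \<bar>step_kernel n V p\<bar> \<le> B" "0 \<le> B"
proof
  let ?B = "\<Sum>i\<in>{1..n}. \<Sum>j\<in>{1..n}. \<bar>cell_average n V i j\<bar>"
  show "0 \<le> ?B" by (intro sum_nonneg) auto
  show "\<bar>step_kernel n V p\<bar> \<le> ?B" for p
    unfolding step_kernel_def
    by (intro order_trans[OF sum_abs] sum_mono) (auto simp: abs_mult indicator_def)
qed

text \<open>Supplies both hypotheses on \<open>V\<close> of the Lipschitz estimate, with
  \<open>M = B\<close>. For step kernels \<open>B\<close> depends on \<open>n\<close>.\<close>

lemma bounded_kernel:
  assumes V: "V \<in> borel_measurable borel" and B: "\<And>p. \<bar>V p\<bar> \<le> B"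
  shows "L2_kernel V" "(\<integral>\<^sup>+y. ennreal \<bar>V (x, y)\<bar> \<partial>leb01) \<le> ennreal B"
proof -
  note m [measurable] = borel_measurable_leb01_sq[OF V]
  have "integrable leb01_sq (\<lambda>p. (V p)\<^sup>2)"
    by (rule leb01_sq.integrable_const_bound[of _ "B\<^sup>2"])
      (use power_mono[OF B, where n=2] in \<open>auto intro!: AE_I2\<close>)
  then show "L2_kernel V" by (simp add: L2_kernel_def)
  have "(\<integral>\<^sup>+y. ennreal \<bar>V (x, y)\<bar> \<partial>leb01) \<le> (\<integral>\<^sup>+y. ennreal B \<partial>leb01)"
    by (intro nn_integral_mono ennreal_leI B)
  then show "(\<integral>\<^sup>+y. ennreal \<bar>V (x, y)\<bar> \<partial>leb01) \<le> ennreal B" by simp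
qed

lemma step_kernel_cell:
  assumes "x \<in> cell n i" "i \<in> {1..n}"
  shows "step_kernel n V (x, y) = step_kernel n V (real i / real n, y)"
  using indicator_cell[OF assms(1)] indicator_cell[OF cell_endpoint[OF assms(2)]]
  by (simp add: step_kernel_def indicator_times)

text \<open>The weight \<open>n^2\<close> in \<open>cell_average\<close> is the inverse measure of a
  square cell, so step kernels are averages over a partition indexed by pairs. The sequence
  \<open>k\<close> is constant where (W-2) is exploited and consists of truncations in the averaged
  problem.\<close>

lemma step_kernel_tendsto_L2:
  fixes W :: "real \<times> real \<Rightarrow> real"
  assumes W: "square_integrable ({0..1} \<times> {0..1}) W" and k: "\<And>n. square_integrable ({0..1} \<times> {0..1}) (k n)"
    and lim: "(\<lambda>n. LINT p|lebesgue_on ({0..1} \<times> {0..1}). (k n p - W p)\<^sup>2) \<longlonglongrightarrow> 0"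
  shows "(\<lambda>n. LINT p|lebesgue_on ({0..1} \<times> {0..1}). (step_kernel n (k n) p - W p)\<^sup>2) \<longlonglongrightarrow> 0"
proof -
  let ?S = "{0..1::real} \<times> {0..1::real}"
  define C where "C n ij = cell n (fst ij) \<times> cell n (snd ij)" for n ij
  let ?J = "\<lambda>n::nat. {1..n} \<times> {1..n}"
  have eq: "step_kernel n (k n) p = (\<Sum>ij\<in>?J n. (LINT z|lebesgue_on (C n ij). k n z) / measure lebesgue (C n ij)
      * indicator (C n ij) p)" for n p
    unfolding step_kernel_def sum.cartesian_product
    by (rule sum.cong) (auto simp: C_def cell_average_def measure_cell_prod)
  have "(\<lambda>n. LINT p|lebesgue_on ?S. ((\<Sum>ij\<in>?J n. (LINT z|lebesgue_on (C n ij). k n z) / measure lebesgue (C n ij)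
      * indicator (C n ij) p) - W p)\<^sup>2) \<longlonglongrightarrow> 0"
  proof (rule cell_averages_tendsto_L2[OF _ _ _ _ _ _ _ _ W k lim])
    show "compact ?S" by (intro compact_Times compact_Icc)
    show "finite (?J n)" for n by simp
    show "C n ij \<in> sets lebesgue" for n ij by (simp add: C_def cell_prod_lebesgue)
    show "C n ij \<subseteq> ?S" if "ij \<in> ?J n" for n ij
      using cell_subset[of "fst ij" n] cell_subset[of "snd ij" n] that by (fastforce simp: C_def)
    show "0 < measure lebesgue (C n ij)" if "ij \<in> ?J n" for n ij
      using that by (auto simp: C_def measure_cell_prod)
    show "disjoint_family_on (C n) (?J n)" for n
      using cell_disjoint by (fastforce simp: disjoint_family_on_def C_def)
    \<comment> \<open>Only points with a vanishing coordinate lie in no cell, and they are contained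
      in two lines. For \<open>n = 0\<close> there are no cells, hence the restriction to
      \<open>1 \<le> n\<close>.\<close>
    show "negligible (?S - (\<Union>ij\<in>?J n. C n ij))" if n1: "1 \<le> n" for n
    proof (rule negligible_subset)
      show "negligible ({p. (1, 0) \<bullet> p = (0::real)} \<union> {p. (0, 1) \<bullet> p = (0::real)} :: (real \<times> real) set)"
        by (intro negligible_Un negligible_hyperplane) (auto simp: zero_prod_def)
      show "?S - (\<Union>ij\<in>?J n. C n ij) \<subseteq> {p. (1, 0) \<bullet> p = 0} \<union> {p. (0, 1) \<bullet> p = 0}"
      proof
        fix p assume p: "p \<in> ?S - (\<Union>ij\<in>?J n. C n ij)"
        obtain x y where xy: "p = (x, y)" by fastforce
        show "p \<in> {p. (1, 0) \<bullet> p = 0} \<union> {p. (0, 1) \<bullet> p = 0}"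
        proof (rule ccontr)
          assume "\<not> ?thesis"
          then have "x \<in> {0<..1}" "y \<in> {0<..1}" using p by (auto simp: xy)
          then obtain i j where "i \<in> {1..n}" "x \<in> cell n i" "j \<in> {1..n}" "y \<in> cell n j"
            using cell_cover[OF _ n1] by metis
          then have "(i, j) \<in> ?J n" "p \<in> C n (i, j)" by (auto simp: C_def xy)
          then show False using p by blast
        qed
      qed
    qed
    show "\<forall>\<^sub>F n in sequentially. \<forall>ij\<in>?J n. \<forall>p\<in>C n ij. \<forall>q\<in>C n ij. dist p q < e" if "0 < e" for e
      using eventually_inverse_nat_less[OF that, of 2]
    proof eventually_elim
      case (elim n)
      show ?case
      proof (intro ballI)
        fix ij p q assume "p \<in> C n ij" "q \<in> C n ij"
        then have d: "dist (fst p) (fst q) \<le> 1 / real n" "dist (snd p) (snd q) \<le> 1 / real n"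
          by (auto simp: C_def mem_Times_iff intro: cell_dist)
        have "dist p q \<le> dist (fst p) (fst q) + dist (snd p) (snd q)"
          unfolding dist_prod_def by (rule sqrt_sum_squares_le_sum) auto
        also have "\<dots> \<le> 2 / real n" using d by simp
        finally show "dist p q < e" using elim by simp
      qed
    qed
  qed
  then show ?thesis unfolding eq .
qed

section \<open>Step functions and averaged initial data\<close>

lemma step_function_square_integrable:
  "square_integrable {0..1} (\<lambda>x. \<Sum>i\<in>{1..n}. c i * indicator (cell n i) x)"
proof -
  have "square_integrable {0..1} (\<lambda>x. \<Sum>i\<in>I. c i * indicator (cell n i) x)" if "finite I" for I
    using that
  proof induction
    case (insert i I)
    show ?case
      unfolding sum.insert[OF insert.hyps]
      by (intro square_integrable_add square_integrable_scale square_integrable_indicator cell_lebesgue insert.IH)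
  qed (simp add: square_integrable_zero)
  from this[OF finite_atLeastAtMost] show ?thesis .
qed

lemma step_datum_square_integrable: "square_integrable {0..1} (step_datum n g)"
  unfolding step_datum_def[abs_def] by (rule step_function_square_integrable)

lemma step_datum_tendsto_L2:
  assumes g: "square_integrable {0..1} g"
  shows "(\<lambda>n. abs_L2 (step_datum n g)) \<longlonglongrightarrow> abs_L2 g"
proof -
  have eq: "step_datum n g x = (\<Sum>i\<in>{1..n}. (LINT z|lebesgue_on (cell n i). g z) / measure lebesgue (cell n i)
      * indicator (cell n i) x)" for n x
    unfolding step_datum_def by (rule sum.cong) (auto simp: measure_cell)
  have "(\<lambda>n. LINT x|leb01. ((\<Sum>i\<in>{1..n}. (LINT z|lebesgue_on (cell n i). g z) / measure lebesgue (cell n i)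
      * indicator (cell n i) x) - g x)\<^sup>2) \<longlonglongrightarrow> 0"
  proof (rule cell_averages_tendsto_L2[OF _ _ _ _ _ _ _ _ g g])
    show "compact {0..1::real}" by (rule compact_Icc)
    show "cell n i \<in> sets lebesgue" for n i by (rule cell_lebesgue)
    show "cell n i \<subseteq> {0..1}" if "i \<in> {1..n}" for n i
      using cell_subset[OF that] by fastforce
    show "0 < measure lebesgue (cell n i)" if "i \<in> {1..n}" for n i
      using that by (simp add: measure_cell)
    show "disjoint_family_on (cell n) {1..n}" for n
      using cell_disjoint by (fastforce simp: disjoint_family_on_def)
    show "negligible ({0..1} - (\<Union>i\<in>{1..n}. cell n i))" if n1: "1 \<le> n" for n
    proof (rule negligible_subset)
      show "negligible {0::real}" by simp
      show "{0..1} - (\<Union>i\<in>{1..n}. cell n i) \<subseteq> {0}"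
      proof
        fix x assume x: "x \<in> {0..1} - (\<Union>i\<in>{1..n}. cell n i)"
        show "x \<in> {0}"
        proof (rule ccontr)
          assume "x \<notin> {0}"
          then have "x \<in> {0<..1}" using x by auto
          then obtain i where "i \<in> {1..n}" "x \<in> cell n i" using cell_cover[OF _ n1] by metis
          then show False using x by blast
        qed
      qed
    qed
    show "\<forall>\<^sub>F n in sequentially. \<forall>i\<in>{1..n}. \<forall>x\<in>cell n i. \<forall>y\<in>cell n i. dist x y < e" if "0 < e" for e
      using eventually_inverse_nat_less[OF that, of 1]
    proof eventually_elim
      case (elim n)
      then show ?case using cell_dist[of _ n] by (meson le_less_trans)
    qed
  qed auto
  then have "(\<lambda>n. (norm (abs_L2 (step_datum n g) - abs_L2 g))\<^sup>2) \<longlonglongrightarrow> 0"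
    using norm_abs_L2[OF square_integrable_diff[OF step_datum_square_integrable g]]
    by (simp add: abs_L2_diff[OF step_datum_square_integrable g] eq)
  then have "(\<lambda>n. sqrt ((norm (abs_L2 (step_datum n g) - abs_L2 g))\<^sup>2)) \<longlonglongrightarrow> sqrt 0"
    by (rule tendsto_real_sqrt)
  then have "(\<lambda>n. norm (abs_L2 (step_datum n g) - abs_L2 g)) \<longlonglongrightarrow> 0" by simp
  then show ?thesis by (rule LIM_zero_cancel[OF tendsto_norm_zero_cancel])
qed

section \<open>Row bound and convergence of the kernels\<close>


abbreviation (input) lebesgue_sq :: "(real \<times> real) measure" where
  "lebesgue_sq \<equiv> lebesgue_on ({0..1} \<times> {0..1})"

lemma square_lebesgue: "{0..1::real} \<times> {0..1::real} \<in> sets lebesgue"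
  by (rule lmeasurable_compact[OF compact_Times[OF compact_Icc compact_Icc], THEN fmeasurableD])

lemma borel_measurable_lebesgue_onI:
  fixes f :: "'a::euclidean_space \<Rightarrow> 'b::topological_space"
  shows "f \<in> borel_measurable borel \<Longrightarrow> f \<in> borel_measurable (lebesgue_on S)"
  by (intro measurable_restrict_space1 measurable_completion) simp

lemma borel_section_measurable:
  fixes V :: "real \<times> real \<Rightarrow> real"
  assumes [measurable]: "V \<in> borel_measurable borel"
  shows "(\<lambda>y. V (x, y)) \<in> borel_measurable leb01"
  by (rule borel_measurable_lebesgue_onI) measurable

lemma integral_leb01_sq:
  fixes F :: "real \<times> real \<Rightarrow> real"
  assumes F: "F \<in> borel_measurable borel" and nonneg: "\<And>p. 0 \<le> F p"
  shows "(LINT p|leb01_sq. F p) = (LINT p|lebesgue_sq. F p)"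
proof -
  have "(LINT p|leb01_sq. F p) = enn2real (\<integral>\<^sup>+p. ennreal (F p) \<partial>leb01_sq)"
    by (rule integral_eq_nn_integral) (use borel_measurable_leb01_sq[OF F] nonneg in auto)
  also have "(\<integral>\<^sup>+p. ennreal (F p) \<partial>leb01_sq) = (\<integral>\<^sup>+p. ennreal (F p) \<partial>lebesgue_sq)"
    using F by (intro nn_integral_leb01_sq) measurable
  also have "enn2real (\<integral>\<^sup>+p. ennreal (F p) \<partial>lebesgue_sq) = (LINT p|lebesgue_sq. F p)"
    by (rule integral_eq_nn_integral[symmetric]) (use borel_measurable_lebesgue_onI[OF F] nonneg in auto)
  finally show ?thesis .
qed

lemma square_integrable_cong_AE:
  assumes "S \<in> sets lebesgue" "square_integrable S f" "AE x in lebesgue_on S. f x = g x"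
  shows "square_integrable S g"
proof -
  have m: "f \<in> borel_measurable (lebesgue_on S)" "g \<in> borel_measurable (lebesgue_on S)"
    using assms borel_measurable_lebesgue_on_cong_AE by (auto simp: square_integrable_def)
  have "integrable (lebesgue_on S) (\<lambda>x. (f x)\<^sup>2) \<longleftrightarrow> integrable (lebesgue_on S) (\<lambda>x. (g x)\<^sup>2)"
    using assms(3) m by (intro integrable_cong_AE) (auto elim: eventually_mono)
  then show ?thesis using assms(2) m by (simp add: square_integrable_def)
qed

text \<open>The given \<open>W\<close> need not be measurable for the product sigma-algebra.
  Multiplying by the indicator of the square makes it measurable on the whole plane, where a Borel
  version exists.\<close>

lemma square_integrable_borel_version:
  assumes W: "square_integrable ({0..1} \<times> {0..1}) W"
  obtains W0 where "W0 \<in> borel_measurable borel" "AE p in lebesgue_sq. W p = W0 p" "L2_kernel W0"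
proof -
  have "(\<lambda>p. indicator ({0..1} \<times> {0..1}) p * W p) \<in> borel_measurable lebesgue"
    using W square_lebesgue
    by (simp add: square_integrable_def borel_measurable_restrict_space_iff)
  then obtain W0 where W0: "W0 \<in> borel_measurable lborel"
    and AE: "AE p in lborel. indicator ({0..1} \<times> {0..1}) p * W p = W0 p"
    using completion_ex_borel_measurable_real by blast
  have AE': "AE p in lebesgue_sq. W p = W0 p"
    using AE_completion[OF AE] square_lebesgue
    by (subst AE_restrict_space_iff) (auto elim!: eventually_mono simp: indicator_def split: if_splits)
  have "square_integrable ({0..1} \<times> {0..1}) W0"
    by (rule square_integrable_cong_AE[OF square_lebesgue W AE'])
  then have "(\<integral>\<^sup>+p. ennreal ((W0 p)\<^sup>2) \<partial>lebesgue_sq) < \<infinity>"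
    by (auto simp: square_integrable_def integrable_iff_bounded)
  moreover have [measurable]: "W0 \<in> borel_measurable borel" using W0 by simp
  have "(\<integral>\<^sup>+p. ennreal ((W0 p)\<^sup>2) \<partial>leb01_sq) = (\<integral>\<^sup>+p. ennreal ((W0 p)\<^sup>2) \<partial>lebesgue_sq)"
    by (rule nn_integral_leb01_sq) measurable
  moreover have m: "W0 \<in> borel_measurable leb01_sq" by (rule borel_measurable_leb01_sq) measurable
  ultimately have "integrable leb01_sq (\<lambda>p. (W0 p)\<^sup>2)"
    by (intro integrableI_nonneg borel_measurable_power) (simp_all only: AE_I2 zero_le_power2)
  then have k: "L2_kernel W0" using m by (simp add: L2_kernel_def)
  show thesis by (rule that[OF _ AE' k]) measurable
qed

text \<open>Almost everywhere statements are the same for a measure and its completion, so the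
  passage to rows can be made for \<open>lborel\<close> on the plane, which is a product.\<close>

lemma AE_lebesgue_sq_rows:
  assumes "AE p in lebesgue_sq. P p"
  shows "AE x in leb01. AE y in leb01. P (x, y)"
proof -
  have "AE p in lebesgue. p \<in> {0..1} \<times> {0..1} \<longrightarrow> P p"
    using assms square_lebesgue by (subst (asm) AE_restrict_space_iff) auto
  then have "AE p in lborel \<Otimes>\<^sub>M lborel. p \<in> {0..1} \<times> {0..1} \<longrightarrow> P p"
    by (simp only: AE_completion_iff lborel_prod)
  then have "AE x in lborel. AE y in lborel. (x, y) \<in> {0..1} \<times> {0..1} \<longrightarrow> P (x, y)"
    by (rule lborel_pair.AE_pair)
  then have "AE x in lebesgue. x \<in> {0..1} \<longrightarrow> (AE y in lebesgue. y \<in> {0..1} \<longrightarrow> P (x, y))"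
    unfolding AE_completion_iff by eventually_elim (auto elim: eventually_mono)
  then show ?thesis by (simp add: AE_restrict_space_iff)
qed

text \<open>For almost every \<open>x\<close> the rows of \<open>W\<close> and \<open>W0\<close>
  agree almost everywhere, so the two integrals coincide there. The remaining \<open>x\<close> form
  a null set and are invisible to \<open>abs_L2\<close>.\<close>

lemma coupling_kernel_cong_AE:
  assumes D: "L-lipschitz_on UNIV D" "\<And>x. \<bar>D x\<bar> \<le> 1"
    and W0: "W0 \<in> borel_measurable borel" "L2_kernel W0" and AE: "AE p in lebesgue_sq. W p = W0 p"
  shows "coupling W D = coupling W0 D"
proof
  fix u
  define h where "h = rep_L2 u"
  have h [measurable]: "h \<in> borel_measurable leb01"
    using square_integrable_rep[of u] by (simp add: h_def square_integrable_def)
  note [measurable] = D_measurable[OF D] W0(1)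
  have "AE x in leb01. coupling_fun W0 D h x = coupling_fun W D h x"
    using AE_lebesgue_sq_rows[OF AE]
  proof eventually_elim
    case (elim x)
    have W0x: "(\<lambda>y. W0 (x, y)) \<in> borel_measurable leb01"
      by (rule borel_section_measurable[OF W0(1)])
    have Wx: "(\<lambda>y. W (x, y)) \<in> borel_measurable leb01"
      by (rule borel_measurable_lebesgue_on_cong_AE[OF _ W0x]) (use elim in \<open>auto elim: eventually_mono\<close>)
    show ?case
      unfolding coupling_fun_def
      by (rule integral_cong_AE) (use W0x Wx elim in \<open>auto elim: eventually_mono\<close>)
  qed
  moreover have s: "square_integrable {0..1} (coupling_fun W0 D h)"
    by (rule coupling_fun_square_integrable(1)[OF D W0(2) h])
  ultimately have "abs_L2 (coupling_fun W0 D h) = abs_L2 (coupling_fun W D h)"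
    using square_integrable_cong_AE[OF _ s] by (subst abs_L2_eq_iff) auto
  then show "coupling W D u = coupling W0 D u"
    by (simp add: coupling_def coupling_fun_def[abs_def] h_def)
qed

lemma cond_W2_bound:
  assumes "cond_W2 W"
  obtains M where "0 \<le> M" "\<And>n x. 1 \<le> n \<Longrightarrow> x \<in> {0..1} \<Longrightarrow> (LINT y|leb01. step_kernel n W (x, y)) \<le> M"
proof -
  define s where "s = (SUP n\<in>{1..}. SUP x\<in>{0..1}. ereal (LINT y|leb01. step_kernel n W (x, y)))"
  have le: "ereal (LINT y|leb01. step_kernel n W (x, y)) \<le> s" if "1 \<le> n" "x \<in> {0..1}" for n x
    unfolding s_def using that by (intro SUP_upper2[of n] SUP_upper) auto
  have "s < \<infinity>" using assms by (simp add: cond_W2_def s_def)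
  then obtain r where "s \<le> ereal r" by (cases s) auto
  show thesis
  proof (rule that[of "max 0 r"])
    fix n :: nat and x :: real assume "1 \<le> n" "x \<in> {0..1}"
    from order_trans[OF le[OF this] \<open>s \<le> ereal r\<close>]
    show "(LINT y|leb01. step_kernel n W (x, y)) \<le> max 0 r" by simp
  qed simp
qed

lemma step_kernel_nonneg:
  assumes "AE p in lebesgue_sq. 0 \<le> W p"
  shows "0 \<le> step_kernel n W p"
proof -
  have "0 \<le> cell_average n W i j" if "i \<in> {1..n}" "j \<in> {1..n}" for i j
  proof -
    have sub: "cell n i \<times> cell n j \<subseteq> {0..1} \<times> {0..1}"
      using cell_subset[OF that(1)] cell_subset[OF that(2)] by fastforce
    have "AE p in lebesgue. p \<in> {0..1} \<times> {0..1} \<longrightarrow> 0 \<le> W p"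
      using assms square_lebesgue by (subst (asm) AE_restrict_space_iff) auto
    then have "AE p in lebesgue_on (cell n i \<times> cell n j). 0 \<le> W p"
      using sub cell_prod_lebesgue by (subst AE_restrict_space_iff) (auto elim!: eventually_mono)
    then show ?thesis unfolding cell_average_def by (intro mult_nonneg_nonneg integral_nonneg_AE) auto
  qed
  then show ?thesis unfolding step_kernel_def by (intro sum_nonneg mult_nonneg_nonneg) auto
qed

text \<open>The excess of a row integral over the bound of (W-2) is at most the row integral of
  \<open>\<bar>W0 - W\<^sub>n\<bar>\<close>, which tends to zero in \<open>L\<^sup>2\<close>.\<close>

lemma row_integral_bound:
  assumes W: "square_integrable ({0..1} \<times> {0..1}) W" and nonneg: "AE p in lebesgue_sq. 0 \<le> W p"
    and W2: "cond_W2 W"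
    and W0: "W0 \<in> borel_measurable borel" "L2_kernel W0" and AE: "AE p in lebesgue_sq. W p = W0 p"
  obtains M where "0 \<le> M" "AE x in leb01. (\<integral>\<^sup>+y. ennreal \<bar>W0 (x, y)\<bar> \<partial>leb01) \<le> ennreal M"
proof -
  obtain M where M: "0 \<le> M" "\<And>n x. 1 \<le> n \<Longrightarrow> x \<in> {0..1} \<Longrightarrow> (LINT y|leb01. step_kernel n W (x, y)) \<le> M"
    using cond_W2_bound[OF W2] by metis
  define R where "R x = (\<integral>\<^sup>+y. ennreal \<bar>W0 (x, y)\<bar> \<partial>leb01)" for x
  note [measurable] = W0(1) L2_kernel_measurable[OF W0(2)] borel_measurable_leb01_sq[OF step_kernel_measurable]
  have Rm [measurable]: "R \<in> borel_measurable leb01" unfolding R_def[abs_def] by measurable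
  have sm: "(\<lambda>y. W0 (x, y)) \<in> borel_measurable leb01" "(\<lambda>y. step_kernel n W (x, y)) \<in> borel_measurable leb01" for n x
    by (intro borel_section_measurable W0(1) step_kernel_measurable)+
  \<comment> \<open>Subtraction in \<open>ennreal\<close> is cut off at 0, so
    \<open>R x - ennreal M\<close> is the excess over the bound, also where \<open>R x\<close> is
    infinite.\<close>
  have bound: "(\<integral>\<^sup>+x. (R x - ennreal M)\<^sup>2 \<partial>leb01) \<le> ennreal (LINT p|lebesgue_sq. (step_kernel n W p - W p)\<^sup>2)"
    if n: "1 \<le> n" for n
  proof -
    obtain B where B: "\<And>p. \<bar>step_kernel n W p\<bar> \<le> B" "0 \<le> B" using step_kernel_bounded[of n W] by blast
    have L: "L2_kernel (\<lambda>p. W0 p - step_kernel n W p)"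
      by (rule L2_kernel_diff[OF W0(2) bounded_kernel(1)[OF step_kernel_measurable B(1)]])
    have "R x - ennreal M \<le> (\<integral>\<^sup>+y. ennreal \<bar>W0 (x, y) - step_kernel n W (x, y)\<bar> \<partial>leb01)" if x: "x \<in> space leb01" for x
    proof -
      have i: "integrable leb01 (\<lambda>y. step_kernel n W (x, y))"
        by (rule leb01.integrable_const_bound[of _ B]) (use B sm in \<open>auto intro!: AE_I2\<close>)
      have "R x \<le> (\<integral>\<^sup>+y. ennreal (step_kernel n W (x, y)) + ennreal \<bar>W0 (x, y) - step_kernel n W (x, y)\<bar> \<partial>leb01)"
        unfolding R_def
      proof (rule nn_integral_mono)
        fix y
        have "\<bar>W0 (x, y)\<bar> \<le> step_kernel n W (x, y) + \<bar>W0 (x, y) - step_kernel n W (x, y)\<bar>"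
          using step_kernel_nonneg[OF nonneg, of n "(x, y)"] by linarith
        then show "ennreal \<bar>W0 (x, y)\<bar> \<le> ennreal (step_kernel n W (x, y)) + ennreal \<bar>W0 (x, y) - step_kernel n W (x, y)\<bar>"
          using step_kernel_nonneg[OF nonneg, of n "(x, y)"]
          by (simp add: ennreal_plus[symmetric] ennreal_leI del: ennreal_plus)
      qed
      also have "\<dots> = (\<integral>\<^sup>+y. ennreal (step_kernel n W (x, y)) \<partial>leb01) + (\<integral>\<^sup>+y. ennreal \<bar>W0 (x, y) - step_kernel n W (x, y)\<bar> \<partial>leb01)"
        using sm by (intro nn_integral_add) auto
      also have "(\<integral>\<^sup>+y. ennreal (step_kernel n W (x, y)) \<partial>leb01) = ennreal (LINT y|leb01. step_kernel n W (x, y))"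
        using i step_kernel_nonneg[OF nonneg] by (intro nn_integral_eq_integral) auto
      also have "\<dots> \<le> ennreal M"
        using M(2)[OF n, of x] x by (intro ennreal_leI) simp
      finally show ?thesis
        by (simp add: ennreal_minus_le_iff add_right_mono)
    qed
    then have "(\<integral>\<^sup>+x. (R x - ennreal M)\<^sup>2 \<partial>leb01)
        \<le> (\<integral>\<^sup>+x. (\<integral>\<^sup>+y. ennreal \<bar>W0 (x, y) - step_kernel n W (x, y)\<bar> \<partial>leb01)\<^sup>2 \<partial>leb01)"
      by (intro nn_integral_mono power_mono) auto
    also have "\<dots> \<le> (\<integral>\<^sup>+p. ennreal ((W0 p - step_kernel n W p)\<^sup>2) \<partial>leb01_sq)"
      by (rule nn_integral_row_square[OF L2_kernel_measurable[OF L]])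
    also have "\<dots> = ennreal (LINT p|lebesgue_sq. (W0 p - step_kernel n W p)\<^sup>2)"
      unfolding L2_kernel_nn_integral[OF L] by (subst integral_leb01_sq) auto
    also have "(LINT p|lebesgue_sq. (W0 p - step_kernel n W p)\<^sup>2) = (LINT p|lebesgue_sq. (step_kernel n W p - W p)\<^sup>2)"
    proof (rule integral_cong_AE)
      show "AE p in lebesgue_sq. (W0 p - step_kernel n W p)\<^sup>2 = (step_kernel n W p - W p)\<^sup>2"
        using AE by eventually_elim (simp add: power2_commute)
      have [measurable]: "W \<in> borel_measurable lebesgue_sq" using W by (simp add: square_integrable_def)
      have [measurable]: "W0 \<in> borel_measurable lebesgue_sq" "step_kernel n W \<in> borel_measurable lebesgue_sq"
        by (auto intro!: borel_measurable_lebesgue_onI W0)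
      show "(\<lambda>p. (W0 p - step_kernel n W p)\<^sup>2) \<in> borel_measurable lebesgue_sq" by measurable
      show "(\<lambda>p. (step_kernel n W p - W p)\<^sup>2) \<in> borel_measurable lebesgue_sq" by measurable
    qed
    finally show ?thesis .
  qed
  have "(\<lambda>n. ennreal (LINT p|lebesgue_sq. (step_kernel n W p - W p)\<^sup>2)) \<longlonglongrightarrow> ennreal 0"
    by (intro tendsto_ennrealI step_kernel_tendsto_L2 W) simp
  \<comment> \<open>The left-hand side does not depend on \<open>n\<close>, so it is bounded by the
    limit.\<close>
  then have "(\<integral>\<^sup>+x. (R x - ennreal M)\<^sup>2 \<partial>leb01) \<le> ennreal 0"
    by (rule LIMSEQ_le_const) (use bound in auto)
  then have "(\<integral>\<^sup>+x. (R x - ennreal M)\<^sup>2 \<partial>leb01) = 0" by simp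
  then have "AE x in leb01. (R x - ennreal M)\<^sup>2 = 0"
    by (subst (asm) nn_integral_0_iff_AE) auto
  then have "AE x in leb01. R x \<le> ennreal M"
    by eventually_elim (auto simp: power2_eq_square intro: ennreal_minus_eq_0)
  then show thesis using M(1) by (intro that[of M]) (auto simp: R_def)
qed

lemma truncated_kernel_square_integrable:
  assumes W: "square_integrable ({0..1} \<times> {0..1}) W"
  shows "square_integrable ({0..1} \<times> {0..1}) (truncated_kernel a W)"
proof -
  interpret S: finite_measure lebesgue_sq
    by (intro finite_measure_lebesgue_on lmeasurable_compact compact_Times compact_Icc)
  have m [measurable]: "W \<in> borel_measurable lebesgue_sq" using W by (simp add: square_integrable_def)
  have t [measurable]: "truncated_kernel a W \<in> borel_measurable lebesgue_sq"
    unfolding truncated_kernel_def[abs_def] by measurable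
  have "integrable lebesgue_sq (\<lambda>p. (truncated_kernel a W p)\<^sup>2)"
  proof (rule Bochner_Integration.integrable_bound)
    show "integrable lebesgue_sq (\<lambda>p. (inverse a)\<^sup>2 + (W p)\<^sup>2)"
      using W by (auto simp: square_integrable_def)
    show "AE p in lebesgue_sq. norm ((truncated_kernel a W p)\<^sup>2) \<le> norm ((inverse a)\<^sup>2 + (W p)\<^sup>2)"
      by (auto simp: truncated_kernel_def min_def)
  qed measurable
  then show ?thesis by (simp add: square_integrable_def)
qed

lemma truncated_kernel_tendsto_L2:
  assumes W: "square_integrable ({0..1} \<times> {0..1}) W" and nonneg: "AE p in lebesgue_sq. 0 \<le> W p"
    and \<alpha>: "\<And>n. 1 \<le> n \<Longrightarrow> 0 < \<alpha> n" "\<alpha> \<longlonglongrightarrow> 0"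
  shows "(\<lambda>n. LINT p|lebesgue_sq. (truncated_kernel (\<alpha> n) W p - W p)\<^sup>2) \<longlonglongrightarrow> 0"
proof -
  have m [measurable]: "W \<in> borel_measurable lebesgue_sq"
    "truncated_kernel a W \<in> borel_measurable lebesgue_sq" for a
    using W truncated_kernel_square_integrable[OF W, of a] by (auto simp: square_integrable_def)
  \<comment> \<open>The index is shifted because positivity of \<open>\<alpha>\<close> is available
    from index 1 on; the limit is the same.\<close>
  have "(\<lambda>n. LINT p|lebesgue_sq. (truncated_kernel (\<alpha> (Suc n)) W p - W p)\<^sup>2) \<longlonglongrightarrow> (LINT p|lebesgue_sq. 0)"
  proof (rule integral_dominated_convergence[where w="\<lambda>p. (W p)\<^sup>2"])
    show "integrable lebesgue_sq (\<lambda>p. (W p)\<^sup>2)" using W by (simp add: square_integrable_def)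
    show "AE p in lebesgue_sq. norm ((truncated_kernel (\<alpha> (Suc n)) W p - W p)\<^sup>2) \<le> (W p)\<^sup>2" for n
      using nonneg
    proof eventually_elim
      case (elim p)
      have "0 < inverse (\<alpha> (Suc n))" using \<alpha>(1) by simp
      then have "\<bar>truncated_kernel (\<alpha> (Suc n)) W p - W p\<bar> \<le> \<bar>W p\<bar>"
        using elim by (auto simp: truncated_kernel_def min_def)
      then show ?case unfolding abs_le_square_iff by simp
    qed
    show "AE p in lebesgue_sq. (\<lambda>n. (truncated_kernel (\<alpha> (Suc n)) W p - W p)\<^sup>2) \<longlonglongrightarrow> 0"
    proof (rule AE_I2, rule tendsto_eventually)
      fix p
      \<comment> \<open>At each point the truncation is inactive as soon as
        \<open>inverse (\<alpha> (Suc n))\<close> exceeds \<open>W p\<close>, so the sequence is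
        eventually 0.\<close>
      have "filterlim (\<lambda>n. \<alpha> (Suc n)) (at_right 0) sequentially"
        using \<alpha> by (intro tendsto_imp_filterlim_at_right LIMSEQ_Suc) auto
      then have "filterlim (\<lambda>n. inverse (\<alpha> (Suc n))) at_top sequentially"
        by (rule filterlim_compose[OF filterlim_inverse_at_top_right])
      then have "\<forall>\<^sub>F n in sequentially. W p \<le> inverse (\<alpha> (Suc n))"
        by (simp add: filterlim_at_top)
      then show "\<forall>\<^sub>F n in sequentially. (truncated_kernel (\<alpha> (Suc n)) W p - W p)\<^sup>2 = 0"
        by eventually_elim (simp add: truncated_kernel_def)
    qed
  qed measurable
  then show ?thesis by (subst filterlim_sequentially_Suc[symmetric]) simp
qed

lemma averaged_kernel_tendsto_L2:
  assumes W: "square_integrable ({0..1} \<times> {0..1}) W" and nonneg: "AE p in lebesgue_sq. 0 \<le> W p"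
    and W0: "W0 \<in> borel_measurable borel" and AE: "AE p in lebesgue_sq. W p = W0 p"
    and \<alpha>: "\<And>n. 1 \<le> n \<Longrightarrow> 0 < \<alpha> n" "\<alpha> \<longlonglongrightarrow> 0"
  shows "(\<lambda>n. LINT p|leb01_sq. (W0 p - step_kernel n (truncated_kernel (\<alpha> n) W) p)\<^sup>2) \<longlonglongrightarrow> 0"
proof -
  have "(LINT p|leb01_sq. (W0 p - step_kernel n V p)\<^sup>2) = (LINT p|lebesgue_sq. (step_kernel n V p - W p)\<^sup>2)" for n V
  proof -
    note [measurable] = W0
    have "(LINT p|leb01_sq. (W0 p - step_kernel n V p)\<^sup>2) = (LINT p|lebesgue_sq. (W0 p - step_kernel n V p)\<^sup>2)"
      by (rule integral_leb01_sq) auto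
    also have "\<dots> = (LINT p|lebesgue_sq. (step_kernel n V p - W p)\<^sup>2)"
    proof (rule integral_cong_AE)
      show "AE p in lebesgue_sq. (W0 p - step_kernel n V p)\<^sup>2 = (step_kernel n V p - W p)\<^sup>2"
        using AE by eventually_elim (simp add: power2_commute)
      have [measurable]: "W \<in> borel_measurable lebesgue_sq" using W by (simp add: square_integrable_def)
      have [measurable]: "W0 \<in> borel_measurable lebesgue_sq" "step_kernel n V \<in> borel_measurable lebesgue_sq"
        by (auto intro!: borel_measurable_lebesgue_onI W0)
      show "(\<lambda>p. (W0 p - step_kernel n V p)\<^sup>2) \<in> borel_measurable lebesgue_sq" by measurable
      show "(\<lambda>p. (step_kernel n V p - W p)\<^sup>2) \<in> borel_measurable lebesgue_sq" by measurable
    qed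
    finally show ?thesis .
  qed
  then show ?thesis
    using step_kernel_tendsto_L2[OF W truncated_kernel_square_integrable[OF W] truncated_kernel_tendsto_L2[OF W nonneg \<alpha>]]
    by simp
qed

section \<open>The averaged problem\<close>


lemma norm_abs_L2_mono:
  assumes h: "square_integrable {0..1} h" and k: "square_integrable {0..1} k" and c: "0 \<le> c"
    and le: "\<And>x. \<bar>h x\<bar> \<le> c * \<bar>k x\<bar>"
  shows "norm (abs_L2 h) \<le> c * norm (abs_L2 k)"
proof (rule power2_le_imp_le)
  have "(norm (abs_L2 h))\<^sup>2 = (LINT x|leb01. (h x)\<^sup>2)" by (rule norm_abs_L2[OF h])
  also have "\<dots> \<le> (LINT x|leb01. c\<^sup>2 * (k x)\<^sup>2)"
  proof (rule integral_mono)
    show "(h x)\<^sup>2 \<le> c\<^sup>2 * (k x)\<^sup>2" for x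
      using power_mono[OF le[of x], of 2] by (simp add: power_mult_distrib)
  qed (use h k in \<open>auto simp: square_integrable_def\<close>)
  also have "\<dots> = (c * norm (abs_L2 k))\<^sup>2"
    by (simp add: norm_abs_L2[OF k] power_mult_distrib)
  finally show "(norm (abs_L2 h))\<^sup>2 \<le> (c * norm (abs_L2 k))\<^sup>2" .
qed (use c in simp)

lemma square_integrable_const: "square_integrable {0..1::real} (\<lambda>x. c)"
  by (simp add: square_integrable_def)

section \<open>The reaction term\<close>

context
  fixes f :: "real \<Rightarrow> real \<Rightarrow> real" and K :: real
  assumes f_lip: "\<And>t. K-lipschitz_on UNIV (\<lambda>u. f u t)"
    and f_cont: "\<And>u. continuous_on UNIV (f u)"
begin

lemma f_growth: "\<bar>f u t\<bar> \<le> \<bar>f 0 t\<bar> + K * \<bar>u\<bar>"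
  using lipschitz_onD[OF f_lip, of u 0 t] by (simp add: dist_real_def)

lemma reaction_square_integrable:
  assumes h: "square_integrable {0..1::real} h"
  shows "square_integrable {0..1} (\<lambda>x. f (h x) t)"
proof -
  have [measurable]: "h \<in> borel_measurable leb01" using h by (simp add: square_integrable_def)
  have [measurable]: "(\<lambda>u. f u t) \<in> borel_measurable borel"
    by (rule borel_measurable_continuous_onI[OF lipschitz_on_continuous_on[OF f_lip]])
  have m: "(\<lambda>x. f (h x) t) \<in> borel_measurable leb01" by measurable
  have "square_integrable {0..1} (\<lambda>x. \<bar>f 0 t\<bar> + K * \<bar>h x\<bar>)"
    using h by (intro square_integrable_add square_integrable_scale square_integrable_const)
      (auto simp: square_integrable_def)
  then have "integrable leb01 (\<lambda>x. (\<bar>f 0 t\<bar> + K * \<bar>h x\<bar>)\<^sup>2)" by (simp add: square_integrable_def)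
  then have "integrable leb01 (\<lambda>x. (f (h x) t)\<^sup>2)"
  proof (rule Bochner_Integration.integrable_bound)
    show "AE x in leb01. norm ((f (h x) t)\<^sup>2) \<le> norm ((\<bar>f 0 t\<bar> + K * \<bar>h x\<bar>)\<^sup>2)"
      using power_mono[OF f_growth, where n=2] by (auto intro!: AE_I2)
  qed (use m in measurable)
  then show ?thesis using m by (simp add: square_integrable_def)
qed

lemma reaction_lipschitz: "norm (reaction f t u - reaction f t w) \<le> K * norm (u - w)"
proof -
  note s = square_integrable_rep[of u] square_integrable_rep[of w]
  have "norm (abs_L2 (\<lambda>x. f (rep_L2 u x) t - f (rep_L2 w x) t)) \<le> K * norm (abs_L2 (\<lambda>x. rep_L2 u x - rep_L2 w x))"
  proof (rule norm_abs_L2_mono)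
    show "square_integrable {0..1} (\<lambda>x. f (rep_L2 u x) t - f (rep_L2 w x) t)"
      by (intro square_integrable_diff reaction_square_integrable s)
    show "square_integrable {0..1} (\<lambda>x. rep_L2 u x - rep_L2 w x)"
      by (intro square_integrable_diff s)
    show "0 \<le> K" by (rule lipschitz_on_nonneg[OF f_lip])
    show "\<bar>f (rep_L2 u x) t - f (rep_L2 w x) t\<bar> \<le> K * \<bar>rep_L2 u x - rep_L2 w x\<bar>" for x
      using lipschitz_onD[OF f_lip, of "rep_L2 u x" "rep_L2 w x" t] by (simp add: dist_real_def)
  qed
  then show ?thesis
    by (simp add: reaction_def abs_L2_diff reaction_square_integrable s abs_rep_L2)
qed

lemma reaction_abs_L2:
  assumes h: "square_integrable {0..1} h"
  shows "reaction f t (abs_L2 h) = abs_L2 (\<lambda>x. f (h x) t)"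
  unfolding reaction_def
  using rep_abs_L2[OF h]
  by (subst abs_L2_eq_iff) (auto intro!: reaction_square_integrable h square_integrable_rep elim: eventually_mono)

text \<open>Continuity of \<open>f\<close> in time is assumed for each fixed value only. The
  Lipschitz condition supplies linear growth, and \<open>f 0\<close> is bounded on
  \<open>{0..T}\<close>; this gives a majorant independent of time for dominated
  convergence.\<close>

lemma reaction_continuous: "continuous_on {0..T} (\<lambda>t. reaction f t u)"
proof (rule continuous_on_sequentiallyI)
  fix s t assume s: "\<forall>n. s n \<in> {0..T}" and t: "t \<in> {0..T}" and st: "s \<longlonglongrightarrow> t"
  have f0: "continuous_on {0..T} (f 0)" by (rule continuous_on_subset[OF f_cont]) simp
  obtain B where B: "\<And>t. t \<in> {0..T} \<Longrightarrow> norm (f 0 t) \<le> B"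
    using compact_imp_bounded[OF compact_continuous_image[OF f0 compact_Icc]] unfolding bounded_iff by blast
  show "(\<lambda>n. reaction f (s n) u) \<longlonglongrightarrow> reaction f t u"
    unfolding reaction_def
  proof (rule L2_dominated[where k="\<lambda>x. B + K * \<bar>rep_L2 u x\<bar>"])
    show "square_integrable {0..1} (\<lambda>x. B + K * \<bar>rep_L2 u x\<bar>)"
      using square_integrable_rep[of u]
      by (intro square_integrable_add square_integrable_scale square_integrable_const)
        (auto simp: square_integrable_def)
    show "(\<lambda>n. f (rep_L2 u x) (s n)) \<longlonglongrightarrow> f (rep_L2 u x) t" for x
      using continuous_on_tendsto_compose[OF f_cont st] by simp
    show "\<bar>f (rep_L2 u x) (s n)\<bar> \<le> B + K * \<bar>rep_L2 u x\<bar>" for n x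
      using f_growth[of "rep_L2 u x" "s n"] B[OF s[rule_format, of n]] unfolding real_norm_def by linarith
  qed (intro reaction_square_integrable square_integrable_rep)+
qed

end

definition rhs :: "(real \<times> real \<Rightarrow> real) \<Rightarrow> (real \<Rightarrow> real) \<Rightarrow> (real \<Rightarrow> real \<Rightarrow> real) \<Rightarrow> real \<Rightarrow> L2 \<Rightarrow> L2" where
  "rhs V D f t u = coupling V D u + reaction f t u"

section \<open>Step functions as a finite-dimensional subspace\<close>

definition step_fun :: "nat \<Rightarrow> (nat \<Rightarrow> real) \<Rightarrow> real \<Rightarrow> real" where
  "step_fun n c x = (\<Sum>i\<in>{1..n}. c i * indicator (cell n i) x)"

abbreviation step_basis :: "nat \<Rightarrow> nat \<Rightarrow> L2" where
  "step_basis n i \<equiv> abs_L2 (indicator (cell n i))"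

lemma step_fun_cell:
  assumes "x \<in> cell n i" "i \<in> {1..n}" shows "step_fun n c x = c i"
  unfolding step_fun_def using assms by (simp add: indicator_cell[OF assms(1)] of_bool_def if_distrib cong: if_cong)

lemma step_fun_square_integrable: "square_integrable {0..1} (step_fun n c)"
  unfolding step_fun_def[abs_def] by (rule step_function_square_integrable)

lemma abs_L2_step_fun: "abs_L2 (step_fun n c) = (\<Sum>i\<in>{1..n}. c i *\<^sub>R step_basis n i)"
proof -
  have "square_integrable {0..1} (\<lambda>x. \<Sum>i\<in>I. c i * indicator (cell n i) x) \<and>
      abs_L2 (\<lambda>x. \<Sum>i\<in>I. c i * indicator (cell n i) x) = (\<Sum>i\<in>I. c i *\<^sub>R step_basis n i)" if "finite I" for I
    using that
  proof induction
    case empty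
    have "abs_L2 (\<lambda>x. 0) = 0" by (simp add: zero_L2.abs_eq)
    then show ?case by (simp add: square_integrable_zero)
  next
    case (insert i I)
    have 1: "square_integrable {0..1} (indicator (cell n i))"
      by (intro square_integrable_indicator cell_lebesgue)
    have 2: "square_integrable {0..1} (\<lambda>x. c i * indicator (cell n i) x)"
      by (rule square_integrable_scale[OF 1])
    have 3: "square_integrable {0..1} (\<lambda>x. \<Sum>i\<in>I. c i * indicator (cell n i) x)"
      and 4: "abs_L2 (\<lambda>x. \<Sum>i\<in>I. c i * indicator (cell n i) x) = (\<Sum>i\<in>I. c i *\<^sub>R step_basis n i)"
      using insert.IH by blast+
    show ?case
      unfolding sum.insert[OF insert.hyps] abs_L2_add[OF 2 3] abs_L2_scale[OF 1] 4
      using square_integrable_add[OF 2 3] by blast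
  qed
  from this[OF finite_atLeastAtMost, of 1 n] show ?thesis unfolding step_fun_def[abs_def] by blast
qed

lemma inner_step_basis:
  assumes "square_integrable {0..1} h" "i \<in> {1..n}"
  shows "inner (abs_L2 h) (step_basis n i) = (LINT x|lebesgue_on (cell n i). h x)"
proof -
  have s: "square_integrable {0..1} (indicator (cell n i))"
    by (intro square_integrable_indicator cell_lebesgue)
  have "inner (abs_L2 h) (step_basis n i) = (LINT x|leb01. indicator (cell n i) x * h x)"
    using assms s by (simp add: inner_L2.abs_eq L2_rel_refl mult.commute)
  also have "\<dots> = (LINT x|lebesgue_on (cell n i). h x)"
    using cell_subset[OF assms(2)] by (intro integral_lebesgue_on_subset cell_lebesgue) fastforce+
  finally show ?thesis .
qed

text \<open>A cell has length \<open>1 / n\<close>, so scaling by \<open>n\<close> turns the inner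
  product into the cell mean. Coefficients become functionals of the class, which serves both
  uniqueness and the projection in the existence proof.\<close>

lemma inner_step_fun:
  assumes i: "i \<in> {1..n}"
  shows "real n * inner (abs_L2 (step_fun n c)) (step_basis n i) = c i"
proof -
  have "(LINT x|lebesgue_on (cell n i). step_fun n c x) = (LINT x|lebesgue_on (cell n i). c i)"
    using i by (intro Bochner_Integration.integral_cong) (auto simp: step_fun_cell)
  also have "\<dots> = c i / real n"
    using i by (simp add: measure_restrict_space cell_lebesgue measure_cell)
  finally show ?thesis
    using i by (simp add: inner_step_basis[OF step_fun_square_integrable i])
qed

section \<open>Solutions of the averaged problem\<close>

context
  fixes D :: "real \<Rightarrow> real" and L :: real and f :: "real \<Rightarrow> real \<Rightarrow> real" and K :: real
  assumes D: "L-lipschitz_on UNIV D" "\<And>x. \<bar>D x\<bar> \<le> 1"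
    and f: "\<And>t. K-lipschitz_on UNIV (\<lambda>u. f u t)" "\<And>u. continuous_on UNIV (f u)"
begin

lemma rhs_lipschitz:
  assumes V: "L2_kernel V"
    and M: "AE x in leb01. (\<integral>\<^sup>+y. ennreal \<bar>V (x, y)\<bar> \<partial>leb01) \<le> ennreal M" "0 \<le> M"
  obtains \<Lambda> where "0 < \<Lambda>" "\<And>t u w. norm (rhs V D f t u - rhs V D f t w) \<le> \<Lambda> * norm (u - w)"
proof -
  let ?a = "sqrt (2 * L\<^sup>2 * ((LINT p|leb01_sq. (V p)\<^sup>2) + M\<^sup>2))"
  have a: "0 \<le> ?a" by simp
  have K: "0 \<le> K" by (rule lipschitz_on_nonneg[OF f(1)])
  show thesis
  \<comment> \<open>The summand \<open>1\<close> makes the constant strictly positive, as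
    \<open>ode_stability\<close> and \<open>picard_lindelof_global\<close> require.\<close>
  proof (rule that[of "?a + K + 1"])
    show "0 < ?a + K + 1" using a K by linarith
    fix t u w
    have "norm (rhs V D f t u - rhs V D f t w)
        = norm ((coupling V D u - coupling V D w) + (reaction f t u - reaction f t w))"
      by (simp add: rhs_def algebra_simps)
    also have "\<dots> \<le> norm (coupling V D u - coupling V D w) + norm (reaction f t u - reaction f t w)"
      by (rule norm_triangle_ineq)
    also have "\<dots> \<le> ?a * norm (u - w) + K * norm (u - w)"
      by (intro add_mono coupling_lipschitz[OF D V M] reaction_lipschitz[OF f])
    also have "\<dots> \<le> (?a + K + 1) * norm (u - w)" by (simp only: distrib_right) simp
    finally show "norm (rhs V D f t u - rhs V D f t w) \<le> (?a + K + 1) * norm (u - w)" .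
  qed
qed

lemma rhs_continuous: "continuous_on {0..T} (\<lambda>t. rhs V D f t u)"
  unfolding rhs_def by (intro continuous_on_add continuous_on_const reaction_continuous[OF f])

lemma step_kernel_rhs_lipschitz:
  obtains \<Lambda> where "0 < \<Lambda>" "\<And>t u w. norm (rhs (step_kernel n X) D f t u - rhs (step_kernel n X) D f t w) \<le> \<Lambda> * norm (u - w)"
proof -
  obtain B where B: "\<And>p. \<bar>step_kernel n X p\<bar> \<le> B" "0 \<le> B" using step_kernel_bounded[of n X] by blast
  from rhs_lipschitz[OF bounded_kernel(1)[OF step_kernel_measurable B(1)] AE_I2[OF bounded_kernel(2)[OF step_kernel_measurable B(1)]] B(2)]
  show thesis using that by blast
qed

text \<open>Rows of a step kernel are constant on cells, so the right-hand side maps step functions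
  to step functions. On coefficient vectors the equation in \<open>L2\<close> is a finite system,
  with the kernel sampled at \<open>i / n\<close>.\<close>

lemma rhs_step_fun:
  assumes n: "1 \<le> n"
  shows "rhs (step_kernel n X) D f t (abs_L2 (step_fun n c)) = abs_L2 (step_fun n (\<lambda>i. f (c i) t +
    (LINT y|leb01. step_kernel n X (real i / real n, y) * D (step_fun n c y - c i))))"
proof -
  obtain B where B: "\<And>p. \<bar>step_kernel n X p\<bar> \<le> B" "0 \<le> B" using step_kernel_bounded[of n X] by blast
  let ?V = "step_kernel n X" and ?h = "step_fun n c"
  note Vk = bounded_kernel(1)[OF step_kernel_measurable B(1)]
  note s = step_fun_square_integrable[of n c]
  have hm: "?h \<in> borel_measurable leb01" using s by (simp add: square_integrable_def)
  note s1 = coupling_fun_square_integrable(1)[OF D Vk hm]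
  note s2 = reaction_square_integrable[OF f s]
  have "rhs ?V D f t (abs_L2 ?h) = abs_L2 (coupling_fun ?V D ?h) + abs_L2 (\<lambda>x. f (?h x) t)"
    unfolding rhs_def
    using coupling_abs_L2[OF D Vk s AE_I2[OF bounded_kernel(2)[OF step_kernel_measurable B(1)]] B(2)]
      reaction_abs_L2[OF f s] by simp
  also have "\<dots> = abs_L2 (\<lambda>x. coupling_fun ?V D ?h x + f (?h x) t)"
    by (rule abs_L2_add[OF s1 s2, symmetric])
  also have "\<dots> = abs_L2 (step_fun n (\<lambda>i. f (c i) t + (LINT y|leb01. ?V (real i / real n, y) * D (?h y - c i))))"
  proof (subst abs_L2_eq_iff[OF square_integrable_add[OF s1 s2] step_fun_square_integrable])
    \<comment> \<open>The point \<open>0\<close> belongs to no cell: step functions vanish there,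
      while \<open>f 0 t\<close> need not. The identity is shown off this null set.\<close>
    have "AE x in lebesgue. x \<noteq> (0::real)"
      by (rule AE_completion) (rule AE_lborel_singleton)
    then have "AE x in leb01. x \<noteq> 0 \<and> x \<in> {0..1}"
      by (subst AE_restrict_space_iff) (auto elim: eventually_mono)
    then show "AE x in leb01. coupling_fun ?V D ?h x + f (?h x) t =
        step_fun n (\<lambda>i. f (c i) t + (LINT y|leb01. ?V (real i / real n, y) * D (?h y - c i))) x"
    proof eventually_elim
      case (elim x)
      then have "x \<in> {0<..1}" by auto
      then obtain i where i: "i \<in> {1..n}" "x \<in> cell n i" using cell_cover[OF _ n] by metis
      have "?V (x, y) = ?V (real i / real n, y)" for y by (rule step_kernel_cell[OF i(2,1)])
      then show ?case by (simp add: step_fun_cell[OF i(2,1)] coupling_fun_def)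
    qed
  qed
  finally show ?thesis .
qed

text \<open>The definition prescribes a derivative for each \<open>x\<close> separately. As only the
  \<open>n\<close> coefficients vary in time, their derivatives give the derivative in
  \<open>L2\<close> by linearity, with no uniformity in \<open>x\<close> to be checked.\<close>

lemma averaged_solution_L2_curve:
  assumes n: "1 \<le> n" and v: "averaged_solution n a W D f g T v"
  shows "\<And>t. t \<in> {0..T} \<Longrightarrow> ((\<lambda>s. abs_L2 (v s)) has_vector_derivative
      rhs (step_kernel n (truncated_kernel a W)) D f t (abs_L2 (v t))) (at t within {0..T})"
    and "0 \<le> T \<Longrightarrow> abs_L2 (v 0) = abs_L2 (step_datum n g)"
    and "\<exists>c. \<forall>t\<in>{0..T}. (\<forall>x\<in>{0..1}. v t x = step_fun n (c t) x) \<and> abs_L2 (v t) = abs_L2 (step_fun n (c t))"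
proof -
  let ?V = "step_kernel n (truncated_kernel a W)"
  obtain c where c: "\<And>t x. t \<in> {0..T} \<Longrightarrow> x \<in> {0..1} \<Longrightarrow> v t x = step_fun n (\<lambda>i. c i t) x"
    using v unfolding averaged_solution_def step_fun_def by blast
  have dv: "((\<lambda>s. v s x) has_real_derivative f (v t x) t + (LINT y|leb01. ?V (x, y) * D (v t y - v t x))) (at t within {0..T})"
    if "t \<in> {0..T}" "x \<in> {0<..1}" for t x
    using v that unfolding averaged_solution_def by blast
  have v0: "v 0 x = step_datum n g x" if "x \<in> {0<..1}" for x
    using v that unfolding averaged_solution_def by blast
  have eq: "abs_L2 (v t) = abs_L2 (step_fun n (\<lambda>i. c i t))" if t: "t \<in> {0..T}" for t
  proof -
    have AE: "AE x in leb01. step_fun n (\<lambda>i. c i t) x = v t x"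
      using c[OF t] by (auto intro!: AE_I2)
    have "square_integrable {0..1} (v t)"
      by (rule square_integrable_cong_AE[OF _ step_fun_square_integrable AE]) simp
    with AE show ?thesis
      using abs_L2_eq_iff[OF step_fun_square_integrable, of "v t" n "\<lambda>i. c i t"] by simp
  qed
  show "\<exists>c. \<forall>t\<in>{0..T}. (\<forall>x\<in>{0..1}. v t x = step_fun n (c t) x) \<and> abs_L2 (v t) = abs_L2 (step_fun n (c t))"
    using c eq by (intro exI[of _ "\<lambda>t i. c i t"]) blast
  define b where "b t i = f (c i t) t + (LINT y|leb01. ?V (real i / real n, y) * D (step_fun n (\<lambda>i. c i t) y - c i t))" for t i
  \<comment> \<open>The equation is read off at the sample point \<open>i / n\<close>, where
    \<open>v\<close> equals its coefficient \<open>c i\<close>.\<close>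
  have dc: "(c i has_real_derivative b t i) (at t within {0..T})" if t: "t \<in> {0..T}" and i: "i \<in> {1..n}" for t i
  proof -
    let ?x = "real i / real n"
    have x: "?x \<in> cell n i" "?x \<in> {0<..1}"
      using cell_endpoint[OF i] cell_subset[OF i] by auto
    then have vc: "v s ?x = c i s" if "s \<in> {0..T}" for s
      using c[OF that, of ?x] step_fun_cell[OF x(1) i] by auto
    have "f (v t ?x) t + (LINT y|leb01. ?V (?x, y) * D (v t y - v t ?x)) = b t i"
      unfolding b_def vc[OF t] using c[OF t]
      by (intro arg_cong2[of _ _ _ _ "(+)"] refl Bochner_Integration.integral_cong) auto
    with dv[OF t x(2)] have "((\<lambda>s. v s ?x) has_real_derivative b t i) (at t within {0..T})" by simp
    then show ?thesis
      unfolding has_real_derivative_iff_has_vector_derivative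
      by (rule has_vector_derivative_transform[OF t, rotated]) (simp add: vc)
  qed
  show "((\<lambda>s. abs_L2 (v s)) has_vector_derivative rhs ?V D f t (abs_L2 (v t))) (at t within {0..T})"
    if t: "t \<in> {0..T}" for t
  proof -
    have r: "rhs ?V D f t (abs_L2 (v t)) = (\<Sum>i\<in>{1..n}. b t i *\<^sub>R step_basis n i)"
      unfolding eq[OF t] rhs_step_fun[OF n] b_def[symmetric] by (rule abs_L2_step_fun)
    have "((\<lambda>s. \<Sum>i\<in>{1..n}. c i s *\<^sub>R step_basis n i) has_vector_derivative (\<Sum>i\<in>{1..n}. b t i *\<^sub>R step_basis n i))
        (at t within {0..T})"
    proof (rule has_vector_derivative_sum)
      fix i assume "i \<in> {1..n}"
      from dc[OF t this]
      show "((\<lambda>s. c i s *\<^sub>R step_basis n i) has_vector_derivative b t i *\<^sub>R step_basis n i) (at t within {0..T})"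
        unfolding has_real_derivative_iff_has_vector_derivative
        by (rule bounded_linear.has_vector_derivative[OF bounded_linear_scaleR_left])
    qed
    then show ?thesis
      unfolding r by (rule has_vector_derivative_transform[OF t, rotated]) (simp add: eq abs_L2_step_fun)
  qed
  show "abs_L2 (v 0) = abs_L2 (step_datum n g)" if "0 \<le> T"
  proof -
    \<comment> \<open>At \<open>x = 0\<close> no initial condition is imposed, but both functions
      vanish there as step functions.\<close>
    have "AE x in leb01. step_datum n g x = v 0 x"
    proof (rule AE_I2)
      fix x assume "x \<in> space leb01"
      then have x: "x \<in> {0..1}" by simp
      show "step_datum n g x = v 0 x"
      proof (cases "x = 0")
        case True
        have "indicator (cell n i) (0::real) = (0::real)" if "i \<in> {1..n}" for i
          using cell_subset[OF that] by (auto simp: indicator_def)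
        then have "step_datum n g 0 = 0" "step_fun n (\<lambda>i. c i 0) 0 = 0"
          by (auto simp: step_datum_def step_fun_def intro!: sum.neutral)
        then show ?thesis using c[of 0 x] x True \<open>0 \<le> T\<close> by simp
      next
        case False
        then show ?thesis using v0[of x] x by auto
      qed
    qed
    moreover from this have "square_integrable {0..1} (v 0)"
      by (rule square_integrable_cong_AE[OF _ step_datum_square_integrable, rotated]) simp
    ultimately show ?thesis
      using abs_L2_eq_iff[OF step_datum_square_integrable, of "v 0" n g] by simp
  qed
qed

text \<open>\<open>ode_stability\<close> with \<open>\<delta> = 0\<close> identifies the classes in
  \<open>L2\<close>; recovering the coefficients from the class upgrades this to equality at every
  point.\<close>

lemma averaged_solution_unique:
  assumes n: "1 \<le> n" and v: "averaged_solution n a W D f g T v" and w: "averaged_solution n a W D f g T w"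
    and t: "t \<in> {0..T}" and x: "x \<in> {0..1}"
  shows "v t x = w t x"
proof -
  let ?V = "step_kernel n (truncated_kernel a W)"
  obtain \<Lambda> where \<Lambda>: "0 < \<Lambda>" "\<And>t u w. norm (rhs ?V D f t u - rhs ?V D f t w) \<le> \<Lambda> * norm (u - w)"
    using step_kernel_rhs_lipschitz[of n "truncated_kernel a W"] by blast
  have T: "0 \<le> T" using t by auto
  have "norm (abs_L2 (v t) - abs_L2 (w t)) \<le> 2 * (norm (abs_L2 (v 0) - abs_L2 (w 0)) + 0 * T) * exp (2 * \<Lambda> * T)"
  proof (rule ode_stability[OF \<Lambda>(1) order_refl _ _ t])
    fix t assume "t \<in> {0..T}"
    then show "((\<lambda>t. abs_L2 (v t) - abs_L2 (w t)) has_vector_derivative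
        rhs ?V D f t (abs_L2 (v t)) - rhs ?V D f t (abs_L2 (w t))) (at t within {0..T})"
      by (intro has_vector_derivative_diff averaged_solution_L2_curve(1)[OF n v] averaged_solution_L2_curve(1)[OF n w])
    show "norm (rhs ?V D f t (abs_L2 (v t)) - rhs ?V D f t (abs_L2 (w t))) \<le> 0 + \<Lambda> * norm (abs_L2 (v t) - abs_L2 (w t))"
      using \<Lambda>(2) by simp
  qed
  then have eq: "abs_L2 (v t) = abs_L2 (w t)"
    using averaged_solution_L2_curve(2)[OF n v T] averaged_solution_L2_curve(2)[OF n w T] by simp
  obtain c where c: "\<And>x. x \<in> {0..1} \<Longrightarrow> v t x = step_fun n c x" "abs_L2 (v t) = abs_L2 (step_fun n c)"
    using averaged_solution_L2_curve(3)[OF n v] t by blast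
  obtain d where d: "\<And>x. x \<in> {0..1} \<Longrightarrow> w t x = step_fun n d x" "abs_L2 (w t) = abs_L2 (step_fun n d)"
    using averaged_solution_L2_curve(3)[OF n w] t by blast
  have "c i = d i" if "i \<in> {1..n}" for i
    using inner_step_fun[OF that, of c] inner_step_fun[OF that, of d] eq c(2) d(2) by simp
  then show ?thesis
    unfolding c(1)[OF x] d(1)[OF x] step_fun_def by (intro sum.cong) auto
qed

text \<open>The equation is solved in \<open>L2\<close> with the state projected onto the step functions inside the
  right-hand side; the coefficients of the projected solution then solve the averaged system.\<close>

lemma averaged_solution_exists:
  assumes n: "1 \<le> n" and T: "0 < T" and g: "square_integrable {0..1} g"
  obtains v where "averaged_solution n a W D f g T v"
proof -
  let ?V = "step_kernel n (truncated_kernel a W)"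
  obtain \<Lambda> where \<Lambda>: "0 < \<Lambda>" "\<And>t u w. norm (rhs ?V D f t u - rhs ?V D f t w) \<le> \<Lambda> * norm (u - w)"
    using step_kernel_rhs_lipschitz[of n "truncated_kernel a W"] by blast
  \<comment> \<open>Orthogonal projection onto the span of the cell indicators, whose squared norms
    are \<open>1 / n\<close>. Its boundedness keeps the projected right-hand side Lipschitz, with
    constant \<open>\<Lambda> * B\<close>.\<close>
  define P where "P w = (\<Sum>i\<in>{1..n}. (real n * inner w (step_basis n i)) *\<^sub>R step_basis n i)" for w
  have P: "bounded_linear P"
    unfolding P_def
    by (intro bounded_linear_sum bounded_linear_compose[OF bounded_linear_scaleR_left]
        bounded_linear_compose[OF bounded_linear_mult_right] bounded_linear_inner_left)
  obtain B where B: "0 < B" "\<And>w. norm (P w) \<le> norm w * B"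
    using bounded_linear.pos_bounded[OF P] by blast
  \<comment> \<open>The curve starts at \<open>g\<close>, not at its projection, and need not
    consist of step functions; its coefficients at time 0 are already the cell means of
    \<open>g\<close>.\<close>
  obtain U where U: "U 0 = abs_L2 g"
    "\<And>t. t \<in> {0..T} \<Longrightarrow> (U has_vector_derivative rhs ?V D f t (P (U t))) (at t within {0..T})"
  proof (rule picard_lindelof_global[OF T, of "\<Lambda> * B" "\<lambda>t w. rhs ?V D f t (P w)" "abs_L2 g"])
    show "0 < \<Lambda> * B" using \<Lambda> B by simp
    fix t u w
    have "norm (rhs ?V D f t (P u) - rhs ?V D f t (P w)) \<le> \<Lambda> * norm (P u - P w)" by (rule \<Lambda>(2))
    also have "\<dots> \<le> \<Lambda> * (norm (u - w) * B)"
      unfolding linear_diff[OF bounded_linear.linear[OF P], symmetric] using \<Lambda> B by (intro mult_left_mono) auto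
    finally show "norm (rhs ?V D f t (P u) - rhs ?V D f t (P w)) \<le> \<Lambda> * B * norm (u - w)" by (simp add: mult_ac)
    show "continuous_on {0..T} (\<lambda>t. rhs ?V D f t (P w))" by (rule rhs_continuous)
  qed blast
  define c where "c t i = real n * inner (U t) (step_basis n i)" for t i
  have PU: "P (U t) = abs_L2 (step_fun n (c t))" for t
    by (simp add: P_def abs_L2_step_fun c_def)
  define b where "b t i = f (c t i) t + (LINT y|leb01. ?V (real i / real n, y) * D (step_fun n (c t) y - c t i))" for t i
  have dc: "((\<lambda>s. c s i) has_real_derivative b t i) (at t within {0..T})" if t: "t \<in> {0..T}" and i: "i \<in> {1..n}" for t i
  proof -
    have "((\<lambda>s. c s i) has_vector_derivative real n * inner (rhs ?V D f t (P (U t))) (step_basis n i)) (at t within {0..T})"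
      unfolding c_def
      by (rule bounded_linear.has_vector_derivative[OF _ U(2)[OF t],
            of "\<lambda>w. real n * inner w (step_basis n i)"])
        (intro bounded_linear_compose[OF bounded_linear_mult_right] bounded_linear_inner_left)
    also have "real n * inner (rhs ?V D f t (P (U t))) (step_basis n i) = b t i"
      unfolding PU rhs_step_fun[OF n] b_def[symmetric] by (rule inner_step_fun[OF i])
    finally show ?thesis by (simp add: has_real_derivative_iff_has_vector_derivative)
  qed
  show thesis
  proof (rule that[of "\<lambda>t. step_fun n (c t)"], unfold averaged_solution_def, intro conjI ballI)
    show "\<exists>c'. \<forall>t\<in>{0..T}. \<forall>x\<in>{0..1}. step_fun n (c t) x = (\<Sum>i\<in>{1..n}. c' i t * indicator (cell n i) x)"
      by (intro exI[of _ "\<lambda>i t. c t i"]) (simp add: step_fun_def)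
    fix x assume "x \<in> {0<..1::real}"
    then obtain i where i: "i \<in> {1..n}" "x \<in> cell n i" using cell_cover[OF _ n] by metis
    have Vx: "?V (x, y) = ?V (real i / real n, y)" for y by (rule step_kernel_cell[OF i(2,1)])
    show "((\<lambda>s. step_fun n (c s) x) has_real_derivative f (step_fun n (c t) x) t +
        (LINT y|leb01. ?V (x, y) * D (step_fun n (c t) y - step_fun n (c t) x))) (at t within {0..T})"
      if "t \<in> {0..T}" for t
      using dc[OF that i(1)] by (simp add: step_fun_cell[OF i(2,1)] Vx b_def)
    show "step_fun n (c 0) x = step_datum n g x"
    proof -
      have "step_datum n g = step_fun n (\<lambda>i. real n * (LINT z|lebesgue_on (cell n i). g z))"
        by (simp add: step_datum_def[abs_def] step_fun_def[abs_def])
      then show ?thesis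
        by (simp add: step_fun_cell[OF i(2,1)] c_def U(1) inner_step_basis[OF g i(1)])
    qed
  qed
qed

end

section \<open>Well-posedness and convergence\<close>


theorem theorem5p2:
  fixes D :: "real \<Rightarrow> real" and f :: "real \<Rightarrow> real \<Rightarrow> real"
    and W :: "real \<times> real \<Rightarrow> real" and g :: "real \<Rightarrow> real"
    and \<alpha> :: "nat \<Rightarrow> real" and T :: real
  assumes D_periodic: "\<And>x. D (x + 2 * pi) = D x"
    and D_lipschitz: "\<exists>L. L-lipschitz_on UNIV D"
    and D_max: "(\<forall>x. \<bar>D x\<bar> \<le> 1) \<and> (\<exists>x. \<bar>D x\<bar> = 1)"
    and f_lipschitz: "\<exists>L. \<forall>t. L-lipschitz_on UNIV (\<lambda>u. f u t)"
    and f_continuous: "\<And>u. continuous_on UNIV (\<lambda>t. f u t)"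
    and \<alpha>_le_1: "\<And>n. n \<ge> 1 \<Longrightarrow> \<alpha> n \<le> 1"
    and \<alpha>_antimono: "antimono_on {1..} \<alpha>"
    and \<alpha>_tendsto: "\<alpha> \<longlonglongrightarrow> 0"
    and n_\<alpha>: "filterlim (\<lambda>n. real n * \<alpha> n) at_top sequentially"
    and W_L2: "square_integrable ({0..1} \<times> {0..1}) W"
    and W_nonneg: "AE p in lebesgue_on ({0..1} \<times> {0..1}). 0 \<le> W p"
    and W1: "cond_W1 W"
    and W2: "cond_W2 W"
    and g_L2: "square_integrable {0..1} g"
    and T_pos: "0 < T"
  shows "\<exists>u. weak_solution W D f g T u \<and>
    (\<forall>w. weak_solution W D f g T w \<longrightarrow> (\<forall>t\<in>{0..T}. w t = u t)) \<and>
    (\<forall>n\<ge>1. \<exists>v. averaged_solution n (\<alpha> n) W D f g T v \<and>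
      (\<forall>v'. averaged_solution n (\<alpha> n) W D f g T v' \<longrightarrow>
        (\<forall>t\<in>{0..T}. \<forall>x\<in>{0..1}. v' t x = v t x))) \<and>
    (\<forall>v. (\<forall>n\<ge>1. averaged_solution n (\<alpha> n) W D f g T (v n)) \<longrightarrow>
      (\<lambda>n. C_norm T (\<lambda>t. abs_L2 (v n t) - u t)) \<longlonglongrightarrow> 0)"
proof -
  obtain L where D: "L-lipschitz_on UNIV D" "\<And>x. \<bar>D x\<bar> \<le> 1" using D_lipschitz D_max by blast
  obtain K where f: "\<And>t. K-lipschitz_on UNIV (\<lambda>u. f u t)" "\<And>u. continuous_on UNIV (f u)"
    using f_lipschitz f_continuous by blast
  \<comment> \<open>A nonpositive \<open>\<alpha> n\<close> would stay nonpositive for all larger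
    indices by monotonicity, against \<open>n * \<alpha> n\<close> tending to infinity.\<close>
  have \<alpha>_pos: "0 < \<alpha> n" if "1 \<le> n" for n
  proof (rule ccontr)
    assume "\<not> 0 < \<alpha> n"
    then have "real m * \<alpha> m \<le> 0" if "n \<le> m" for m
      using monotone_onD[OF \<alpha>_antimono, of n m] \<open>1 \<le> n\<close> that by (intro mult_nonneg_nonpos) auto
    moreover have "\<forall>\<^sub>F m in sequentially. 1 \<le> real m * \<alpha> m"
      using n_\<alpha> by (simp add: filterlim_at_top)
    then obtain N where "\<And>m. N \<le> m \<Longrightarrow> 1 \<le> real m * \<alpha> m" by (auto simp: eventually_sequentially)
    ultimately show False using \<open>1 \<le> n\<close> by (meson max.cobounded1 max.cobounded2 not_one_le_zero order_trans)
  qed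
  obtain W0 where W0: "W0 \<in> borel_measurable borel" "AE p in lebesgue_sq. W p = W0 p" "L2_kernel W0"
    using square_integrable_borel_version[OF W_L2] by blast
  obtain M where M: "0 \<le> M" "AE x in leb01. (\<integral>\<^sup>+y. ennreal \<bar>W0 (x, y)\<bar> \<partial>leb01) \<le> ennreal M"
    using row_integral_bound[OF W_L2 W_nonneg W2 W0(1,3,2)] by blast
  have coup: "coupling W D = coupling W0 D" by (rule coupling_kernel_cong_AE[OF D W0(1,3,2)])
  let ?F = "rhs W0 D f" and ?V = "\<lambda>n. step_kernel n (truncated_kernel (\<alpha> n) W)"
  obtain \<Lambda> where \<Lambda>: "0 < \<Lambda>" "\<And>t u w. norm (?F t u - ?F t w) \<le> \<Lambda> * norm (u - w)"
    using rhs_lipschitz[OF D f W0(3) M(2,1)] by blast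
  have Fc: "continuous_on {0..T} (\<lambda>t. coupling W D (u t) + reaction f t (u t))" if "continuous_on {0..T} u" for u
    unfolding coup rhs_def[symmetric]
    by (rule continuous_on_lipschitz_param[OF \<Lambda>(2) rhs_continuous[OF D f] that])
  have weak: "weak_solution W D f g T w \<longleftrightarrow> w 0 = abs_L2 g \<and>
      (\<forall>t\<in>{0..T}. (w has_vector_derivative ?F t (w t)) (at t within {0..T}))" for w
    unfolding rhs_def coup[symmetric] by (rule weak_solution_iff_classical[OF T_pos Fc])
  obtain u where u: "u 0 = abs_L2 g"
    "\<And>t. t \<in> {0..T} \<Longrightarrow> (u has_vector_derivative ?F t (u t)) (at t within {0..T})"
    using picard_lindelof_global[OF T_pos \<Lambda>(1), of ?F "abs_L2 g"] \<Lambda>(2) rhs_continuous[OF D f] by blast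
  show ?thesis
  proof (intro exI[of _ u] conjI allI impI ballI)
    show "weak_solution W D f g T u"
      using u by (subst weak) auto
  next
    fix w t assume "weak_solution W D f g T w" and t: "t \<in> {0..T}"
    then have w: "w 0 = abs_L2 g"
      "\<And>t. t \<in> {0..T} \<Longrightarrow> (w has_vector_derivative ?F t (w t)) (at t within {0..T})"
      by (auto simp: weak)
    have "norm (w t - u t) \<le> 2 * (norm (w 0 - u 0) + 0 * T) * exp (2 * \<Lambda> * T)"
      by (rule ode_stability[OF \<Lambda>(1) order_refl _ _ t, where w'="\<lambda>t. ?F t (w t) - ?F t (u t)"])
        (use \<Lambda>(2) in \<open>auto intro!: has_vector_derivative_diff w(2) u(2)\<close>)
    then show "w t = u t" using w(1) u(1) by simp
  next
    fix n :: nat assume n: "1 \<le> n"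
    obtain v where "averaged_solution n (\<alpha> n) W D f g T v"
      using averaged_solution_exists[OF D f n T_pos g_L2] by blast
    then show "\<exists>v. averaged_solution n (\<alpha> n) W D f g T v \<and>
      (\<forall>v'. averaged_solution n (\<alpha> n) W D f g T v' \<longrightarrow> (\<forall>t\<in>{0..T}. \<forall>x\<in>{0..1}. v' t x = v t x))"
      using averaged_solution_unique[OF D f n] by blast
  next
    fix v assume v: "\<forall>n\<ge>1. averaged_solution n (\<alpha> n) W D f g T (v n)"
    \<comment> \<open>\<open>\<delta>\<close> is the perturbation term fed into
      \<open>ode_stability\<close>, and \<open>E\<close> the bound which that lemma returns.\<close>
    define \<delta> where "\<delta> n = sqrt (LINT p|leb01_sq. (W0 p - ?V n p)\<^sup>2)" for n
    define E where "E n = 2 * (norm (abs_L2 (step_datum n g) - abs_L2 g) + \<delta> n * T) * exp (2 * \<Lambda> * T)" for n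
    have bound: "norm (abs_L2 (v n t) - u t) \<le> E n" if n: "1 \<le> n" and t: "t \<in> {0..T}" for n t
    proof -
      have vn: "averaged_solution n (\<alpha> n) W D f g T (v n)" using v n by blast
      obtain B where B: "\<And>p. \<bar>?V n p\<bar> \<le> B" using step_kernel_bounded by metis
      have "norm (abs_L2 (v n t) - u t) \<le> 2 * (norm (abs_L2 (v n 0) - u 0) + \<delta> n * T) * exp (2 * \<Lambda> * T)"
      proof (rule ode_stability[OF \<Lambda>(1) _ _ _ t])
        show "0 \<le> \<delta> n" by (simp add: \<delta>_def)
        fix t assume t: "t \<in> {0..T}"
        show "((\<lambda>t. abs_L2 (v n t) - u t) has_vector_derivative
            rhs (?V n) D f t (abs_L2 (v n t)) - ?F t (u t)) (at t within {0..T})"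
          by (intro has_vector_derivative_diff averaged_solution_L2_curve(1)[OF D f n vn t] u(2) t)
        \<comment> \<open>The kernel is exchanged at the state \<open>v n t\<close>, and the state
          is then moved under the fixed kernel \<open>W0\<close>; in this order
          \<open>\<Lambda>\<close> does not depend on \<open>n\<close>.\<close>
        have "norm (rhs (?V n) D f t (abs_L2 (v n t)) - ?F t (u t))
            = norm (- (coupling W0 D (abs_L2 (v n t)) - coupling (?V n) D (abs_L2 (v n t)))
              + (?F t (abs_L2 (v n t)) - ?F t (u t)))"
          by (simp add: rhs_def algebra_simps)
        also have "\<dots> \<le> norm (coupling W0 D (abs_L2 (v n t)) - coupling (?V n) D (abs_L2 (v n t)))
            + norm (?F t (abs_L2 (v n t)) - ?F t (u t))"
          using norm_triangle_ineq[of "- (coupling W0 D (abs_L2 (v n t)) - coupling (?V n) D (abs_L2 (v n t)))"]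
          by (simp only: norm_minus_cancel)
        also have "\<dots> \<le> \<delta> n + \<Lambda> * norm (abs_L2 (v n t) - u t)"
          unfolding \<delta>_def
          by (intro add_mono \<Lambda>(2) coupling_kernel_diff[OF D W0(3)] bounded_kernel(1)[OF step_kernel_measurable B])
        finally show "norm (rhs (?V n) D f t (abs_L2 (v n t)) - ?F t (u t)) \<le> \<delta> n + \<Lambda> * norm (abs_L2 (v n t) - u t)" .
      qed
      moreover have "abs_L2 (v n 0) = abs_L2 (step_datum n g)"
        using averaged_solution_L2_curve(2)[OF D f n vn] T_pos by simp
      ultimately show ?thesis by (simp add: E_def u(1))
    qed
    have "\<delta> \<longlonglongrightarrow> sqrt 0"
      unfolding \<delta>_def[abs_def]
      by (intro tendsto_real_sqrt averaged_kernel_tendsto_L2[OF W_L2 W_nonneg W0(1,2) \<alpha>_pos \<alpha>_tendsto])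
    then have "E \<longlonglongrightarrow> 2 * (norm (abs_L2 g - abs_L2 g) + sqrt 0 * T) * exp (2 * \<Lambda> * T)"
      unfolding E_def[abs_def] by (intro tendsto_intros step_datum_tendsto_L2 g_L2)
    then have E: "E \<longlonglongrightarrow> 0" by simp
    show "(\<lambda>n. C_norm T (\<lambda>t. abs_L2 (v n t) - u t)) \<longlonglongrightarrow> 0"
    proof (rule Lim_null_comparison[OF _ E])
      show "\<forall>\<^sub>F n in sequentially. norm (C_norm T (\<lambda>t. abs_L2 (v n t) - u t)) \<le> E n"
        using eventually_ge_at_top[of 1]
      proof eventually_elim
        case (elim n)
        have "0 \<in> {0..T}" using T_pos by simp
        moreover have "bdd_above ((\<lambda>t. norm (abs_L2 (v n t) - u t)) ` {0..T})"
          by (rule bdd_aboveI2[OF bound[OF elim]])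
        ultimately have "norm (abs_L2 (v n 0) - u 0) \<le> C_norm T (\<lambda>t. abs_L2 (v n t) - u t)"
          unfolding C_norm_def by (intro cSUP_upper)
        then have "0 \<le> C_norm T (\<lambda>t. abs_L2 (v n t) - u t)"
          using norm_ge_zero order_trans by blast
        moreover have "C_norm T (\<lambda>t. abs_L2 (v n t) - u t) \<le> E n"
          unfolding C_norm_def using bound[OF elim] T_pos by (intro cSUP_least) auto
        ultimately show ?case by simp
      qed
    qed
  qed
qed

end
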